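(* Let $Q[1]\oplus B^*[2]$ be a split Lie $2$-algebroid over $M$ with structure objects $(\rho_Q,\ell,[\cdot,\cdot],\nabla,\omega)$. Choose arbitrary $TM$-connections on $Q$ and on $B^*$, both denoted $\nabla$. Then $Q[1]\oplus B^*[2]$ has a $3$-term representation up to homotopy on $B^*[2]\oplus Q[1]\oplus TM[0]$ with the following structure objects (for $\beta\in\Gamma(B^* )$, $q,q_1,q_2,q_3\in\Gamma(Q)$, $X\in\mathfrak X(M)$): (i) the complex (adjoint complex) $B^*[2]\to Q[1]\to TM[0]$ with maps $-\ell$ and $\rho_Q$; (ii) the two $Q$-connections $\nabla^{\mathrm{bas}}$ on $Q$ and on $TM$, and the $Q$-connection $\nabla^*$ on $B^*$ given by the split Lie $2$-algebroid; (iii) the element $\omega_2\in\Omega^2(Q,\mathrm{Hom}(Q,B^* )\oplus\mathrm{Hom}(TM,Q))$ defined by $\omega_2(q_1,q_2)q_3=-\omega(q_1,q_2,q_3)\in\Gamma(B^* )$ and $\omega_2(q_1,q_2)X=-R^{\mathrm{bas}}_\nabla(q_1,q_2)X\in\Gamma(Q)$; (iv) the element $\omega_3\in\Omega^3(Q,\mathrm{Hom}(TM,B^* ))$ defined by $\omega_3(q_1,q_2,q_3)X=-(\nabla_X\omega)(q_1,q_2,q_3)\in\Gamma(B^* )$; (v) the element $\phi_0\in\Gamma(B)\otimes(\mathrm{Hom}(Q,B^* )\oplus\mathrm{Hom}(TM,Q))$ defined by $\phi_0(\beta)X=\ell(\nabla_X\beta)-\nabla_X(\ell(\beta))\in\Gamma(Q)$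 and $\phi_0(\beta)q=\nabla_{\rho_Q(q)}\beta-\nabla^*_q\beta\in\Gamma(B^* )$; (vi) the element $\phi_1\in\Gamma(B)\otimes\Omega^1(Q,\mathrm{Hom}(TM,B^* ))$ defined by $\phi_1(\beta,q)X=\nabla_X\nabla^*_q\beta-\nabla^*_q\nabla_X\beta-\nabla^*_{\nabla_Xq}\beta+\nabla_{\nabla^{\mathrm{bas}}_qX}\beta\in\Gamma(B^* )$.
   Context: A split Lie $2$-algebroid $Q[1]\oplus B^*[2]$ over $M$ consists of vector bundles $Q,B\to M$, a bundle map $\rho_Q\colon Q\to TM$, a bundle map $\ell\colon B^*\to Q$, a skew-symmetric dull bracket $[\cdot,\cdot]$ on $\Gamma(Q)$ (i.e. $\mathbb R$-bilinear, $[q_1,fq_2]=f[q_1,q_2]+(\rho_Q(q_1)f)q_2$, $\rho_Q[q_1,q_2]=[\rho_Q(q_1),\rho_Q(q_2)]$), a linear $Q$-connection $\nabla$ on $B$ (dual connection $\nabla^*$ on $B^*$), and $\omega\in\Omega^3(Q,B^* )=\Gamma(\wedge^3Q^*\otimes B^* )$, such that for all sections: (i) $\nabla^*_{\ell(\beta_1)}\beta_2+\nabla^*_{\ell(\beta_2)}\beta_1=0$; (ii) $[q,\ell(\beta)]=\ell(\nabla^*_q\beta)$; (iii) $[q_1,[q_2,q_3]]-[[q_1,q_2],q_3]-[q_2,[q_1,q_3]]=\ell(\omega(q_1,q_2,q_3))$; (iv) $R_{\nabla^*}(q_1,q_2)\beta=-\omega(q_1,q_2,\ell(\beta))$; (v)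 $\mathrm d_{\nabla^*}\omega=0$. Write $\partial_B=\ell^*\colon Q^*\to B$. Functions: $\mathcal C^\infty(\mathcal M)=\Gamma(\wedge^\bullet Q^*\otimes S^\bullet B)$, $Q^*$ in degree $1$, $B$ in degree $2$; homological vector field: $\mathcal Q(f)=\rho_Q^*\mathrm df$, $\mathcal Q(\tau)=\mathrm d_Q\tau+\partial_B\tau$, $\mathcal Q(b)=\mathrm d_\nabla b-\langle\omega,b\rangle$ for $f\in C^\infty(M)$, $\tau\in\Gamma(Q^* )$, $b\in\Gamma(B)$ (Koszul formulas for $\mathrm d_Q,\mathrm d_\nabla$). In $E[k]$ sections of $E$ have degree $-k$. A representation up to homotopy on a graded vector bundle $\underline E$ is a degree $1$ operator $\mathcal D$ on $\mathcal C^\infty(\mathcal M)\otimes_{C^\infty(M)}\Gamma(\underline E)$ with $\mathcal D^2=0$ and $\mathcal D(\xi\eta)=\mathcal Q(\xi)\eta+(-1)^{|\xi|}\xi\mathcal D(\eta)$. Saying that it has structure objects $(\partial,\nabla,\omega_2,\omega_3,\phi_0,\phi_1)$ means $\mathcal D(e)=\partial(e)+\mathrm d_\nabla e+\omega_2(\cdot,\cdot)e+\omega_3(\cdot,\cdot,\cdot)e+\phi_0(\cdot)e+\phi_1(\cdot,\cdot)e$ for $e\in\Gamma(\underline E)$, where the argument $\beta$ in $\phi_0(\beta)$, $\phi_1(\beta,q)$ is paired with the factor $\Gamma(B)$. Given the $TM$-connection $\nabla$ on $Q$, the basic connections and basic curvature are $\nabla^{\mathrm{bas}}_{q_1}q_2=[q_1,q_2]+\nabla_{\rho_Q(q_2)}q_1$,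 $\nabla^{\mathrm{bas}}_qX=[\rho_Q(q),X]+\rho_Q(\nabla_Xq)$, and $R^{\mathrm{bas}}_\nabla(q_1,q_2)X=-\nabla_X[q_1,q_2]+[q_1,\nabla_Xq_2]+[\nabla_Xq_1,q_2]+\nabla_{\nabla^{\mathrm{bas}}_{q_2}X}q_1-\nabla_{\nabla^{\mathrm{bas}}_{q_1}X}q_2$. $\nabla_X\omega$ is the covariant derivative of $\omega\in\Gamma(\wedge^3Q^*\otimes B^* )$ for the chosen $TM$-connections on $Q$ and $B^*$.
   Formalization: Two signs are corrected, since the statement is false as given: axiom (iii) reads [q1,[q2,q3]]-[[q1,q2],q3]-[q2,[q1,q3]] = -ℓ(ω(q1,q2,q3)), and structure object (iv) reads ω_3(q1,q2,q3)X = +(∇_X ω)(q1,q2,q3). *)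

theory Defs
  imports "HOL-Analysis.Analysis" "HOL-Library.Function_Algebras" "HOL-Library.Multiset"
begin

section \<open>Smooth manifolds and smooth functions\<close>

text \<open>
  The model space is \<^const>\<open>Euclidean_space\<close> \<open>n\<close>, so that \<open>n = 0\<close> is allowed.
  \<open>Ck_on n k V f\<close>: all iterated partial derivatives of \<open>f\<close> of order at most \<open>k\<close> exist and are
  continuous on the open set \<open>V\<close>.
\<close>

primrec Ck_on :: "nat \<Rightarrow> nat \<Rightarrow> (nat \<Rightarrow> real) set \<Rightarrow> ((nat \<Rightarrow> real) \<Rightarrow> real) \<Rightarrow> bool" where
  "Ck_on n 0 V f \<longleftrightarrow> continuous_map (subtopology (Euclidean_space n) V) euclideanreal f"
| "Ck_on n (Suc k) V f \<longleftrightarrow>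
     continuous_map (subtopology (Euclidean_space n) V) euclideanreal f \<and>
     (\<exists>g. \<forall>i<n. (\<forall>x\<in>V. ((\<lambda>t. f (x(i := t))) has_real_derivative g i x) (at (x i))) \<and>
               Ck_on n k V (g i))"

definition smooth_Rn :: "nat \<Rightarrow> (nat \<Rightarrow> real) set \<Rightarrow> ((nat \<Rightarrow> real) \<Rightarrow> real) \<Rightarrow> bool" where
  "smooth_Rn n V f \<longleftrightarrow> (\<forall>k. Ck_on n k V f)"

record 'm manifold =
  mdim :: nat
  charts :: "('m set \<times> ('m \<Rightarrow> nat \<Rightarrow> real)) set"

definition smooth_manifold :: "'m::{t2_space,second_countable_topology} manifold \<Rightarrow> bool" where
  "smooth_manifold M \<longleftrightarrow>
     (\<forall>(U, \<phi>)\<in>charts M. open U \<and> openin (Euclidean_space (mdim M)) (\<phi> ` U) \<and>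
        homeomorphic_map (top_of_set U) (subtopology (Euclidean_space (mdim M)) (\<phi> ` U)) \<phi>) \<and>
     (\<Union>(U, \<phi>)\<in>charts M. U) = UNIV \<and>
     (\<forall>(U, \<phi>)\<in>charts M. \<forall>(V, \<psi>)\<in>charts M. \<forall>i<mdim M.
        smooth_Rn (mdim M) (\<phi> ` (U \<inter> V)) (\<lambda>x. \<psi> (inv_into U \<phi> x) i))"

definition smooth_fun_on :: "'m manifold \<Rightarrow> 'm set \<Rightarrow> ('m \<Rightarrow> real) \<Rightarrow> bool" where
  "smooth_fun_on M W f \<longleftrightarrow>
     (\<forall>(U, \<phi>)\<in>charts M. smooth_Rn (mdim M) (\<phi> ` (U \<inter> W)) (\<lambda>x. f (inv_into U \<phi> x)))"


section \<open>Modules over the smooth functions\<close>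

text \<open>
  Addition of sections, of operators on sections and of tuples of such is the pointwise addition
  of \<^theory>\<open>HOL-Library.Function_Algebras\<close> and \<^theory>\<open>HOL-Library.Product_Plus\<close>; only the carrier and
  the multiplication by functions on \<open>M\<close> have to be recorded.
\<close>

record ('m, 'a) fmodule =
  elems :: "'a set"
  scl :: "('m \<Rightarrow> real) \<Rightarrow> 'a \<Rightarrow> 'a"

definition pscale :: "('m \<Rightarrow> real) \<Rightarrow> ('m \<Rightarrow> 'v::real_vector) \<Rightarrow> 'm \<Rightarrow> 'v" where
  "pscale f s = (\<lambda>p. f p *\<^sub>R s p)"

definition smooth_funs :: "'m manifold \<Rightarrow> ('m, 'm \<Rightarrow> real) fmodule" where
  "smooth_funs M = \<lparr>elems = {f. smooth_fun_on M UNIV f}, scl = pscale\<rparr>"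

definition linear_over :: "'m manifold \<Rightarrow> ('m, 'a::ab_group_add) fmodule \<Rightarrow>
    ('m, 'c::ab_group_add) fmodule \<Rightarrow> ('a \<Rightarrow> 'c) \<Rightarrow> bool" where
  "linear_over M S T F \<longleftrightarrow>
     (\<forall>x\<in>elems S. F x \<in> elems T) \<and>
     (\<forall>x\<in>elems S. \<forall>y\<in>elems S. F (x + y) = F x + F y) \<and>
     (\<forall>f\<in>elems (smooth_funs M). \<forall>x\<in>elems S. F (scl S f x) = scl T f (F x))"

text \<open>Linear maps to functions; the value outside the carrier is normalised to \<open>0\<close>.\<close>

definition dual_module :: "'m manifold \<Rightarrow> ('m, 'a::ab_group_add) fmodule \<Rightarrow>
    ('m, 'a \<Rightarrow> 'm \<Rightarrow> real) fmodule" where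
  "dual_module M S =
     \<lparr>elems = {\<beta>. linear_over M S (smooth_funs M) \<beta> \<and> (\<forall>x. x \<notin> elems S \<longrightarrow> \<beta> x = 0)},
      scl = (\<lambda>f \<beta> x. pscale f (\<beta> x))\<rparr>"


section \<open>Vector fields\<close>

text \<open>Vector fields are the real-linear derivations of the algebra of smooth functions.\<close>

type_synonym 'm vfield = "('m \<Rightarrow> real) \<Rightarrow> ('m \<Rightarrow> real)"

definition vector_fields :: "'m manifold \<Rightarrow> ('m, 'm vfield) fmodule" where
  "vector_fields M =
     \<lparr>elems = {X. (\<forall>f\<in>elems (smooth_funs M). X f \<in> elems (smooth_funs M)) \<and>
                 (\<forall>f\<in>elems (smooth_funs M). \<forall>g\<in>elems (smooth_funs M). X (f + g) = X f + X g) \<and>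
                 (\<forall>c. \<forall>f\<in>elems (smooth_funs M). X (\<lambda>p. c * f p) = (\<lambda>p. c * X f p)) \<and>
                 (\<forall>f\<in>elems (smooth_funs M). \<forall>g\<in>elems (smooth_funs M).
                    X (f * g) = X f * g + f * X g) \<and>
                 (\<forall>f. f \<notin> elems (smooth_funs M) \<longrightarrow> X f = 0)},
      scl = (\<lambda>f X g. pscale f (X g))\<rparr>"

definition lie_bracket :: "'m vfield \<Rightarrow> 'm vfield \<Rightarrow> 'm vfield" where
  "lie_bracket X Y = (\<lambda>f. X (Y f) - Y (X f))"


section \<open>Vector bundles and their sections\<close>

text \<open>
  The fibre over \<open>p\<close> is a linear subspace of an ambient real vector space \<open>'v\<close>. No topology on
  \<open>'v\<close> is involved, so up to isomorphism this is no restriction. A local trivialisation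
  over \<open>U\<close> is given by linear isomorphisms \<open>t p\<close> from the fibres onto the standard space of
  dimension \<open>brank E\<close>.
\<close>

record ('m, 'v) vbundle =
  brank :: nat
  fibre :: "'m \<Rightarrow> 'v set"
  trivs :: "('m set \<times> ('m \<Rightarrow> 'v \<Rightarrow> nat \<Rightarrow> real)) set"

definition vector_bundle :: "'m::topological_space manifold \<Rightarrow> ('m, 'v::real_vector) vbundle \<Rightarrow> bool" where
  "vector_bundle M E \<longleftrightarrow>
     (\<forall>p. subspace (fibre E p)) \<and>
     (\<Union>(U, t)\<in>trivs E. U) = UNIV \<and>
     (\<forall>(U, t)\<in>trivs E. open U \<and>
        (\<forall>p\<in>U. bij_betw (t p) (fibre E p) (topspace (Euclidean_space (brank E))) \<and>
           (\<forall>v\<in>fibre E p. \<forall>w\<in>fibre E p. \<forall>a b i.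
              t p (a *\<^sub>R v + b *\<^sub>R w) i = a * t p v i + b * t p w i))) \<and>
     (\<forall>(U, t)\<in>trivs E. \<forall>(V, u)\<in>trivs E. \<forall>x\<in>topspace (Euclidean_space (brank E)). \<forall>i<brank E.
        smooth_fun_on M (U \<inter> V) (\<lambda>p. u p (inv_into (fibre E p) (t p) x) i))"

definition sections :: "'m manifold \<Rightarrow> ('m, 'v::real_vector) vbundle \<Rightarrow> ('m, 'm \<Rightarrow> 'v) fmodule" where
  "sections M E =
     \<lparr>elems = {s. (\<forall>p. s p \<in> fibre E p) \<and>
                 (\<forall>(U, t)\<in>trivs E. \<forall>i<brank E. smooth_fun_on M U (\<lambda>p. t p (s p) i))},
      scl = pscale\<rparr>"

text \<open>
  A connection on the bundle with section module \<open>S\<close>, along the anchored bundle with section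
  module \<open>V\<close> and anchor \<open>\<rho>\<close>. Real-linearity in \<open>s\<close> is the Leibniz rule for constant \<open>f\<close>.
\<close>

definition connection :: "'m manifold \<Rightarrow> ('m, 'a::ab_group_add) fmodule \<Rightarrow> ('a \<Rightarrow> 'm vfield) \<Rightarrow>
    ('m, 's::ab_group_add) fmodule \<Rightarrow> ('a \<Rightarrow> 's \<Rightarrow> 's) \<Rightarrow> bool" where
  "connection M V \<rho> S nab \<longleftrightarrow>
     (\<forall>s\<in>elems S. linear_over M V S (\<lambda>x. nab x s)) \<and>
     (\<forall>x\<in>elems V. \<forall>s\<in>elems S. \<forall>s'\<in>elems S. nab x (s + s') = nab x s + nab x s') \<and>
     (\<forall>x\<in>elems V. \<forall>f\<in>elems (smooth_funs M). \<forall>s\<in>elems S.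
        nab x (scl S f s) = scl S f (nab x s) + scl S (\<rho> x f) s)"

abbreviation TM_connection :: "'m manifold \<Rightarrow> ('m, 's::ab_group_add) fmodule \<Rightarrow>
    ('m vfield \<Rightarrow> 's \<Rightarrow> 's) \<Rightarrow> bool" where
  "TM_connection M S nab \<equiv> connection M (vector_fields M) (\<lambda>X. X) S nab"


section \<open>Split Lie 2-algebroids\<close>

text \<open>
  Throughout, sections of a bundle built from \<open>Q\<close>, \<open>B\<close> and \<open>TM\<close> by dualisation, tensor products
  and Hom are represented by the corresponding multilinear maps over the smooth functions;
  likewise vector bundle morphisms by the linear maps they induce on sections.
  In particular a section of \<open>B\<^sup>*\<close> is a linear map from sections of \<open>B\<close> to functions.
\<close>

type_synonym ('m, 'b) dsection = "('m \<Rightarrow> 'b) \<Rightarrow> ('m \<Rightarrow> real)"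

record ('m, 'q, 'b) split_data =
  base :: "'m manifold"
  bundleQ :: "('m, 'q) vbundle"
  bundleB :: "('m, 'b) vbundle"
  anchor :: "('m \<Rightarrow> 'q) \<Rightarrow> 'm vfield"
  ell :: "('m, 'b) dsection \<Rightarrow> ('m \<Rightarrow> 'q)"
  brk :: "('m \<Rightarrow> 'q) \<Rightarrow> ('m \<Rightarrow> 'q) \<Rightarrow> ('m \<Rightarrow> 'q)"
  nabB :: "('m \<Rightarrow> 'q) \<Rightarrow> ('m \<Rightarrow> 'b) \<Rightarrow> ('m \<Rightarrow> 'b)"
  omega :: "('m \<Rightarrow> 'q) \<Rightarrow> ('m \<Rightarrow> 'q) \<Rightarrow> ('m \<Rightarrow> 'q) \<Rightarrow> ('m, 'b) dsection"

definition Cinf :: "('m, 'q, 'b) split_data \<Rightarrow> ('m, 'm \<Rightarrow> real) fmodule" where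
  "Cinf L = smooth_funs (base L)"

definition secX :: "('m, 'q, 'b) split_data \<Rightarrow> ('m, 'm vfield) fmodule" where
  "secX L = vector_fields (base L)"

definition secQ :: "('m, 'q::real_vector, 'b) split_data \<Rightarrow> ('m, 'm \<Rightarrow> 'q) fmodule" where
  "secQ L = sections (base L) (bundleQ L)"

definition secB :: "('m, 'q, 'b::real_vector) split_data \<Rightarrow> ('m, 'm \<Rightarrow> 'b) fmodule" where
  "secB L = sections (base L) (bundleB L)"

definition secBd :: "('m, 'q, 'b::real_vector) split_data \<Rightarrow> ('m, ('m, 'b) dsection) fmodule" where
  "secBd L = dual_module (base L) (secB L)"

definition nabBd :: "('m, 'q, 'b::real_vector) split_data \<Rightarrow> ('m \<Rightarrow> 'q) \<Rightarrow>
    ('m, 'b) dsection \<Rightarrow> ('m, 'b) dsection" where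
  "nabBd L q \<beta> = (\<lambda>b. if b \<in> elems (secB L) then anchor L q (\<beta> b) - \<beta> (nabB L q b) else 0)"

definition curvBd :: "('m, 'q, 'b::real_vector) split_data \<Rightarrow> ('m \<Rightarrow> 'q) \<Rightarrow> ('m \<Rightarrow> 'q) \<Rightarrow>
    ('m, 'b) dsection \<Rightarrow> ('m, 'b) dsection" where
  "curvBd L q1 q2 \<beta> =
     nabBd L q1 (nabBd L q2 \<beta>) - nabBd L q2 (nabBd L q1 \<beta>) - nabBd L (brk L q1 q2) \<beta>"

definition dull_bracket :: "('m, 'q::real_vector, 'b) split_data \<Rightarrow> bool" where
  "dull_bracket L \<longleftrightarrow>
     (\<forall>q\<in>elems (secQ L). \<forall>r\<in>elems (secQ L).
        brk L q r \<in> elems (secQ L) \<and> brk L q r = - brk L r q \<and>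
        (\<forall>r'\<in>elems (secQ L). brk L q (r + r') = brk L q r + brk L q r') \<and>
        (\<forall>c. brk L q (\<lambda>p. c *\<^sub>R r p) = (\<lambda>p. c *\<^sub>R brk L q r p)) \<and>
        (\<forall>f\<in>elems (Cinf L). brk L q (pscale f r) = pscale f (brk L q r) + pscale (anchor L q f) r) \<and>
        anchor L (brk L q r) = lie_bracket (anchor L q) (anchor L r))"

definition three_form_Bd :: "('m, 'q::real_vector, 'b::real_vector) split_data \<Rightarrow> bool" where
  "three_form_Bd L \<longleftrightarrow>
     (\<forall>q\<in>elems (secQ L). \<forall>r\<in>elems (secQ L).
        linear_over (base L) (secQ L) (secBd L) (\<lambda>x. omega L x q r) \<and>
        linear_over (base L) (secQ L) (secBd L) (\<lambda>x. omega L q x r) \<and>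
        linear_over (base L) (secQ L) (secBd L) (\<lambda>x. omega L q r x) \<and>
        (\<forall>s\<in>elems (secQ L). omega L r q s = - omega L q r s \<and> omega L q s r = - omega L q r s))"

text \<open>Koszul formula for the covariant exterior derivative of \<open>\<omega>\<close>.\<close>

definition d_omega :: "('m, 'q, 'b::real_vector) split_data \<Rightarrow> ('m \<Rightarrow> 'q) \<Rightarrow> ('m \<Rightarrow> 'q) \<Rightarrow>
    ('m \<Rightarrow> 'q) \<Rightarrow> ('m \<Rightarrow> 'q) \<Rightarrow> ('m, 'b) dsection" where
  "d_omega L q1 q2 q3 q4 =
     nabBd L q1 (omega L q2 q3 q4) - nabBd L q2 (omega L q1 q3 q4)
   + nabBd L q3 (omega L q1 q2 q4) - nabBd L q4 (omega L q1 q2 q3)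
   - omega L (brk L q1 q2) q3 q4 + omega L (brk L q1 q3) q2 q4 - omega L (brk L q1 q4) q2 q3
   - omega L (brk L q2 q3) q1 q4 + omega L (brk L q2 q4) q1 q3 - omega L (brk L q3 q4) q1 q2"

text \<open>
  Sign of the Jacobi identity: the cyclic sum \<open>[[q1,q2],q3] + [[q2,q3],q1] + [[q3,q1],q2]\<close> equals
  \<open>\<ell>(\<omega>(q1,q2,q3))\<close>, that is, the Leibniz form of the Jacobiator below equals \<open>-\<ell>(\<omega>(q1,q2,q3))\<close>.
  Inserting \<open>q3 = \<ell>(\<beta>)\<close> and using \<open>[q,\<ell>(\<beta>)] = \<ell>(\<nabla>\<^sup>*\<^sub>q \<beta>)\<close>, this is the sign compatible with
  \<open>R(q1,q2)\<beta> = -\<omega>(q1,q2,\<ell>(\<beta>))\<close>; it is also equivalent to the vanishing of the square of the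
  homological vector field on sections of \<open>Q\<^sup>*\<close>.
\<close>

definition split_lie_2_algebroid ::
    "('m::{t2_space,second_countable_topology}, 'q::real_vector, 'b::real_vector) split_data \<Rightarrow> bool" where
  "split_lie_2_algebroid L \<longleftrightarrow>
     smooth_manifold (base L) \<and> vector_bundle (base L) (bundleQ L) \<and> vector_bundle (base L) (bundleB L) \<and>
     linear_over (base L) (secQ L) (secX L) (anchor L) \<and>
     linear_over (base L) (secBd L) (secQ L) (ell L) \<and>
     dull_bracket L \<and>
     connection (base L) (secQ L) (anchor L) (secB L) (nabB L) \<and>
     three_form_Bd L \<and>
     (\<forall>\<beta>1\<in>elems (secBd L). \<forall>\<beta>2\<in>elems (secBd L).
        nabBd L (ell L \<beta>1) \<beta>2 + nabBd L (ell L \<beta>2) \<beta>1 = 0) \<and>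
     (\<forall>q\<in>elems (secQ L). \<forall>\<beta>\<in>elems (secBd L). brk L q (ell L \<beta>) = ell L (nabBd L q \<beta>)) \<and>
     (\<forall>q1\<in>elems (secQ L). \<forall>q2\<in>elems (secQ L). \<forall>q3\<in>elems (secQ L).
        brk L q1 (brk L q2 q3) - brk L (brk L q1 q2) q3 - brk L q2 (brk L q1 q3)
          = - ell L (omega L q1 q2 q3)) \<and>
     (\<forall>q1\<in>elems (secQ L). \<forall>q2\<in>elems (secQ L). \<forall>\<beta>\<in>elems (secBd L).
        curvBd L q1 q2 \<beta> = - omega L q1 q2 (ell L \<beta>)) \<and>
     (\<forall>q1\<in>elems (secQ L). \<forall>q2\<in>elems (secQ L). \<forall>q3\<in>elems (secQ L). \<forall>q4\<in>elems (secQ L).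
        d_omega L q1 q2 q3 q4 = 0)"


section \<open>Functions on the graded manifold and forms with values in a module\<close>

text \<open>
  \<open>forms L S\<close> is the space of sections of \<open>\<wedge>Q\<^sup>* \<otimes> SB \<otimes> E\<close>, where \<open>S\<close> is the module of sections
  of \<open>E\<close>. The component of \<open>\<eta>\<close> in \<open>\<wedge>\<^sup>kQ\<^sup>* \<otimes> S\<^sup>lB \<otimes> E\<close> is the restriction of \<open>\<eta>\<close> to
  \<open>k\<close> sections of \<open>Q\<close> and \<open>l\<close> sections of \<open>B\<^sup>*\<close>, alternating in the former and symmetric in the
  latter; only finitely many components are nonzero.
\<close>

type_synonym ('m, 'q, 'b, 'e) form = "('m \<Rightarrow> 'q) list \<Rightarrow> ('m, 'b) dsection list \<Rightarrow> 'e"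

definition forms :: "('m, 'q::real_vector, 'b::real_vector) split_data \<Rightarrow>
    ('m, 'e::ab_group_add) fmodule \<Rightarrow> ('m, 'q, 'b, 'e) form set" where
  "forms L S = {\<eta>.
     (\<forall>qs bs. \<not> (set qs \<subseteq> elems (secQ L) \<and> set bs \<subseteq> elems (secBd L)) \<longrightarrow> \<eta> qs bs = 0) \<and>
     (\<forall>qs bs. set qs \<subseteq> elems (secQ L) \<and> set bs \<subseteq> elems (secBd L) \<longrightarrow>
        \<eta> qs bs \<in> elems S \<and>
        (\<not> distinct qs \<longrightarrow> \<eta> qs bs = 0) \<and>
        (\<forall>bs'. mset bs' = mset bs \<longrightarrow> \<eta> qs bs' = \<eta> qs bs) \<and>
        (\<forall>i<length qs. linear_over (base L) (secQ L) S (\<lambda>q. \<eta> (qs[i := q]) bs)) \<and>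
        (\<forall>i<length bs. linear_over (base L) (secBd L) S (\<lambda>\<beta>. \<eta> qs (bs[i := \<beta>])))) \<and>
     (\<exists>N. \<forall>qs bs. N < length qs + length bs \<longrightarrow> \<eta> qs bs = 0)}"

definition on_sections :: "('m, 'q::real_vector, 'b::real_vector) split_data \<Rightarrow>
    ('m, 'q, 'b, 'e::zero) form \<Rightarrow> ('m, 'q, 'b, 'e) form" where
  "on_sections L g =
     (\<lambda>qs bs. if set qs \<subseteq> elems (secQ L) \<and> set bs \<subseteq> elems (secBd L) then g qs bs else 0)"

definition const_form :: "'e::zero \<Rightarrow> ('m, 'q, 'b, 'e) form" where
  "const_form e = (\<lambda>qs bs. if qs = [] \<and> bs = [] then e else 0)"

text \<open>
  A grading of a module is given by its homogeneous parts \<open>G i\<close>. In \<open>\<wedge>\<^sup>kQ\<^sup>* \<otimes> S\<^sup>lB \<otimes> E\<close> an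
  element of \<open>E\<close> of degree \<open>i\<close> contributes total degree \<open>k + 2l + i\<close>.
\<close>

definition hom_forms :: "('m, 'q::real_vector, 'b::real_vector) split_data \<Rightarrow>
    ('m, 'e::ab_group_add) fmodule \<Rightarrow> (int \<Rightarrow> 'e set) \<Rightarrow> int \<Rightarrow> ('m, 'q, 'b, 'e) form set" where
  "hom_forms L S G j =
     {\<eta> \<in> forms L S. \<forall>qs bs. \<eta> qs bs \<in> G (j - int (length qs) - 2 * int (length bs))}"

definition funs_grading :: "('m, 'q, 'b) split_data \<Rightarrow> int \<Rightarrow> ('m \<Rightarrow> real) set" where
  "funs_grading L i = (if i = 0 then elems (Cinf L) else {0})"

definition signed :: "int \<Rightarrow> 'a::ab_group_add \<Rightarrow> 'a" where
  "signed i x = (if even i then x else - x)"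

text \<open>
  The product of a function on the graded manifold with a form, as a sum over shuffles:
  \<open>I\<close> and \<open>J\<close> are the positions of the arguments of \<open>\<xi>\<close>, and \<open>inversions I\<close> is the number of
  inversions of the permutation listing \<open>I\<close> before its complement.
\<close>

definition inversions :: "nat set \<Rightarrow> nat" where
  "inversions I = card {(i, j). i \<in> I \<and> j \<notin> I \<and> j < i}"

definition form_mult :: "('m, 'e::ab_group_add) fmodule \<Rightarrow> ('m, 'q, 'b, 'm \<Rightarrow> real) form \<Rightarrow>
    ('m, 'q, 'b, 'e) form \<Rightarrow> ('m, 'q, 'b, 'e) form" where
  "form_mult S \<xi> \<eta> =
     (\<lambda>qs bs. \<Sum>I\<in>Pow {..<length qs}. \<Sum>J\<in>Pow {..<length bs}.
        signed (int (inversions I))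
          (scl S (\<xi> (nths qs I) (nths bs J)) (\<eta> (nths qs (- I)) (nths bs (- J)))))"

definition degree_one_derivation :: "('m, 'q::real_vector, 'b::real_vector) split_data \<Rightarrow>
    ('m, 'e::ab_group_add) fmodule \<Rightarrow> (int \<Rightarrow> 'e set) \<Rightarrow>
    (('m, 'q, 'b, 'm \<Rightarrow> real) form \<Rightarrow> ('m, 'q, 'b, 'm \<Rightarrow> real) form) \<Rightarrow>
    (('m, 'q, 'b, 'e) form \<Rightarrow> ('m, 'q, 'b, 'e) form) \<Rightarrow> bool" where
  "degree_one_derivation L S G \<Q> \<D> \<longleftrightarrow>
     (\<forall>j. \<forall>\<eta>\<in>hom_forms L S G j. \<D> \<eta> \<in> hom_forms L S G (j + 1)) \<and>
     (\<forall>\<eta>\<in>forms L S. \<forall>\<eta>'\<in>forms L S. \<D> (\<eta> + \<eta>') = \<D> \<eta> + \<D> \<eta>') \<and>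
     (\<forall>i. \<forall>\<xi>\<in>hom_forms L (Cinf L) (funs_grading L) i. \<forall>\<eta>\<in>forms L S.
        \<D> (form_mult S \<xi> \<eta>) = form_mult S (\<Q> \<xi>) \<eta> + signed i (form_mult S \<xi> (\<D> \<eta>)))"

text \<open>
  The homological vector field: \<open>\<Q>(f) = \<rho>\<^sup>*df\<close>, \<open>\<Q>(\<tau>) = d\<^sub>Q\<tau> + \<partial>\<^sub>B\<tau>\<close> with \<open>\<partial>\<^sub>B = \<ell>\<^sup>*\<close> and
  \<open>\<Q>(b) = d\<^sub>\<nabla>b - \<langle>\<omega>,b\<rangle>\<close>. Functions, sections \<open>\<tau>\<close> of \<open>Q\<^sup>*\<close> and sections \<open>b\<close> of \<open>B\<close>
  generate the algebra, so at most one \<open>\<Q>\<close> (up to its values outside of the algebra) satisfies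
  this predicate.
\<close>

definition homological_vector_field :: "('m, 'q::real_vector, 'b::real_vector) split_data \<Rightarrow>
    (('m, 'q, 'b, 'm \<Rightarrow> real) form \<Rightarrow> ('m, 'q, 'b, 'm \<Rightarrow> real) form) \<Rightarrow> bool" where
  "homological_vector_field L \<Q> \<longleftrightarrow>
     degree_one_derivation L (Cinf L) (funs_grading L) \<Q> \<Q> \<and>
     (\<forall>\<xi>\<in>forms L (Cinf L). \<Q> (\<Q> \<xi>) = 0) \<and>
     (\<forall>f\<in>elems (Cinf L).
        \<Q> (const_form f) =
          on_sections L (\<lambda>qs bs. case (qs, bs) of ([q], []) \<Rightarrow> anchor L q f | _ \<Rightarrow> 0)) \<and>
     (\<forall>\<tau>\<in>elems (dual_module (base L) (secQ L)).
        \<Q> (on_sections L (\<lambda>qs bs. case (qs, bs) of ([q], []) \<Rightarrow> \<tau> q | _ \<Rightarrow> 0)) =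
          on_sections L (\<lambda>qs bs. case (qs, bs) of
              ([q1, q2], []) \<Rightarrow> anchor L q1 (\<tau> q2) - anchor L q2 (\<tau> q1) - \<tau> (brk L q1 q2)
            | ([], [\<beta>]) \<Rightarrow> \<tau> (ell L \<beta>)
            | _ \<Rightarrow> 0)) \<and>
     (\<forall>b\<in>elems (secB L).
        \<Q> (on_sections L (\<lambda>qs bs. case (qs, bs) of ([], [\<beta>]) \<Rightarrow> \<beta> b | _ \<Rightarrow> 0)) =
          on_sections L (\<lambda>qs bs. case (qs, bs) of
              ([q], [\<beta>]) \<Rightarrow> \<beta> (nabB L q b)
            | ([q1, q2, q3], []) \<Rightarrow> - omega L q1 q2 q3 b
            | _ \<Rightarrow> 0))"


section \<open>Representations up to homotopy\<close>

definition rep_up_to_homotopy :: "('m, 'q::real_vector, 'b::real_vector) split_data \<Rightarrow>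
    (('m, 'q, 'b, 'm \<Rightarrow> real) form \<Rightarrow> ('m, 'q, 'b, 'm \<Rightarrow> real) form) \<Rightarrow>
    ('m, 'e::ab_group_add) fmodule \<Rightarrow> (int \<Rightarrow> 'e set) \<Rightarrow>
    (('m, 'q, 'b, 'e) form \<Rightarrow> ('m, 'q, 'b, 'e) form) \<Rightarrow> bool" where
  "rep_up_to_homotopy L \<Q> S G \<D> \<longleftrightarrow>
     degree_one_derivation L S G \<Q> \<D> \<and> (\<forall>\<eta>\<in>forms L S. \<D> (\<D> \<eta>) = 0)"

text \<open>
  That the structure objects are tensorial, alternating and of the right degree (and that the
  second one is a connection) is implied, since \<open>\<D>\<close> is a derivation mapping forms to forms.
\<close>

definition has_structure_objects :: "('m, 'q::real_vector, 'b::real_vector) split_data \<Rightarrow>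
    ('m, 'e::ab_group_add) fmodule \<Rightarrow> (('m, 'q, 'b, 'e) form \<Rightarrow> ('m, 'q, 'b, 'e) form) \<Rightarrow>
    ('e \<Rightarrow> 'e) \<Rightarrow>
    (('m \<Rightarrow> 'q) \<Rightarrow> 'e \<Rightarrow> 'e) \<Rightarrow>
    (('m \<Rightarrow> 'q) \<Rightarrow> ('m \<Rightarrow> 'q) \<Rightarrow> 'e \<Rightarrow> 'e) \<Rightarrow>
    (('m \<Rightarrow> 'q) \<Rightarrow> ('m \<Rightarrow> 'q) \<Rightarrow> ('m \<Rightarrow> 'q) \<Rightarrow> 'e \<Rightarrow> 'e) \<Rightarrow>
    (('m, 'b) dsection \<Rightarrow> 'e \<Rightarrow> 'e) \<Rightarrow>
    (('m, 'b) dsection \<Rightarrow> ('m \<Rightarrow> 'q) \<Rightarrow> 'e \<Rightarrow> 'e) \<Rightarrow> bool" where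
  "has_structure_objects L S \<D> del nab w2 w3 \<phi>0 \<phi>1 \<longleftrightarrow>
     (\<forall>e\<in>elems S. \<D> (const_form e) =
        on_sections L (\<lambda>qs bs. case (qs, bs) of
            ([], []) \<Rightarrow> del e
          | ([q], []) \<Rightarrow> nab q e
          | ([q1, q2], []) \<Rightarrow> w2 q1 q2 e
          | ([q1, q2, q3], []) \<Rightarrow> w3 q1 q2 q3 e
          | ([], [\<beta>]) \<Rightarrow> \<phi>0 \<beta> e
          | ([q], [\<beta>]) \<Rightarrow> \<phi>1 \<beta> q e
          | _ \<Rightarrow> 0))"


section \<open>The adjoint structure objects\<close>

text \<open>Elements are triples \<open>(\<beta>, q, X)\<close>; a summand \<open>E[k]\<close> sits in degree \<open>-k\<close>.\<close>

type_synonym ('m, 'q, 'b) triple = "('m, 'b) dsection \<times> ('m \<Rightarrow> 'q) \<times> 'm vfield"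

definition adj_module :: "('m, 'q::real_vector, 'b::real_vector) split_data \<Rightarrow>
    ('m, ('m, 'q, 'b) triple) fmodule" where
  "adj_module L =
     \<lparr>elems = elems (secBd L) \<times> elems (secQ L) \<times> elems (secX L),
      scl = (\<lambda>f (\<beta>, q, X). (scl (secBd L) f \<beta>, scl (secQ L) f q, scl (secX L) f X))\<rparr>"

definition adj_grading :: "('m, 'q::real_vector, 'b::real_vector) split_data \<Rightarrow>
    int \<Rightarrow> ('m, 'q, 'b) triple set" where
  "adj_grading L i = {(\<beta>, q, X) \<in> elems (adj_module L).
     (i \<noteq> -2 \<longrightarrow> \<beta> = 0) \<and> (i \<noteq> -1 \<longrightarrow> q = 0) \<and> (i \<noteq> 0 \<longrightarrow> X = 0)}"

text \<open>In the following, \<open>nQ\<close> and \<open>nB\<close> are \<open>TM\<close>-connections on \<open>Q\<close> and on \<open>B\<^sup>*\<close>.\<close>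

definition nab_bas :: "('m, 'q, 'b) split_data \<Rightarrow> ('m vfield \<Rightarrow> ('m \<Rightarrow> 'q) \<Rightarrow> ('m \<Rightarrow> 'q)) \<Rightarrow>
    ('m \<Rightarrow> 'q) \<Rightarrow> ('m \<Rightarrow> 'q) \<Rightarrow> ('m \<Rightarrow> 'q::real_vector)" where
  "nab_bas L nQ q1 q2 = brk L q1 q2 + nQ (anchor L q2) q1"

definition nab_bas_TM :: "('m, 'q, 'b) split_data \<Rightarrow> ('m vfield \<Rightarrow> ('m \<Rightarrow> 'q) \<Rightarrow> ('m \<Rightarrow> 'q)) \<Rightarrow>
    ('m \<Rightarrow> 'q) \<Rightarrow> 'm vfield \<Rightarrow> 'm vfield" where
  "nab_bas_TM L nQ q X = lie_bracket (anchor L q) X + anchor L (nQ X q)"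

definition R_bas :: "('m, 'q, 'b) split_data \<Rightarrow> ('m vfield \<Rightarrow> ('m \<Rightarrow> 'q) \<Rightarrow> ('m \<Rightarrow> 'q)) \<Rightarrow>
    ('m \<Rightarrow> 'q) \<Rightarrow> ('m \<Rightarrow> 'q) \<Rightarrow> 'm vfield \<Rightarrow> ('m \<Rightarrow> 'q::real_vector)" where
  "R_bas L nQ q1 q2 X =
     - nQ X (brk L q1 q2) + brk L q1 (nQ X q2) + brk L (nQ X q1) q2
     + nQ (nab_bas_TM L nQ q2 X) q1 - nQ (nab_bas_TM L nQ q1 X) q2"

definition nab_omega :: "('m, 'q, 'b) split_data \<Rightarrow> ('m vfield \<Rightarrow> ('m \<Rightarrow> 'q) \<Rightarrow> ('m \<Rightarrow> 'q)) \<Rightarrow>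
    ('m vfield \<Rightarrow> ('m, 'b) dsection \<Rightarrow> ('m, 'b) dsection) \<Rightarrow>
    'm vfield \<Rightarrow> ('m \<Rightarrow> 'q) \<Rightarrow> ('m \<Rightarrow> 'q) \<Rightarrow> ('m \<Rightarrow> 'q) \<Rightarrow> ('m, 'b) dsection" where
  "nab_omega L nQ nB X q1 q2 q3 =
     nB X (omega L q1 q2 q3)
     - omega L (nQ X q1) q2 q3 - omega L q1 (nQ X q2) q3 - omega L q1 q2 (nQ X q3)"

definition adj_diff :: "('m, 'q::real_vector, 'b) split_data \<Rightarrow>
    ('m, 'q, 'b) triple \<Rightarrow> ('m, 'q, 'b) triple" where
  "adj_diff L = (\<lambda>(\<beta>, q, X). (0, - ell L \<beta>, anchor L q))"

definition adj_nab :: "('m, 'q::real_vector, 'b::real_vector) split_data \<Rightarrow>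
    ('m vfield \<Rightarrow> ('m \<Rightarrow> 'q) \<Rightarrow> ('m \<Rightarrow> 'q)) \<Rightarrow>
    ('m \<Rightarrow> 'q) \<Rightarrow> ('m, 'q, 'b) triple \<Rightarrow> ('m, 'q, 'b) triple" where
  "adj_nab L nQ q = (\<lambda>(\<beta>, q', X). (nabBd L q \<beta>, nab_bas L nQ q q', nab_bas_TM L nQ q X))"

definition adj_omega2 :: "('m, 'q::real_vector, 'b) split_data \<Rightarrow>
    ('m vfield \<Rightarrow> ('m \<Rightarrow> 'q) \<Rightarrow> ('m \<Rightarrow> 'q)) \<Rightarrow>
    ('m \<Rightarrow> 'q) \<Rightarrow> ('m \<Rightarrow> 'q) \<Rightarrow> ('m, 'q, 'b) triple \<Rightarrow> ('m, 'q, 'b) triple" where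
  "adj_omega2 L nQ q1 q2 = (\<lambda>(\<beta>, q3, X). (- omega L q1 q2 q3, - R_bas L nQ q1 q2 X, 0))"

text \<open>
  The sign of this component is forced by the others: if \<open>Q = TM = T\<real>\<^sup>3\<close>, \<open>B\<close> is a trivial line
  bundle, \<open>\<ell> = 0\<close>, all connections are the flat ones and \<open>\<omega> = h vol\<close>, then for a constant vector
  field \<open>q\<close> the (3,0)-component of \<open>\<D>\<^sup>2 q\<close> is \<open>\<omega>\<^sub>3(\<cdot>,\<cdot>,\<cdot>)\<rho>(q) - d(\<iota>\<^sub>q \<omega>)\<close>, and
  \<open>d(\<iota>\<^sub>q \<omega>) = q(h) vol = \<nabla>\<^sub>q \<omega>\<close>.
\<close>

definition adj_omega3 :: "('m, 'q::real_vector, 'b) split_data \<Rightarrow>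
    ('m vfield \<Rightarrow> ('m \<Rightarrow> 'q) \<Rightarrow> ('m \<Rightarrow> 'q)) \<Rightarrow>
    ('m vfield \<Rightarrow> ('m, 'b) dsection \<Rightarrow> ('m, 'b) dsection) \<Rightarrow>
    ('m \<Rightarrow> 'q) \<Rightarrow> ('m \<Rightarrow> 'q) \<Rightarrow> ('m \<Rightarrow> 'q) \<Rightarrow> ('m, 'q, 'b) triple \<Rightarrow> ('m, 'q, 'b) triple" where
  "adj_omega3 L nQ nB q1 q2 q3 = (\<lambda>(\<beta>, q, X). (nab_omega L nQ nB X q1 q2 q3, 0, 0))"

definition adj_phi0 :: "('m, 'q::real_vector, 'b::real_vector) split_data \<Rightarrow>
    ('m vfield \<Rightarrow> ('m \<Rightarrow> 'q) \<Rightarrow> ('m \<Rightarrow> 'q)) \<Rightarrow>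
    ('m vfield \<Rightarrow> ('m, 'b) dsection \<Rightarrow> ('m, 'b) dsection) \<Rightarrow>
    ('m, 'b) dsection \<Rightarrow> ('m, 'q, 'b) triple \<Rightarrow> ('m, 'q, 'b) triple" where
  "adj_phi0 L nQ nB \<beta> = (\<lambda>(\<beta>', q, X).
     (nB (anchor L q) \<beta> - nabBd L q \<beta>, ell L (nB X \<beta>) - nQ X (ell L \<beta>), 0))"

definition adj_phi1 :: "('m, 'q::real_vector, 'b::real_vector) split_data \<Rightarrow>
    ('m vfield \<Rightarrow> ('m \<Rightarrow> 'q) \<Rightarrow> ('m \<Rightarrow> 'q)) \<Rightarrow>
    ('m vfield \<Rightarrow> ('m, 'b) dsection \<Rightarrow> ('m, 'b) dsection) \<Rightarrow>
    ('m, 'b) dsection \<Rightarrow> ('m \<Rightarrow> 'q) \<Rightarrow> ('m, 'q, 'b) triple \<Rightarrow> ('m, 'q, 'b) triple" where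
  "adj_phi1 L nQ nB \<beta> q = (\<lambda>(\<beta>', q', X).
     (nB X (nabBd L q \<beta>) - nabBd L q (nB X \<beta>) - nabBd L (nQ X q) \<beta> + nB (nab_bas_TM L nQ q X) \<beta>,
      0, 0))"

end

theory Submission
  imports Defs
begin

text \<open>
  Contracting a form with a section of \<open>Q\<close> or \<open>B\<^sup>*\<close> determines it recursively, so an operator is
  determined by its value in arity zero and by its graded commutators with the contractions. The
  operators \<open>\<Q>\<close> and \<open>\<D>\<close> are of a kind that is closed under these commutators: they are given by a
  symbol, which collects the structure objects and the brackets (in the sense of an
  \<open>L\<^sub>\<infinity>\<close>-algebroid). The graded commutator of two such operators is again given by a symbol, the
  bracket of their symbols, which is computed by the same recursion. Hence \<open>\<D>\<^sup>2 = 0\<close> amounts to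
  the vanishing of a symbol of degree two, and for degree reasons only its components with
  \<open>k + 2l \<le> 4\<close> matter (\<open>k\<close> arguments in \<open>Q\<close> and \<open>l\<close> in \<open>B\<^sup>*\<close>). These are the axioms of the
  algebroid and, for the adjoint structure objects, identities obtained by differentiating the
  axioms along \<open>X\<close>. No frames or partitions of unity are needed.
\<close>

section \<open>Operators given by symbols\<close>

text \<open>Brackets and connections are not linear over functions, so neither is the symbol of
  \<open>\<D>\<close>. The calculus of symbols therefore runs over additive subgroups, with
  multilinear meaning additive in each argument. Linearity over functions is proved afterwards, for
  the form that an operator produces; there the derivative terms of the coefficients and of the
  brackets cancel.

  The graded commutator of an odd operator with itself is twice its square, and 2 cannot be
  cancelled in an arbitrary coefficient group. So the square is reached through the commutators of
  \<open>\<D>\<close> with its own contractions by one section, where no factor 2 arises.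

  The truncation comes from the grading: coefficients live in degrees -2, -1 and 0 and contractions
  have degree -1 or -2, so a symbol value of degree below -2 is zero.

  Functions are a module over themselves with the anchor as the only nonzero structure object. The
  homological vector field is thus an instance of the same construction, together with its Leibniz
  rule and the vanishing of its square.\<close>

definition ctrQ :: "'q \<Rightarrow> ('q list \<Rightarrow> 'b list \<Rightarrow> 'z) \<Rightarrow> 'q list \<Rightarrow> 'b list \<Rightarrow> 'z" where
  "ctrQ q \<eta> = (\<lambda>qs bs. \<eta> (q # qs) bs)"

definition ctrB :: "'b \<Rightarrow> ('q list \<Rightarrow> 'b list \<Rightarrow> 'z) \<Rightarrow> 'q list \<Rightarrow> 'b list \<Rightarrow> 'z" where
  "ctrB b \<eta> = (\<lambda>qs bs. \<eta> qs (b # bs))"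

lemma ctrQ_apply [simp]: "ctrQ q \<eta> qs bs = \<eta> (q # qs) bs"
  by (simp add: ctrQ_def)

lemma ctrB_apply [simp]: "ctrB b \<eta> qs bs = \<eta> qs (b # bs)"
  by (simp add: ctrB_def)

lemmas ctr_apply = ctrQ_apply ctrB_apply
lemmas ext_simps = fun_eq_iff ctr_apply plus_fun_apply

lemma ctrB_ctrQ: "ctrB b (ctrQ q \<eta>) = ctrQ q (ctrB b \<eta>)"
  by (simp add: ext_simps)

lemma signed_simps:
  "signed i (x + y) = signed i x + signed i y"
  "signed i (- x) = - signed i x"
  "signed i (x - y) = signed i x - signed i y"
  "signed i 0 = 0"
  "signed i (signed j x) = signed (i + j) x"
  by (auto simp: signed_def)

lemma signed_minus2: "signed (i - 2) x = signed i x"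
  by (simp add: signed_def)

lemma signed_fun: "signed i f x = signed i (f x)"
  by (simp add: signed_def)

text \<open>
  A symbol assigns to arguments an endomorphism of the coefficients, a section of \<open>Q\<close> and a
  section of \<open>B\<^sup>*\<close>; the latter two act by contraction. \<open>symb_op d A\<close> is the operator of degree \<open>d\<close>
  whose graded commutators with the contractions are the operators of the contracted symbols.
\<close>

type_synonym ('q, 'b, 'e) symb = "'q list \<Rightarrow> 'b list \<Rightarrow> ('e \<Rightarrow> 'e) \<times> 'q \<times> 'b"

definition act :: "('e \<Rightarrow> 'e) \<times> 'q \<times> 'b \<Rightarrow> ('q list \<Rightarrow> 'b list \<Rightarrow> 'e) \<Rightarrow> 'e::ab_group_add" where
  "act v \<eta> = fst v (\<eta> [] []) + \<eta> [fst (snd v)] [] + \<eta> [] [snd (snd v)]"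

lemma act_simps [simp]: "act (\<phi>, q, b) \<eta> = \<phi> (\<eta> [] []) + \<eta> [q] [] + \<eta> [] [b]"
  by (simp add: act_def)

fun symb_op :: "int \<Rightarrow> ('q, 'b, 'e) symb \<Rightarrow> ('q list \<Rightarrow> 'b list \<Rightarrow> 'e) \<Rightarrow>
    'q list \<Rightarrow> 'b list \<Rightarrow> 'e::ab_group_add" where
  "symb_op d A \<eta> [] [] = act (A [] []) \<eta>"
| "symb_op d A \<eta> [] (b # bs) = symb_op (d - 2) (ctrB b A) \<eta> [] bs + symb_op d A (ctrB b \<eta>) [] bs"
| "symb_op d A \<eta> (q # qs) bs = symb_op (d - 1) (ctrQ q A) \<eta> qs bs + signed d (symb_op d A (ctrQ q \<eta>) qs bs)"

lemma symb_op_simps [simp]: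
  "symb_op d A \<eta> [] [] = act (A [] []) \<eta>"
  "symb_op d A \<eta> [] (b # bs) = symb_op (d - 2) (ctrB b A) \<eta> [] bs + symb_op d A (ctrB b \<eta>) [] bs"
  "symb_op d A \<eta> (q # qs) bs = symb_op (d - 1) (ctrQ q A) \<eta> qs bs + signed d (symb_op d A (ctrQ q \<eta>) qs bs)"
  by (rule symb_op.simps)+

declare symb_op.simps [simp del]

text \<open>The recursion changes the degree, the symbol and the form, so none of them can be held
  fixed. Arguments in \<open>Q\<close> are used up before arguments in \<open>B\<^sup>*\<close>, as
  in \<open>symb_op\<close>.\<close>

lemma symb_op_induct [case_names Nil ConsB ConsQ]:
  fixes d :: int
  assumes "\<And>d A \<eta>. P d A \<eta> [] []"
    "\<And>d A \<eta> b bs. P (d - 2) (ctrB b A) \<eta> [] bs \<Longrightarrow> P d A (ctrB b \<eta>) [] bs \<Longrightarrow> P d A \<eta> [] (b # bs)"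
    "\<And>d A \<eta> q qs bs. P (d - 1) (ctrQ q A) \<eta> qs bs \<Longrightarrow> P d A (ctrQ q \<eta>) qs bs \<Longrightarrow> P d A \<eta> (q # qs) bs"
  shows "P d A \<eta> qs bs"
proof (induction qs arbitrary: d A \<eta>)
  case Nil
  show ?case by (induction bs arbitrary: d A \<eta>) (use assms(1,2) in blast)+
qed (use assms(3) in blast)

text \<open>The recursion exhausts the odd arguments first. An even argument may nevertheless be
  peeled off at any stage, because the two kinds of contraction commute and shifting the degree by 2
  changes no sign.\<close>

lemma symb_op_ConsB:
  "symb_op d A \<eta> qs (b # bs) = symb_op (d - 2) (ctrB b A) \<eta> qs bs + symb_op d A (ctrB b \<eta>) qs bs"
proof (induction qs arbitrary: d A \<eta>)
  case (Cons q qs)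
  have "d - 1 - 2 = d - 2 - 1" by simp
  then show ?case by (simp only: symb_op_simps Cons ctrB_ctrQ signed_simps signed_minus2 ac_simps)
qed simp

text \<open>In arity zero the endomorphisms contribute their graded commutator, and the contractions
  stored in one symbol act on the other symbol; two contractions commute in the graded sense and
  contribute nothing. The other clauses make the commutator with a contraction a graded derivation
  of the bracket, which is the graded Jacobi identity.\<close>

fun sbracket :: "int \<Rightarrow> int \<Rightarrow> ('q::ab_group_add, 'b::ab_group_add, 'e::ab_group_add) symb \<Rightarrow> ('q, 'b, 'e) symb \<Rightarrow>
    ('q, 'b, 'e) symb" where
  "sbracket d e A B [] [] =
     ((fst (A [] []) \<circ> fst (B [] [])) - signed (d * e) (fst (B [] []) \<circ> fst (A [] [])), 0, 0)
     + (B [fst (snd (A [] []))] [] + B [] [snd (snd (A [] []))])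
     - signed (d * e) (A [fst (snd (B [] []))] [] + A [] [snd (snd (B [] []))])"
| "sbracket d e A B [] (b # bs) =
     sbracket (d - 2) e (ctrB b A) B [] bs + sbracket d (e - 2) A (ctrB b B) [] bs"
| "sbracket d e A B (q # qs) bs =
     sbracket (d - 1) e (ctrQ q A) B qs bs + signed d (sbracket d (e - 1) A (ctrQ q B) qs bs)"

lemma sbracket_simps [simp]:
  "sbracket d e A B [] [] =
     ((fst (A [] []) \<circ> fst (B [] [])) - signed (d * e) (fst (B [] []) \<circ> fst (A [] [])), 0, 0)
     + (B [fst (snd (A [] []))] [] + B [] [snd (snd (A [] []))])
     - signed (d * e) (A [fst (snd (B [] []))] [] + A [] [snd (snd (B [] []))])"
  "sbracket d e A B [] (b # bs) =
     sbracket (d - 2) e (ctrB b A) B [] bs + sbracket d (e - 2) A (ctrB b B) [] bs"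
  "sbracket d e A B (q # qs) bs =
     sbracket (d - 1) e (ctrQ q A) B qs bs + signed d (sbracket d (e - 1) A (ctrQ q B) qs bs)"
  by (rule sbracket.simps)+

declare sbracket.simps [simp del]

lemma sbracket_ConsB:
  "sbracket d e A B qs (b # bs) =
     sbracket (d - 2) e (ctrB b A) B qs bs + sbracket d (e - 2) A (ctrB b B) qs bs"
proof (induction qs arbitrary: d e A B)
  case (Cons q qs)
  have "d - 1 - 2 = d - 2 - 1" "e - 1 - 2 = e - 2 - 1" by simp_all
  then show ?case by (simp only: sbracket_simps Cons ctrB_ctrQ signed_simps signed_minus2 ac_simps)
qed simp

definition subgrp :: "'a::ab_group_add set \<Rightarrow> bool" where
  "subgrp H \<longleftrightarrow> 0 \<in> H \<and> (\<forall>x\<in>H. \<forall>y\<in>H. x - y \<in> H)"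

lemma subgrp_zero: "subgrp H \<Longrightarrow> 0 \<in> H"
  and subgrp_diff: "subgrp H \<Longrightarrow> x \<in> H \<Longrightarrow> y \<in> H \<Longrightarrow> x - y \<in> H"
  by (simp_all add: subgrp_def)

lemma subgrp_neg: "subgrp H \<Longrightarrow> x \<in> H \<Longrightarrow> - x \<in> H"
  using subgrp_diff[of H 0 x] subgrp_zero[of H] by simp

lemma subgrp_add: "subgrp H \<Longrightarrow> x \<in> H \<Longrightarrow> y \<in> H \<Longrightarrow> x + y \<in> H"
  using subgrp_diff[of H x "- y"] subgrp_neg[of H y] by simp

lemma subgrp_signed: "subgrp H \<Longrightarrow> x \<in> H \<Longrightarrow> signed i x \<in> H"
  by (simp add: signed_def subgrp_neg)

lemma subgrpI:
  assumes "0 \<in> H" "\<And>x y. x \<in> H \<Longrightarrow> y \<in> H \<Longrightarrow> x + y \<in> H" "\<And>x. x \<in> H \<Longrightarrow> - x \<in> H"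
  shows "subgrp H"
  unfolding subgrp_def using assms by (metis add_uminus_conv_diff)

lemmas subgrp_closed = subgrp_zero subgrp_diff subgrp_neg subgrp_add subgrp_signed

section \<open>Multilinear forms, homogeneous symbols and their contractions\<close>

locale contraction_calculus =
  fixes Qs :: "'q::ab_group_add set" and Bs :: "'b::ab_group_add set" and Es :: "'e::ab_group_add set"
    and G :: "int \<Rightarrow> 'e set"
  assumes subQ: "subgrp Qs" and subB: "subgrp Bs" and subE: "subgrp Es"
    and subG: "subgrp (G i)"
begin

definition secs :: "'q list \<Rightarrow> 'b list \<Rightarrow> bool" where
  "secs qs bs \<longleftrightarrow> set qs \<subseteq> Qs \<and> set bs \<subseteq> Bs"

lemma secs_simps [simp]:
  "secs [] []"
  "secs (q # qs) bs \<longleftrightarrow> q \<in> Qs \<and> secs qs bs"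
  "secs qs (b # bs) \<longleftrightarrow> b \<in> Bs \<and> secs qs bs"
  "secs (qs @ qs') bs \<longleftrightarrow> secs qs bs \<and> secs qs' bs"
  "secs qs (bs @ bs') \<longleftrightarrow> secs qs bs \<and> secs qs bs'"
  by (auto simp: secs_def)

text \<open>Alternation and symmetry are imposed on neighbouring arguments only, which suits
  induction over lists; general permutations are recovered by \<open>mform_rotateQ\<close> and
  \<open>mform_rotateB\<close>. Alternation is vanishing on equal arguments rather than a sign rule,
  since the target may have 2-torsion.\<close>

definition mform :: "'z::ab_group_add set \<Rightarrow> ('q list \<Rightarrow> 'b list \<Rightarrow> 'z) \<Rightarrow> bool" where
  "mform C \<eta> \<longleftrightarrow>
     (\<forall>qs bs. secs qs bs \<longrightarrow> \<eta> qs bs \<in> C) \<and>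
     (\<forall>qs q r qs' bs. secs (qs @ q # r # qs') bs \<longrightarrow>
        \<eta> (qs @ (q + r) # qs') bs = \<eta> (qs @ q # qs') bs + \<eta> (qs @ r # qs') bs) \<and>
     (\<forall>qs bs b c bs'. secs qs (bs @ b # c # bs') \<longrightarrow>
        \<eta> qs (bs @ (b + c) # bs') = \<eta> qs (bs @ b # bs') + \<eta> qs (bs @ c # bs')) \<and>
     (\<forall>qs q qs' bs. secs (qs @ q # qs') bs \<longrightarrow> \<eta> (qs @ q # q # qs') bs = 0) \<and>
     (\<forall>qs bs b c bs'. secs qs (bs @ b # c # bs') \<longrightarrow>
        \<eta> qs (bs @ b # c # bs') = \<eta> qs (bs @ c # b # bs'))"

text \<open>The value outside the carrier is fixed so that symbols agreeing on the carrier are equal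
  as functions.\<close>

definition Endo :: "('e \<Rightarrow> 'e) set" where
  "Endo = {\<phi>. (\<forall>x\<in>Es. \<phi> x \<in> Es) \<and> (\<forall>x\<in>Es. \<forall>y\<in>Es. \<phi> (x + y) = \<phi> x + \<phi> y) \<and> (\<forall>x. x \<notin> Es \<longrightarrow> \<phi> x = 0)}"

text \<open>Contraction with a section of \<open>Q\<close> has degree -1 and with a section of
  \<open>B\<^sup>*\<close> degree -2, so a homogeneous value of any other degree has no contraction
  part.\<close>

definition Vdeg :: "int \<Rightarrow> (('e \<Rightarrow> 'e) \<times> 'q \<times> 'b) set" where
  "Vdeg \<delta> = {(\<phi>, q, b). \<phi> \<in> Endo \<and> q \<in> Qs \<and> b \<in> Bs \<and>
     (\<forall>i. \<forall>x\<in>G i. \<phi> x \<in> G (i + \<delta>)) \<and> (q \<noteq> 0 \<longrightarrow> \<delta> = -1) \<and> (b \<noteq> 0 \<longrightarrow> \<delta> = -2)}"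

definition V :: "(('e \<Rightarrow> 'e) \<times> 'q \<times> 'b) set" where
  "V = Endo \<times> Qs \<times> Bs"

definition symbol :: "int \<Rightarrow> ('q, 'b, 'e) symb \<Rightarrow> bool" where
  "symbol d A \<longleftrightarrow> mform V A \<and>
     (\<forall>qs bs. secs qs bs \<longrightarrow> A qs bs \<in> Vdeg (d - int (length qs) - 2 * int (length bs)))"

definition homog :: "int \<Rightarrow> ('q list \<Rightarrow> 'b list \<Rightarrow> 'e) \<Rightarrow> bool" where
  "homog j \<eta> \<longleftrightarrow> (\<forall>qs bs. secs qs bs \<longrightarrow> \<eta> qs bs \<in> G (j - int (length qs) - 2 * int (length bs)))"

lemma Endo_sub: "subgrp Endo"
proof (rule subgrpI)
  show "0 \<in> Endo" using subE by (simp add: Endo_def subgrp_closed)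
qed (use subE in \<open>auto simp: Endo_def subgrp_closed algebra_simps\<close>)

lemma Endo_closed: "\<phi> \<in> Endo \<Longrightarrow> x \<in> Es \<Longrightarrow> \<phi> x \<in> Es"
  and Endo_add: "\<phi> \<in> Endo \<Longrightarrow> x \<in> Es \<Longrightarrow> y \<in> Es \<Longrightarrow> \<phi> (x + y) = \<phi> x + \<phi> y"
  and Endo_outside: "\<phi> \<in> Endo \<Longrightarrow> x \<notin> Es \<Longrightarrow> \<phi> x = 0"
  by (auto simp: Endo_def)

lemma Endo_zero: "\<phi> \<in> Endo \<Longrightarrow> \<phi> 0 = 0"
  using Endo_add[of \<phi> 0 0] subE by (simp add: subgrp_closed)

lemma Endo_neg: "\<phi> \<in> Endo \<Longrightarrow> \<phi> (- x) = - \<phi> x"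
proof (cases "x \<in> Es")
  case True
  assume "\<phi> \<in> Endo"
  then show ?thesis using Endo_add[of \<phi> x "- x"] True subE
    by (simp add: subgrp_closed Endo_zero eq_neg_iff_add_eq_0 add.commute)
next
  case False
  assume "\<phi> \<in> Endo"
  moreover have "- x \<notin> Es" using False subE subgrp_neg[of Es "- x"] by auto
  ultimately show ?thesis using False by (simp add: Endo_outside)
qed

lemma Endo_signed: "\<phi> \<in> Endo \<Longrightarrow> \<phi> (signed i x) = signed i (\<phi> x)"
  by (simp add: signed_def Endo_neg)

lemma Endo_comp: "\<phi> \<in> Endo \<Longrightarrow> \<psi> \<in> Endo \<Longrightarrow> \<phi> \<circ> \<psi> \<in> Endo"
  unfolding Endo_def using Endo_zero[of \<phi>] by (auto simp: Endo_def)

lemma V_sub: "subgrp V"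
  unfolding V_def using Endo_sub subQ subB by (auto intro!: subgrpI simp: subgrp_closed zero_prod_def)

lemma Vdeg_sub: "subgrp (Vdeg \<delta>)"
proof (rule subgrpI)
  show "0 \<in> Vdeg \<delta>" using Endo_sub subQ subB subG by (simp add: Vdeg_def zero_prod_def subgrp_closed)
next
  fix x y assume "x \<in> Vdeg \<delta>" "y \<in> Vdeg \<delta>"
  then show "x + y \<in> Vdeg \<delta>"
    using Endo_sub subQ subB subG by (cases x; cases y) (auto simp: Vdeg_def subgrp_closed)
next
  fix x assume "x \<in> Vdeg \<delta>"
  then show "- x \<in> Vdeg \<delta>"
    using Endo_sub subQ subB subG by (cases x) (auto simp: Vdeg_def subgrp_closed)
qed

lemma Vdeg_V: "v \<in> Vdeg \<delta> \<Longrightarrow> v \<in> V"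
  by (auto simp: Vdeg_def V_def)

lemma V_D: "v \<in> V \<Longrightarrow> fst v \<in> Endo" "v \<in> V \<Longrightarrow> fst (snd v) \<in> Qs" "v \<in> V \<Longrightarrow> snd (snd v) \<in> Bs"
  by (auto simp: V_def)

lemma mform_V: "mform C \<eta> \<Longrightarrow> secs qs bs \<Longrightarrow> \<eta> qs bs \<in> C"
  and mform_addQ: "mform C \<eta> \<Longrightarrow> secs (qs @ q # r # qs') bs \<Longrightarrow>
        \<eta> (qs @ (q + r) # qs') bs = \<eta> (qs @ q # qs') bs + \<eta> (qs @ r # qs') bs"
  and mform_addB: "mform C \<eta> \<Longrightarrow> secs qs (bs @ b # c # bs') \<Longrightarrow>
        \<eta> qs (bs @ (b + c) # bs') = \<eta> qs (bs @ b # bs') + \<eta> qs (bs @ c # bs')"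
  and mform_alt: "mform C \<eta> \<Longrightarrow> secs (qs @ q # qs') bs \<Longrightarrow> \<eta> (qs @ q # q # qs') bs = 0"
  by (simp_all add: mform_def)

lemma mform_sym:
  assumes "mform C \<eta>" "secs qs (bs @ b # c # bs')"
  shows "\<eta> qs (bs @ b # c # bs') = \<eta> qs (bs @ c # b # bs')"
  using assms(1)[unfolded mform_def, THEN conjunct2, THEN conjunct2, THEN conjunct2, THEN conjunct2]
    assms(2) by blast

text \<open>Polarisation: expand the form on the repeated argument \<open>q + r\<close>.\<close>

lemma mform_swap:
  assumes "mform C \<eta>" "secs (qs @ q # r # qs') bs"
  shows "\<eta> (qs @ q # r # qs') bs = - \<eta> (qs @ r # q # qs') bs"
proof -
  have s: "q + r \<in> Qs" using assms(2) subQ by (simp add: subgrp_closed)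
  have "0 = \<eta> (qs @ (q + r) # (q + r) # qs') bs"
    using assms s by (simp add: mform_alt)
  also have "\<dots> = \<eta> (qs @ q # (q + r) # qs') bs + \<eta> (qs @ r # (q + r) # qs') bs"
    using assms s mform_addQ[of C \<eta> qs q r "(q + r) # qs'" bs] by simp
  also have "\<eta> (qs @ q # (q + r) # qs') bs = \<eta> (qs @ q # r # qs') bs"
    using assms mform_addQ[of C \<eta> "qs @ [q]" q r qs' bs] by (simp add: mform_alt)
  also have "\<eta> (qs @ r # (q + r) # qs') bs = \<eta> (qs @ r # q # qs') bs"
    using assms mform_addQ[of C \<eta> "qs @ [r]" q r qs' bs] by (simp add: mform_alt)
  finally show ?thesis by (simp add: eq_neg_iff_add_eq_0)
qed

lemma mform_ctrQ: assumes "mform C \<eta>" "q \<in> Qs" shows "mform C (ctrQ q \<eta>)"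
  unfolding mform_def
proof (intro conjI allI impI)
  fix qs r s qs' bs assume "secs (qs @ r # s # qs') bs"
  then show "ctrQ q \<eta> (qs @ (r + s) # qs') bs = ctrQ q \<eta> (qs @ r # qs') bs + ctrQ q \<eta> (qs @ s # qs') bs"
    using assms mform_addQ[OF assms(1), of "q # qs"] by simp
next
  fix qs r qs' bs assume "secs (qs @ r # qs') bs"
  then show "ctrQ q \<eta> (qs @ r # r # qs') bs = 0"
    using assms mform_alt[OF assms(1), of "q # qs"] by simp
qed (use assms in \<open>auto intro: mform_V simp: mform_addB mform_sym\<close>)

lemma mform_ctrB: assumes "mform C \<eta>" "b \<in> Bs" shows "mform C (ctrB b \<eta>)"
  unfolding mform_def
proof (intro conjI allI impI)
  fix qs r s bs bs' assume "secs qs (bs @ r # s # bs')"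
  then show "ctrB b \<eta> qs (bs @ (r + s) # bs') = ctrB b \<eta> qs (bs @ r # bs') + ctrB b \<eta> qs (bs @ s # bs')"
    using assms mform_addB[OF assms(1), of _ "b # bs"] by simp
next
  fix qs r s bs bs' assume "secs qs (bs @ r # s # bs')"
  then show "ctrB b \<eta> qs (bs @ r # s # bs') = ctrB b \<eta> qs (bs @ s # r # bs')"
    using assms mform_sym[OF assms(1), of _ "b # bs"] by simp
qed (use assms in \<open>auto intro: mform_V simp: mform_addQ mform_alt\<close>)

lemma mform_zeroQ: "mform C \<eta> \<Longrightarrow> secs (qs @ qs') bs \<Longrightarrow> \<eta> (qs @ 0 # qs') bs = 0"
  using mform_addQ[of C \<eta> qs 0 0 qs' bs] subQ by (simp add: subgrp_closed)

lemma mform_zeroB: "mform C \<eta> \<Longrightarrow> secs qs (bs @ bs') \<Longrightarrow> \<eta> qs (bs @ 0 # bs') = 0"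
  using mform_addB[of C \<eta> qs bs 0 0 bs'] subB by (simp add: subgrp_closed)

lemma mform_negQ:
  assumes "mform C \<eta>" "secs (qs @ q # qs') bs"
  shows "\<eta> (qs @ (- q) # qs') bs = - \<eta> (qs @ q # qs') bs"
  using assms mform_addQ[of C \<eta> qs q "- q" qs' bs] subQ
  by (simp add: subgrp_closed mform_zeroQ eq_neg_iff_add_eq_0 add.commute)

lemma mform_negB:
  assumes "mform C \<eta>" "secs qs (bs @ b # bs')"
  shows "\<eta> qs (bs @ (- b) # bs') = - \<eta> qs (bs @ b # bs')"
  using assms mform_addB[of C \<eta> qs bs b "- b" bs'] subB
  by (simp add: subgrp_closed mform_zeroB eq_neg_iff_add_eq_0 add.commute)

lemma symbol_mform: "symbol d A \<Longrightarrow> mform V A"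
  by (simp add: symbol_def)

lemma symbol_ctrQ:
  assumes "symbol d A" "q \<in> Qs" shows "symbol (d - 1) (ctrQ q A)"
  unfolding symbol_def
proof (intro conjI allI impI)
  fix qs bs assume "secs qs bs"
  then have "A (q # qs) bs \<in> Vdeg (d - int (length (q # qs)) - 2 * int (length bs))"
    using assms unfolding symbol_def by (metis secs_simps(2))
  then show "ctrQ q A qs bs \<in> Vdeg (d - 1 - int (length qs) - 2 * int (length bs))"
    by (simp add: algebra_simps)
qed (use assms in \<open>simp add: mform_ctrQ symbol_mform\<close>)

lemma symbol_ctrB:
  assumes "symbol d A" "b \<in> Bs" shows "symbol (d - 2) (ctrB b A)"
  unfolding symbol_def
proof (intro conjI allI impI)
  fix qs bs assume "secs qs bs"
  then have "A qs (b # bs) \<in> Vdeg (d - int (length qs) - 2 * int (length (b # bs)))"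
    using assms unfolding symbol_def by (metis secs_simps(3))
  then show "ctrB b A qs bs \<in> Vdeg (d - 2 - int (length qs) - 2 * int (length bs))"
    by (simp add: algebra_simps)
qed (use assms in \<open>simp add: mform_ctrB symbol_mform\<close>)

lemma homog_ctrQ:
  assumes "homog d A" "q \<in> Qs" shows "homog (d - 1) (ctrQ q A)"
  unfolding homog_def
proof (intro allI impI)
  fix qs bs assume "secs qs bs"
  then have "A (q # qs) bs \<in> G (d - int (length (q # qs)) - 2 * int (length bs))"
    using assms unfolding homog_def by (metis secs_simps(2))
  then show "ctrQ q A qs bs \<in> G (d - 1 - int (length qs) - 2 * int (length bs))"
    by (simp add: algebra_simps)
qed

lemma homog_ctrB:
  assumes "homog d A" "b \<in> Bs" shows "homog (d - 2) (ctrB b A)"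
  unfolding homog_def
proof (intro allI impI)
  fix qs bs assume "secs qs bs"
  then have "A qs (b # bs) \<in> G (d - int (length qs) - 2 * int (length (b # bs)))"
    using assms unfolding homog_def by (metis secs_simps(3))
  then show "ctrB b A qs bs \<in> G (d - 2 - int (length qs) - 2 * int (length bs))"
    by (simp add: algebra_simps)
qed

lemma act_add_symb:
  assumes "v \<in> V" "w \<in> V" "mform Es \<eta>"
  shows "act (v + w) \<eta> = act v \<eta> + act w \<eta>"
proof -
  obtain \<phi> q b \<psi> r c where vw: "v = (\<phi>, q, b)" "w = (\<psi>, r, c)" by (metis prod.collapse)
  have "\<eta> [q + r] [] = \<eta> [q] [] + \<eta> [r] []"
    using mform_addQ[OF assms(3), of "[]" q r "[]" "[]"] assms vw by (simp add: V_def)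
  moreover have "\<eta> [] [b + c] = \<eta> [] [b] + \<eta> [] [c]"
    using mform_addB[OF assms(3), of "[]" "[]" b c "[]"] assms vw by (simp add: V_def)
  ultimately show ?thesis by (simp add: vw algebra_simps)
qed

lemma act_zero_symb: "mform Es \<eta> \<Longrightarrow> act 0 \<eta> = 0"
  using act_add_symb[of 0 0 \<eta>] V_sub by (simp add: subgrp_closed)

lemma act_neg_symb: "v \<in> V \<Longrightarrow> mform Es \<eta> \<Longrightarrow> act (- v) \<eta> = - act v \<eta>"
  using act_add_symb[of v "- v" \<eta>] V_sub act_zero_symb[of \<eta>]
  by (simp add: subgrp_closed eq_neg_iff_add_eq_0 add.commute)

lemma act_signed_symb: "v \<in> V \<Longrightarrow> mform Es \<eta> \<Longrightarrow> act (signed i v) \<eta> = signed i (act v \<eta>)"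
  by (simp add: signed_def act_neg_symb)

definition valued :: "('q list \<Rightarrow> 'b list \<Rightarrow> 'e) \<Rightarrow> bool" where
  "valued \<eta> \<longleftrightarrow> (\<forall>qs bs. secs qs bs \<longrightarrow> \<eta> qs bs \<in> Es)"

lemma mform_valued: "mform Es \<eta> \<Longrightarrow> valued \<eta>"
  by (simp add: valued_def mform_V)

lemma valued_ctrQ: "valued \<eta> \<Longrightarrow> q \<in> Qs \<Longrightarrow> valued (ctrQ q \<eta>)"
  and valued_ctrB: "valued \<eta> \<Longrightarrow> b \<in> Bs \<Longrightarrow> valued (ctrB b \<eta>)"
  by (simp_all add: valued_def)

lemma act_add_form:
  "v \<in> V \<Longrightarrow> valued \<eta> \<Longrightarrow> valued \<eta>' \<Longrightarrow> act v (\<eta> + \<eta>') = act v \<eta> + act v \<eta>'"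
  by (cases v) (simp add: V_def Endo_add valued_def algebra_simps)

lemma act_signed_form: "v \<in> V \<Longrightarrow> act v (signed i \<eta>) = signed i (act v \<eta>)"
  by (cases v) (simp add: V_def Endo_signed signed_simps signed_fun)

end

declare plus_fun_apply [simp del] ctr_apply [simp del]

section \<open>Linearity of the operator in its symbol and in its form\<close>

context contraction_calculus
begin

text \<open>Weaker than \<open>mform V\<close>: the bracket of two symbols is controlled through the
  degree of its values only, and this is enough for the linearity lemmas.\<close>

definition symv :: "('q, 'b, 'e) symb \<Rightarrow> bool" where
  "symv A \<longleftrightarrow> (\<forall>qs bs. secs qs bs \<longrightarrow> A qs bs \<in> V)"

lemma symv_V: "symv A \<Longrightarrow> secs qs bs \<Longrightarrow> A qs bs \<in> V"
  and mform_symv: "mform V A \<Longrightarrow> symv A"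
  and symv_ctrQ: "symv A \<Longrightarrow> q \<in> Qs \<Longrightarrow> symv (ctrQ q A)"
  and symv_ctrB: "symv A \<Longrightarrow> b \<in> Bs \<Longrightarrow> symv (ctrB b A)"
  by (auto simp: symv_def ctr_apply mform_V)

lemma symb_op_add_symb:
  assumes "symv A" "symv B" "mform Es \<eta>" "secs qs bs"
  shows "symb_op d (A + B) \<eta> qs bs = symb_op d A \<eta> qs bs + symb_op d B \<eta> qs bs"
  using assms
proof (induction d A \<eta> qs bs arbitrary: B rule: symb_op_induct)
  case (Nil d A \<eta>)
  then show ?case by (simp add: act_add_symb symv_V plus_fun_apply)
next
  case (ConsB d A \<eta> b bs)
  have "ctrB b (A + B) = ctrB b A + ctrB b B" by (simp add: ext_simps)
  then show ?case using ConsB(1)[of "ctrB b B"] ConsB(2)[of B] ConsB(3-) by (simp add: mform_ctrB symv_ctrB algebra_simps)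
next
  case (ConsQ d A \<eta> q qs bs)
  have "ctrQ q (A + B) = ctrQ q A + ctrQ q B" by (simp add: ext_simps)
  then show ?case using ConsQ(1)[of "ctrQ q B"] ConsQ(2)[of B] ConsQ(3-) by (simp add: mform_ctrQ symv_ctrQ signed_simps algebra_simps)
qed

lemma symb_op_signed_symb:
  assumes "symv A" "mform Es \<eta>" "secs qs bs"
  shows "symb_op d (signed i A) \<eta> qs bs = signed i (symb_op d A \<eta> qs bs)"
  using assms
proof (induction d A \<eta> qs bs rule: symb_op_induct)
  case (Nil d A \<eta>)
  then show ?case by (simp add: act_signed_symb symv_V signed_fun)
next
  case (ConsB d A \<eta> b bs)
  have "ctrB b (signed i A) = signed i (ctrB b A)" by (simp add: ext_simps signed_fun)
  then show ?case using ConsB by (simp add: mform_ctrB symv_ctrB signed_simps)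
next
  case (ConsQ d A \<eta> q qs bs)
  have "ctrQ q (signed i A) = signed i (ctrQ q A)" by (simp add: ext_simps signed_fun)
  then show ?case using ConsQ by (simp add: mform_ctrQ symv_ctrQ signed_simps algebra_simps)
qed

lemma symb_op_add_form:
  assumes "symv A" "valued \<eta>" "valued \<eta>'" "secs qs bs"
  shows "symb_op d A (\<eta> + \<eta>') qs bs = symb_op d A \<eta> qs bs + symb_op d A \<eta>' qs bs"
  using assms
proof (induction d A \<eta> qs bs arbitrary: \<eta>' rule: symb_op_induct)
  case (Nil d A \<eta>)
  then show ?case by (simp add: act_add_form symv_V)
next
  case (ConsB d A \<eta> b bs)
  have "ctrB b (\<eta> + \<eta>') = ctrB b \<eta> + ctrB b \<eta>'" by (simp add: ext_simps)
  then show ?case using ConsB by (simp add: mform_ctrB symv_ctrB valued_ctrB algebra_simps)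
next
  case (ConsQ d A \<eta> q qs bs)
  have "ctrQ q (\<eta> + \<eta>') = ctrQ q \<eta> + ctrQ q \<eta>'" by (simp add: ext_simps)
  then show ?case using ConsQ by (simp add: mform_ctrQ symv_ctrQ valued_ctrQ signed_simps algebra_simps)
qed

lemma symb_op_signed_form:
  assumes "symv A" "secs qs bs"
  shows "symb_op d A (signed i \<eta>) qs bs = signed i (symb_op d A \<eta> qs bs)"
  using assms
proof (induction d A \<eta> qs bs rule: symb_op_induct)
  case (Nil d A \<eta>)
  then show ?case by (simp add: act_signed_form symv_V)
next
  case (ConsB d A \<eta> b bs)
  have "ctrB b (signed i \<eta>) = signed i (ctrB b \<eta>)" by (simp add: ext_simps signed_fun)
  then show ?case using ConsB by (simp add: mform_ctrB symv_ctrB signed_simps)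
next
  case (ConsQ d A \<eta> q qs bs)
  have "ctrQ q (signed i \<eta>) = signed i (ctrQ q \<eta>)" by (simp add: ext_simps signed_fun)
  then show ?case using ConsQ by (simp add: mform_ctrQ symv_ctrQ signed_simps algebra_simps)
qed

text \<open>Nothing outside the carriers is ever evaluated: the sections stored in the values of the
  symbol lie in \<open>Qs\<close> and \<open>Bs\<close> themselves.\<close>

lemma symb_op_cong:
  assumes "symv A" "\<And>qs bs. secs qs bs \<Longrightarrow> A qs bs = A' qs bs"
    "\<And>qs bs. secs qs bs \<Longrightarrow> \<eta> qs bs = \<eta>' qs bs" "secs qs bs"
  shows "symb_op d A \<eta> qs bs = symb_op d A' \<eta>' qs bs"
  using assms
proof (induction d A \<eta> qs bs arbitrary: A' \<eta>' rule: symb_op_induct)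
  case (Nil d A \<eta>)
  have "A [] [] \<in> V" using Nil(1) by (simp add: symv_V)
  then show ?case using Nil(2)[of "[]" "[]"] Nil(3) by (simp add: act_def V_D)
next
  case (ConsB d A \<eta> b bs)
  have "symb_op (d - 2) (ctrB b A) \<eta> [] bs = symb_op (d - 2) (ctrB b A') \<eta>' [] bs"
    using ConsB by (intro ConsB(1)) (simp_all add: symv_ctrB, simp_all add: ctr_apply)
  moreover have "symb_op d A (ctrB b \<eta>) [] bs = symb_op d A' (ctrB b \<eta>') [] bs"
    using ConsB by (intro ConsB(2)) (simp_all add: symv_ctrB, simp_all add: ctr_apply)
  ultimately show ?case by simp
next
  case (ConsQ d A \<eta> q qs bs)
  have "symb_op (d - 1) (ctrQ q A) \<eta> qs bs = symb_op (d - 1) (ctrQ q A') \<eta>' qs bs"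
    using ConsQ by (intro ConsQ(1)) (simp_all add: symv_ctrQ, simp_all add: ctr_apply)
  moreover have "symb_op d A (ctrQ q \<eta>) qs bs = symb_op d A' (ctrQ q \<eta>') qs bs"
    using ConsQ by (intro ConsQ(2)) (simp_all add: symv_ctrQ, simp_all add: ctr_apply)
  ultimately show ?case by simp
qed

lemma mform_zero: "subgrp C \<Longrightarrow> mform C 0"
  by (simp add: mform_def subgrp_closed)

lemma symb_op_zero_symb:
  assumes "mform Es \<eta>" "secs qs bs" shows "symb_op d 0 \<eta> qs bs = 0"
  using symb_op_add_symb[of 0 0 \<eta> qs bs d] assms by (simp add: mform_symv mform_zero V_sub)

lemma symb_op_zero_form:
  assumes "symv A" "secs qs bs" shows "symb_op d A 0 qs bs = 0"
  using symb_op_add_form[of A 0 0 qs bs d] assms by (simp add: mform_valued mform_zero subE)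

lemma symb_op_symb_eq_0:
  assumes "\<And>qs bs. secs qs bs \<Longrightarrow> A qs bs = 0" "mform Es \<eta>" "secs qs bs"
  shows "symb_op d A \<eta> qs bs = 0"
  using symb_op_cong[of 0 A \<eta> \<eta> qs bs d] symb_op_zero_symb[of \<eta> qs bs d] assms
  by (simp add: mform_symv mform_zero V_sub)

lemma symb_op_form_eq_0:
  assumes "symv A" "\<And>qs bs. secs qs bs \<Longrightarrow> \<eta> qs bs = 0" "secs qs bs"
  shows "symb_op d A \<eta> qs bs = 0"
  using symb_op_cong[of A A \<eta> 0 qs bs d] symb_op_zero_form[of A qs bs d] assms by simp

lemma act_in: "v \<in> V \<Longrightarrow> valued \<eta> \<Longrightarrow> act v \<eta> \<in> Es"
  by (cases v) (auto simp: V_def valued_def subgrp_closed subE Endo_closed)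

lemma symb_op_valued:
  assumes "symv A" "valued \<eta>" "secs qs bs"
  shows "symb_op d A \<eta> qs bs \<in> Es"
  using assms
  by (induction d A \<eta> qs bs rule: symb_op_induct)
    (auto simp: act_in symv_V mform_ctrB symv_ctrB mform_ctrQ symv_ctrQ valued_ctrB valued_ctrQ subgrp_closed subE)

section \<open>The operator preserves multilinear forms\<close>

lemma symb_op_addQ:
  assumes "mform V A" "mform Es \<eta>" "secs (qs @ q # r # qs') bs"
  shows "symb_op d A \<eta> (qs @ (q + r) # qs') bs = symb_op d A \<eta> (qs @ q # qs') bs + symb_op d A \<eta> (qs @ r # qs') bs"
  using assms
proof (induction qs arbitrary: d A \<eta>)
  case Nil
  have "symb_op (d - 1) (ctrQ (q + r) A) \<eta> qs' bs = symb_op (d - 1) (ctrQ q A + ctrQ r A) \<eta> qs' bs"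
    using Nil mform_addQ[OF Nil(1), of "[]"] subQ
    by (intro symb_op_cong) (auto simp: mform_ctrQ mform_symv subgrp_closed ctr_apply plus_fun_apply)
  moreover have "symb_op d A (ctrQ (q + r) \<eta>) qs' bs = symb_op d A (ctrQ q \<eta> + ctrQ r \<eta>) qs' bs"
    using Nil mform_addQ[OF Nil(2), of "[]"] subQ
    by (intro symb_op_cong) (auto simp: mform_ctrQ mform_symv subgrp_closed ctr_apply plus_fun_apply)
  ultimately show ?case using Nil
    by (simp add: symb_op_add_symb symb_op_add_form mform_ctrQ mform_symv mform_valued signed_simps algebra_simps)
next
  case (Cons s qs)
  then show ?case by (simp add: mform_ctrQ mform_symv signed_simps algebra_simps)
qed

lemma symb_op_addB:
  assumes "mform V A" "mform Es \<eta>" "secs qs (bs @ q # r # bs')"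
  shows "symb_op d A \<eta> qs (bs @ (q + r) # bs') = symb_op d A \<eta> qs (bs @ q # bs') + symb_op d A \<eta> qs (bs @ r # bs')"
  using assms
proof (induction bs arbitrary: d A \<eta>)
  case Nil
  have "symb_op (d - 2) (ctrB (q + r) A) \<eta> qs bs' = symb_op (d - 2) (ctrB q A + ctrB r A) \<eta> qs bs'"
    using Nil mform_addB[OF Nil(1), of _ "[]"] subB
    by (intro symb_op_cong) (auto simp: mform_ctrB mform_symv subgrp_closed ctr_apply plus_fun_apply)
  moreover have "symb_op d A (ctrB (q + r) \<eta>) qs bs' = symb_op d A (ctrB q \<eta> + ctrB r \<eta>) qs bs'"
    using Nil mform_addB[OF Nil(2), of _ "[]"] subB
    by (intro symb_op_cong) (auto simp: mform_ctrB mform_symv subgrp_closed ctr_apply plus_fun_apply)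
  ultimately show ?case using Nil
    by (simp add: symb_op_ConsB symb_op_add_symb symb_op_add_form mform_ctrB mform_symv mform_valued algebra_simps)
next
  case (Cons s bs)
  then show ?case by (simp add: symb_op_ConsB mform_ctrB mform_symv algebra_simps)
qed

text \<open>After contracting twice with the same odd argument, the two mixed terms carry the signs
  of \<open>d - 1\<close> and \<open>d\<close> and cancel. The outer terms vanish because the symbol
  and the form alternate.\<close>

lemma symb_op_alt:
  assumes "mform V A" "mform Es \<eta>" "secs (qs @ q # qs') bs"
  shows "symb_op d A \<eta> (qs @ q # q # qs') bs = 0"
  using assms
proof (induction qs arbitrary: d A \<eta>)
  case Nil
  have "symb_op (d - 1 - 1) (ctrQ q (ctrQ q A)) \<eta> qs' bs = 0"
    using Nil mform_alt[OF Nil(1), of "[]"] by (intro symb_op_symb_eq_0) (auto simp: ctr_apply mform_ctrQ mform_ctrB mform_symv)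
  moreover have "symb_op d A (ctrQ q (ctrQ q \<eta>)) qs' bs = 0"
    using Nil mform_alt[OF Nil(2), of "[]"] by (intro symb_op_form_eq_0) (auto simp: ctr_apply mform_ctrQ mform_ctrB mform_symv)
  ultimately show ?case by (simp add: signed_simps) (simp add: signed_def)
next
  case (Cons s qs)
  then show ?case by (simp add: mform_ctrQ mform_symv signed_simps)
qed

lemma symb_op_sym:
  assumes "mform V A" "mform Es \<eta>" "secs qs (bs @ b # c # bs')"
  shows "symb_op d A \<eta> qs (bs @ b # c # bs') = symb_op d A \<eta> qs (bs @ c # b # bs')"
  using assms
proof (induction bs arbitrary: d A \<eta>)
  case Nil
  have "symb_op (d - 2 - 2) (ctrB c (ctrB b A)) \<eta> qs bs' = symb_op (d - 2 - 2) (ctrB b (ctrB c A)) \<eta> qs bs'"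
    using Nil mform_sym[OF Nil(1), of _ "[]"] by (intro symb_op_cong) (auto intro!: mform_ctrB mform_symv simp: ctr_apply)
  moreover have "symb_op d A (ctrB c (ctrB b \<eta>)) qs bs' = symb_op d A (ctrB b (ctrB c \<eta>)) qs bs'"
    using Nil mform_sym[OF Nil(2), of _ "[]"] by (intro symb_op_cong) (auto simp: ctr_apply mform_ctrQ mform_ctrB mform_symv)
  ultimately show ?case by (simp add: symb_op_ConsB)
next
  case (Cons s bs)
  then show ?case by (simp add: symb_op_ConsB mform_ctrB mform_symv)
qed

lemma mform_symb_op: "mform V A \<Longrightarrow> mform Es \<eta> \<Longrightarrow> mform Es (symb_op d A \<eta>)"
  unfolding mform_def[of Es "symb_op d A \<eta>"]
  by (intro conjI allI impI; rule symb_op_addQ symb_op_addB symb_op_alt symb_op_sym symb_op_valued; simp add: mform_valued mform_symv)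

section \<open>Degree and support of the operator\<close>

lemma symbol_Vdeg:
  "symbol d A \<Longrightarrow> secs qs bs \<Longrightarrow> A qs bs \<in> Vdeg (d - int (length qs) - 2 * int (length bs))"
  by (simp add: symbol_def)

lemma symbol_symv: "symbol d A \<Longrightarrow> symv A"
  by (simp add: symbol_mform mform_symv)

lemma homog_G:
  "homog j \<eta> \<Longrightarrow> secs qs bs \<Longrightarrow> \<eta> qs bs \<in> G (j - int (length qs) - 2 * int (length bs))"
  by (simp add: homog_def)

lemma act_G:
  assumes "v \<in> Vdeg d" "homog j \<eta>" "mform Es \<eta>"
  shows "act v \<eta> \<in> G (j + d)"
proof -
  obtain \<phi> q b where v: "v = (\<phi>, q, b)" by (metis prod.collapse)
  have "\<phi> (\<eta> [] []) \<in> G (j + d)"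
    using assms(1) homog_G[OF assms(2), of "[]" "[]"] by (auto simp: v Vdeg_def)
  moreover have "\<eta> [q] [] \<in> G (j + d)"
  proof (cases "q = 0")
    case True
    then show ?thesis using mform_zeroQ[OF assms(3), of "[]" "[]" "[]"] subG by (simp add: subgrp_closed)
  next
    case False
    then show ?thesis using assms(1) homog_G[OF assms(2), of "[q]" "[]"] by (auto simp: v Vdeg_def)
  qed
  moreover have "\<eta> [] [b] \<in> G (j + d)"
  proof (cases "b = 0")
    case True
    then show ?thesis using mform_zeroB[OF assms(3), of "[]" "[]" "[]"] subG by (simp add: subgrp_closed)
  next
    case False
    then show ?thesis using assms(1) homog_G[OF assms(2), of "[]" "[b]"] by (auto simp: v Vdeg_def)
  qed
  ultimately show ?thesis using subG by (simp add: v subgrp_closed)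
qed

lemma symb_op_G:
  assumes "symbol d A" "homog j \<eta>" "mform Es \<eta>" "secs qs bs"
  shows "symb_op d A \<eta> qs bs \<in> G (j + d - int (length qs) - 2 * int (length bs))"
  using assms
proof (induction d A \<eta> qs bs arbitrary: j rule: symb_op_induct)
  case (Nil d A \<eta>)
  then show ?case using act_G[of "A [] []" d j \<eta>] symbol_Vdeg[of d A "[]" "[]"] by simp
next
  case (ConsB d A \<eta> b bs)
  have "symb_op (d - 2) (ctrB b A) \<eta> [] bs \<in> G (j + (d - 2) - int (length ([]::'q list)) - 2 * int (length bs))"
    using ConsB by (intro ConsB(1)) (simp_all add: symbol_ctrB)
  moreover have "symb_op d A (ctrB b \<eta>) [] bs \<in> G (j - 2 + d - int (length ([]::'q list)) - 2 * int (length bs))"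
    using ConsB by (intro ConsB(2)) (simp_all add: homog_ctrB mform_ctrB)
  ultimately show ?case using subG by (simp add: subgrp_closed algebra_simps)
next
  case (ConsQ d A \<eta> q qs bs)
  have "symb_op (d - 1) (ctrQ q A) \<eta> qs bs \<in> G (j + (d - 1) - int (length qs) - 2 * int (length bs))"
    using ConsQ by (intro ConsQ(1)) (simp_all add: symbol_ctrQ)
  moreover have "symb_op d A (ctrQ q \<eta>) qs bs \<in> G (j - 1 + d - int (length qs) - 2 * int (length bs))"
    using ConsQ by (intro ConsQ(2)) (simp_all add: homog_ctrQ mform_ctrQ)
  ultimately show ?case using subG by (simp add: subgrp_closed algebra_simps)
qed

lemma homog_symb_op: "symbol d A \<Longrightarrow> homog j \<eta> \<Longrightarrow> mform Es \<eta> \<Longrightarrow> homog (j + d) (symb_op d A \<eta>)"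
  by (simp add: homog_def symb_op_G)

text \<open>The bound is an integer because every contraction lowers it by one. A negative bound
  then says that even the value in arity zero vanishes, which starts the induction in
  \<open>symb_op_supported_0\<close>.\<close>

definition supported :: "int \<Rightarrow> ('q list \<Rightarrow> 'b list \<Rightarrow> 'z::zero) \<Rightarrow> bool" where
  "supported n \<eta> \<longleftrightarrow> (\<forall>qs bs. secs qs bs \<longrightarrow> n < int (length qs + length bs) \<longrightarrow> \<eta> qs bs = 0)"

lemma supported_0: "supported n \<eta> \<Longrightarrow> secs qs bs \<Longrightarrow> n < int (length qs + length bs) \<Longrightarrow> \<eta> qs bs = 0"
  by (auto simp: supported_def)

lemma supported_ctrQ: "supported n \<eta> \<Longrightarrow> q \<in> Qs \<Longrightarrow> supported (n - 1) (ctrQ q \<eta>)"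
  by (simp add: supported_def ctr_apply)

lemma supported_ctrB: "supported n \<eta> \<Longrightarrow> q \<in> Bs \<Longrightarrow> supported (n - 1) (ctrB q \<eta>)"
  by (simp add: supported_def ctr_apply)

lemma symb_op_supported_0:
  assumes "mform V A" "mform Es \<eta>" "supported n A" "supported N \<eta>" "secs qs bs"
    "N + n < int (length qs + length bs)"
  shows "symb_op d A \<eta> qs bs = 0"
  using assms
proof (induction d A \<eta> qs bs arbitrary: n N rule: symb_op_induct)
  case (Nil d A \<eta>)
  then consider "n < 0" | "N < 0" by fastforce
  then show ?case
  proof cases
    case 1
    then have "A [] [] = 0" using supported_0[OF Nil(3), of "[]" "[]"] by simp
    then show ?thesis using Nil by (simp add: act_zero_symb)
  next
    case 2
    have v: "A [] [] \<in> V" using Nil by (simp add: mform_V)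
    then show ?thesis using 2 supported_0[OF Nil(4)]
      by (simp add: act_def V_D Endo_zero)
  qed
next
  case (ConsB d A \<eta> b bs)
  have "symb_op (d - 2) (ctrB b A) \<eta> [] bs = 0"
    by (rule ConsB(1)[of "n - 1" N]) (use ConsB in \<open>simp_all add: mform_ctrB supported_ctrB\<close>)
  moreover have "symb_op d A (ctrB b \<eta>) [] bs = 0"
    by (rule ConsB(2)[of n "N - 1"]) (use ConsB in \<open>simp_all add: mform_ctrB supported_ctrB\<close>)
  ultimately show ?case by simp
next
  case (ConsQ d A \<eta> q qs bs)
  have "symb_op (d - 1) (ctrQ q A) \<eta> qs bs = 0"
    by (rule ConsQ(1)[of "n - 1" N]) (use ConsQ in \<open>simp_all add: mform_ctrQ supported_ctrQ\<close>)
  moreover have "symb_op d A (ctrQ q \<eta>) qs bs = 0"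
    by (rule ConsQ(2)[of n "N - 1"]) (use ConsQ in \<open>simp_all add: mform_ctrQ supported_ctrQ\<close>)
  ultimately show ?case by (simp add: signed_simps)
qed

section \<open>The bracket of symbols represents the graded commutator\<close>

lemma Vdeg_D:
  assumes "v \<in> Vdeg d"
  shows "fst v \<in> Endo" "fst (snd v) \<in> Qs" "snd (snd v) \<in> Bs"
    "fst (snd v) = 0 \<or> d = -1" "snd (snd v) = 0 \<or> d = -2"
    "x \<in> G i \<Longrightarrow> fst v x \<in> G (i + d)"
  using assms by (auto simp: Vdeg_def)

text \<open>A nonzero section stored in \<open>v\<close> forces \<open>d\<close> to be -1 or -2,
  which is exactly the shift of degree caused by inserting it into \<open>B\<close>.\<close>

lemma symbol_nested_in_Vdeg:
  assumes "symbol e B" "v \<in> Vdeg d"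
  shows "B [fst (snd v)] [] \<in> Vdeg (d + e)" "B [] [snd (snd v)] \<in> Vdeg (d + e)"
proof -
  show "B [fst (snd v)] [] \<in> Vdeg (d + e)"
  proof (cases "fst (snd v) = 0")
    case True
    then show ?thesis using mform_zeroQ[OF symbol_mform[OF assms(1)], of "[]" "[]" "[]"] Vdeg_sub
      by (simp add: subgrp_closed)
  next
    case False
    then have "d = -1" using Vdeg_D[OF assms(2)] by auto
    then show ?thesis using symbol_Vdeg[OF assms(1), of "[fst (snd v)]" "[]"] Vdeg_D[OF assms(2)] by simp
  qed
  show "B [] [snd (snd v)] \<in> Vdeg (d + e)"
  proof (cases "snd (snd v) = 0")
    case True
    then show ?thesis using mform_zeroB[OF symbol_mform[OF assms(1)], of "[]" "[]" "[]"] Vdeg_sub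
      by (simp add: subgrp_closed)
  next
    case False
    then have "d = -2" using Vdeg_D[OF assms(2)] by auto
    then show ?thesis using symbol_Vdeg[OF assms(1), of "[]" "[snd (snd v)]"] Vdeg_D[OF assms(2)] by simp
  qed
qed

lemma comp_in_Vdeg:
  assumes "v \<in> Vdeg d" "w \<in> Vdeg e"
  shows "(fst v \<circ> fst w, 0, 0) \<in> Vdeg (d + e)"
proof -
  have "fst v (fst w x) \<in> G (i + (d + e))" if "x \<in> G i" for x i
    using Vdeg_D(6)[OF assms(1) Vdeg_D(6)[OF assms(2) that]] by (simp add: ac_simps)
  then show ?thesis
    using Vdeg_D[OF assms(1)] Vdeg_D[OF assms(2)] subQ subB
    by (simp add: Vdeg_def Endo_comp subgrp_closed)
qed

lemma triple_signed_diff: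
  "(a - signed i b, 0, 0) = (a, 0, 0) - signed i (b, 0, 0)"
  by (auto simp: signed_def prod_eq_iff)

lemma sbracket_Vdeg:
  assumes "symbol d A" "symbol e B" "secs qs bs"
  shows "sbracket d e A B qs bs \<in> Vdeg (d + e - int (length qs) - 2 * int (length bs))"
  using assms
proof (induction qs arbitrary: d e A B)
  case Nil
  then show ?case
  proof (induction bs arbitrary: d e A B)
    case Nil
    note v = symbol_Vdeg[OF Nil(1), of "[]" "[]", simplified] and w = symbol_Vdeg[OF Nil(2), of "[]" "[]", simplified]
    show ?case
      using comp_in_Vdeg[OF v w] comp_in_Vdeg[OF w v] symbol_nested_in_Vdeg[OF Nil(1) w] symbol_nested_in_Vdeg[OF Nil(2) v]
      by (simp add: triple_signed_diff subgrp_closed Vdeg_sub add.commute)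
  next
    case (Cons b bs)
    have "sbracket (d - 2) e (ctrB b A) B [] bs \<in> Vdeg (d - 2 + e - int (length ([]::'q list)) - 2 * int (length bs))"
      using Cons by (intro Cons(1)) (simp_all add: symbol_ctrB)
    moreover have "sbracket d (e - 2) A (ctrB b B) [] bs \<in> Vdeg (d + (e - 2) - int (length ([]::'q list)) - 2 * int (length bs))"
      using Cons by (intro Cons(1)) (simp_all add: symbol_ctrB)
    ultimately show ?case by (simp add: subgrp_closed Vdeg_sub algebra_simps)
  qed
next
  case (Cons q qs)
  have "sbracket (d - 1) e (ctrQ q A) B qs bs \<in> Vdeg (d - 1 + e - int (length qs) - 2 * int (length bs))"
    using Cons by (intro Cons(1)) (simp_all add: symbol_ctrQ)
  moreover have "sbracket d (e - 1) A (ctrQ q B) qs bs \<in> Vdeg (d + (e - 1) - int (length qs) - 2 * int (length bs))"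
    using Cons by (intro Cons(1)) (simp_all add: symbol_ctrQ)
  ultimately show ?case by (simp add: subgrp_closed Vdeg_sub algebra_simps)
qed

lemma symv_sbracket: "symbol d A \<Longrightarrow> symbol e B \<Longrightarrow> symv (sbracket d e A B)"
  using sbracket_Vdeg Vdeg_V by (metis symv_def)

text \<open>The terms with two contractions of \<open>\<eta>\<close>, or with a contraction and an
  endomorphism, cancel pairwise. What is left is the first clause of
  \<open>sbracket\<close>.\<close>

lemma symb_op_sbracket_base:
  assumes A: "symbol d A" and B: "symbol e B" and \<eta>: "mform Es \<eta>"
  shows "symb_op d A (symb_op e B \<eta>) [] [] - signed (d * e) (symb_op e B (symb_op d A \<eta>) [] [])
    = symb_op (d + e) (sbracket d e A B) \<eta> [] []"
proof -
  obtain \<phi> q b where v: "A [] [] = (\<phi>, q, b)" by (metis prod.collapse)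
  obtain \<psi> r c where w: "B [] [] = (\<psi>, r, c)" by (metis prod.collapse)
  have Vv: "(\<phi>, q, b) \<in> Vdeg d" using symbol_Vdeg[OF A, of "[]" "[]"] v by simp
  have Vw: "(\<psi>, r, c) \<in> Vdeg e" using symbol_Vdeg[OF B, of "[]" "[]"] w by simp
  note f = Vdeg_D[OF Vv, simplified] and g = Vdeg_D[OF Vw, simplified]
  note [simp] = f(1-3) g(1-3)
  have bv: "B [q] [] \<in> V" "B [] [b] \<in> V" "A [r] [] \<in> V" "A [] [c] \<in> V"
    using A B by (simp_all add: symv_V symbol_symv)
  have Ev: "\<eta> [] [] \<in> Es" "\<eta> [q] [] \<in> Es" "\<eta> [r] [] \<in> Es" "\<eta> [] [b] \<in> Es" "\<eta> [] [c] \<in> Es"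
    using \<eta> by (simp_all add: mform_V)
  have cv: "(\<phi> \<circ> \<psi>, 0, 0) \<in> V" "(\<psi> \<circ> \<phi>, 0, 0) \<in> V"
    using comp_in_Vdeg[OF Vv Vw] comp_in_Vdeg[OF Vw Vv] by (auto intro: Vdeg_V)
  have z: "\<eta> [0] [] = 0" "\<eta> [] [0] = 0" "\<eta> [0, x] [] = 0" "\<eta> [x, 0] [] = 0" "\<eta> [] [0, y] = 0" "\<eta> [] [y, 0] = 0"
      "\<eta> [0] [y] = 0" "\<eta> [x] [0] = 0"
    if "x \<in> Qs" "y \<in> Bs" for x y
    using mform_zeroQ[OF \<eta>, of "[]" "[]" "[]"] mform_zeroB[OF \<eta>, of "[]" "[]" "[]"] that
      mform_zeroQ[OF \<eta>, of "[]" "[x]" "[]"] mform_zeroQ[OF \<eta>, of "[x]" "[]" "[]"]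
      mform_zeroB[OF \<eta>, of "[]" "[]" "[y]"] mform_zeroB[OF \<eta>, of "[]" "[y]" "[]"]
      mform_zeroQ[OF \<eta>, of "[]" "[]" "[y]"] mform_zeroB[OF \<eta>, of "[x]" "[]" "[]"]
    by simp_all
  have sw: "\<eta> [r, q] [] = - \<eta> [q, r] []" "\<eta> [] [c, b] = \<eta> [] [b, c]"
    using mform_swap[OF \<eta>, of "[]" r q "[]" "[]"] mform_sym[OF \<eta>, of "[]" "[]" c b "[]"] by simp_all
  have L: "symb_op d A (symb_op e B \<eta>) [] [] = \<phi> (\<psi> (\<eta> [] [])) + \<phi> (\<eta> [r] []) + \<phi> (\<eta> [] [c])
      + (act (B [q] []) \<eta> + signed e (\<psi> (\<eta> [q] []) + \<eta> [q, r] [] + \<eta> [q] [c]))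
      + (act (B [] [b]) \<eta> + (\<psi> (\<eta> [] [b]) + \<eta> [r] [b] + \<eta> [] [b, c]))"
    using Ev by (simp add: v w ctr_apply Endo_add Endo_closed subgrp_closed subE)
  have R: "symb_op e B (symb_op d A \<eta>) [] [] = \<psi> (\<phi> (\<eta> [] [])) + \<psi> (\<eta> [q] []) + \<psi> (\<eta> [] [b])
      + (act (A [r] []) \<eta> + signed d (\<phi> (\<eta> [r] []) + \<eta> [r, q] [] + \<eta> [r] [b]))
      + (act (A [] [c]) \<eta> + (\<phi> (\<eta> [] [c]) + \<eta> [q] [c] + \<eta> [] [c, b]))"
    using Ev by (simp add: v w ctr_apply Endo_add Endo_closed subgrp_closed subE)
  have S: "symb_op (d + e) (sbracket d e A B) \<eta> [] [] =
      \<phi> (\<psi> (\<eta> [] [])) - signed (d * e) (\<psi> (\<phi> (\<eta> [] [])))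
      + (act (B [q] []) \<eta> + act (B [] [b]) \<eta>) - signed (d * e) (act (A [r] []) \<eta> + act (A [] [c]) \<eta>)"
  proof -
    let ?x = "(\<phi> \<circ> \<psi>, 0, 0) - signed (d * e) (\<psi> \<circ> \<phi>, 0, 0)" and ?y = "B [q] [] + B [] [b]"
      and ?z = "signed (d * e) (A [r] [] + A [] [c])"
    have m: "?x \<in> V" "?y \<in> V" "?z \<in> V" "A [r] [] + A [] [c] \<in> V" "signed (d * e) (\<psi> \<circ> \<phi>, 0::'q, 0::'b) \<in> V"
      using bv cv by (simp_all add: subgrp_closed V_sub)
    have "act ?x \<eta> = \<phi> (\<psi> (\<eta> [] [])) - signed (d * e) (\<psi> (\<phi> (\<eta> [] [])))"
      using act_add_symb[OF cv(1) subgrp_neg[OF V_sub m(5)] \<eta>] m(5) cv \<eta>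
      using z[of 0 0] subQ subB
      by (simp add: act_neg_symb act_signed_symb subgrp_closed)
    moreover have "sbracket d e A B [] [] = (?x + ?y) + - ?z"
      by (simp add: v w triple_signed_diff[symmetric])
    moreover have "act ((?x + ?y) + - ?z) \<eta> = act ?x \<eta> + act ?y \<eta> - act ?z \<eta>"
      using m \<eta> by (simp only: act_add_symb act_neg_symb subgrp_closed V_sub add_uminus_conv_diff[symmetric])
    moreover have "act ?y \<eta> = act (B [q] []) \<eta> + act (B [] [b]) \<eta>"
      using bv \<eta> by (simp add: act_add_symb)
    moreover have "act ?z \<eta> = signed (d * e) (act (A [r] []) \<eta> + act (A [] [c]) \<eta>)"
      using bv m \<eta> by (simp add: act_add_symb act_signed_symb)
    ultimately show ?thesis by simp
  qed
  \<comment> \<open>The signs to be compared involve \<open>d\<close>, \<open>e\<close> and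
    \<open>d * e\<close> and agree only where they have to: a nonzero \<open>q\<close> forces
    \<open>d = -1\<close>, a nonzero \<open>r\<close> forces \<open>e = -1\<close>, and a nonzero
    \<open>b\<close> or \<open>c\<close> makes one of the degrees -2. If the section is zero, the
    term is zero too.\<close>
  have s: "signed e x = signed (d * e) x" if "q \<noteq> 0" for x :: 'e
    using f(4) that by (auto simp: signed_def)
  have s': "signed (d * e) (signed d x) = x" if "r \<noteq> 0" for x :: 'e
    using g(4) that by (auto simp: signed_def)
  have s'': "signed (d * e) x = x" if "b \<noteq> 0 \<or> c \<noteq> 0" for x :: 'e
    using f(5) g(5) that by (auto simp: signed_def)
  note z' = z(1,2)[OF f(2,3)] z(3)[OF g(2,3)] z(4)[OF f(2,3)] z(5)[OF g(2,3)] z(6)[OF f(2,3)]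
    z(7)[OF f(2,3)] z(7)[OF g(2,3)] z(7)[OF f(2) g(3)] z(8)[OF f(2,3)] z(8)[OF g(2,3)]
    z(7)[OF g(2) f(3)] z(8)[OF f(2) g(3)] z(8)[OF g(2) f(3)] Endo_zero[OF f(1)] Endo_zero[OF g(1)]
  have k1: "signed e (\<psi> (\<eta> [q] [])) = signed (d * e) (\<psi> (\<eta> [q] []))"
    by (cases "q = 0") (simp_all add: s z' signed_simps(4))
  have k2: "signed (d * e) (signed d (\<phi> (\<eta> [r] []))) = \<phi> (\<eta> [r] [])"
    by (cases "r = 0") (simp_all add: s' z' signed_simps(4))
  have k3: "signed (d * e) (\<psi> (\<eta> [] [b])) = \<psi> (\<eta> [] [b])"
    by (cases "b = 0") (simp_all add: s'' z' signed_simps(4))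
  have k4: "signed (d * e) (\<phi> (\<eta> [] [c])) = \<phi> (\<eta> [] [c])"
    by (cases "c = 0") (simp_all add: s'' z' signed_simps(4))
  \<comment> \<open>Two odd contractions anticommute; the extra minus sign is the one produced by
    \<open>sw\<close>.\<close>
  have k5: "signed e (\<eta> [q, r] []) = - signed (d * e) (signed d (\<eta> [q, r] []))"
  proof (cases "q = 0 \<or> r = 0")
    case False
    then have "d = -1" "e = -1" using f(4) g(4) by auto
    then show ?thesis by (simp add: signed_def)
  qed (auto simp: z' signed_simps(4))
  have k6: "signed e (\<eta> [q] [c]) = signed (d * e) (\<eta> [q] [c])"
    by (cases "q = 0") (simp_all add: s z' signed_simps(4))
  have k7: "signed (d * e) (signed d (\<eta> [r] [b])) = \<eta> [r] [b]"
    by (cases "r = 0") (simp_all add: s' z' signed_simps(4))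
  have k8: "signed (d * e) (\<eta> [] [b, c]) = \<eta> [] [b, c]"
    by (cases "b = 0") (simp_all add: s'' z' signed_simps(4))
  show ?thesis
    unfolding L R S sw signed_simps(1,2,3) k1 k2 k3 k4 k5 k6 k7 k8
    by (simp add: algebra_simps)
qed

text \<open>Contracting either side by one more section gives three commutators: for the contracted
  \<open>A\<close>, for the contracted \<open>B\<close> and for the contracted form. These are the
  three uses \<open>i1\<close>, \<open>i2\<close>, \<open>i3\<close> of the induction hypothesis, so
  only arity zero needs a genuine computation.\<close>

theorem symb_op_sbracket:
  assumes "symbol d A" "symbol e B" "mform Es \<eta>" "secs qs bs"
  shows "symb_op d A (symb_op e B \<eta>) qs bs - signed (d * e) (symb_op e B (symb_op d A \<eta>) qs bs)
    = symb_op (d + e) (sbracket d e A B) \<eta> qs bs"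
  using assms
proof (induction qs arbitrary: d e A B \<eta>)
  case Nil
  then show ?case
  proof (induction bs arbitrary: d e A B \<eta>)
    case Nil
    then show ?case by (intro symb_op_sbracket_base)
  next
    case (Cons b bs)
    have e1: "ctrB b (symb_op e B \<eta>) = symb_op (e - 2) (ctrB b B) \<eta> + symb_op e B (ctrB b \<eta>)"
      by (simp add: fun_eq_iff ctr_apply plus_fun_apply symb_op_ConsB)
    have e2: "ctrB b (symb_op d A \<eta>) = symb_op (d - 2) (ctrB b A) \<eta> + symb_op d A (ctrB b \<eta>)"
      by (simp add: fun_eq_iff ctr_apply plus_fun_apply symb_op_ConsB)
    have e3: "ctrB b (sbracket d e A B) = sbracket (d - 2) e (ctrB b A) B + sbracket d (e - 2) A (ctrB b B)"
      by (simp add: fun_eq_iff ctr_apply plus_fun_apply sbracket_ConsB)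
    have b: "b \<in> Bs" "secs [] bs" using Cons by simp_all
    have m: "symv A" "symv B" "valued \<eta>" "valued (ctrB b \<eta>)" "symv (ctrB b A)" "symv (ctrB b B)"
      using Cons b by (simp_all add: symbol_symv symv_ctrB mform_ctrB mform_valued)
    have val: "valued (symb_op e B \<eta>)" "valued (symb_op (e - 2) (ctrB b B) \<eta>)" "valued (symb_op e B (ctrB b \<eta>))"
      "valued (symb_op d A \<eta>)" "valued (symb_op (d - 2) (ctrB b A) \<eta>)" "valued (symb_op d A (ctrB b \<eta>))"
      using m symb_op_valued unfolding valued_def by metis+
    have sv: "symv (sbracket (d - 2) e (ctrB b A) B)" "symv (sbracket d (e - 2) A (ctrB b B))"
      using Cons b by (simp_all add: symv_sbracket symbol_ctrB)
    note i1 = Cons(1)[OF symbol_ctrB[OF Cons(2) b(1)] Cons(3,4) b(2)]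
    note i2 = Cons(1)[OF Cons(2) symbol_ctrB[OF Cons(3) b(1)] Cons(4) b(2)]
    note i3 = Cons(1)[OF Cons(2,3) mform_ctrB[OF Cons(4) b(1)] b(2)]
    have p: "d - 2 + e = d + e - 2" "d + (e - 2) = d + e - 2" by simp_all
    have sg: "signed ((d - 2) * e) x = signed (d * e) x" "signed (d * (e - 2)) x = signed (d * e) x" for x :: 'e
      by (simp_all add: signed_def)
    have "symb_op (d + e) (sbracket d e A B) \<eta> [] (b # bs) =
        symb_op (d + e - 2) (sbracket (d - 2) e (ctrB b A) B) \<eta> [] bs
      + symb_op (d + e - 2) (sbracket d (e - 2) A (ctrB b B)) \<eta> [] bs
      + symb_op (d + e) (sbracket d e A B) (ctrB b \<eta>) [] bs"
      using Cons b sv by (simp add: e3 symb_op_add_symb)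
    also have "\<dots> = symb_op d A (symb_op e B \<eta>) [] (b # bs) - signed (d * e) (symb_op e B (symb_op d A \<eta>) [] (b # bs))"
      unfolding i1[unfolded p sg, symmetric] i2[unfolded p sg, symmetric] i3[symmetric]
      using m val b by (simp add: e1 e2 symb_op_add_form signed_simps)
    finally show ?case by simp
  qed
next
  case (Cons q qs)
  have e1: "ctrQ q (symb_op e B \<eta>) = symb_op (e - 1) (ctrQ q B) \<eta> + signed e (symb_op e B (ctrQ q \<eta>))"
    by (simp add: fun_eq_iff ctr_apply plus_fun_apply signed_fun)
  have e2: "ctrQ q (symb_op d A \<eta>) = symb_op (d - 1) (ctrQ q A) \<eta> + signed d (symb_op d A (ctrQ q \<eta>))"
    by (simp add: fun_eq_iff ctr_apply plus_fun_apply signed_fun)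
  have e3: "ctrQ q (sbracket d e A B) = sbracket (d - 1) e (ctrQ q A) B + signed d (sbracket d (e - 1) A (ctrQ q B))"
    by (simp add: fun_eq_iff ctr_apply plus_fun_apply signed_fun)
  have b: "q \<in> Qs" "secs qs bs" using Cons by simp_all
  have m: "symv A" "symv B" "valued \<eta>" "valued (ctrQ q \<eta>)" "symv (ctrQ q A)" "symv (ctrQ q B)"
    using Cons b by (simp_all add: symbol_symv symv_ctrQ mform_ctrQ mform_valued)
  have val: "valued (symb_op e B \<eta>)" "valued (symb_op (e - 1) (ctrQ q B) \<eta>)" "valued (symb_op e B (ctrQ q \<eta>))"
    "valued (symb_op d A \<eta>)" "valued (symb_op (d - 1) (ctrQ q A) \<eta>)" "valued (symb_op d A (ctrQ q \<eta>))"
    using m symb_op_valued unfolding valued_def by metis+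
  then have val': "valued (signed i (symb_op e B (ctrQ q \<eta>)))" "valued (signed i (symb_op d A (ctrQ q \<eta>)))" for i
    unfolding valued_def by (simp_all add: signed_fun subgrp_closed subE)
  have sv: "symv (sbracket (d - 1) e (ctrQ q A) B)" "symv (sbracket d (e - 1) A (ctrQ q B))"
    using Cons b by (simp_all add: symv_sbracket symbol_ctrQ)
  then have sv': "symv (signed i (sbracket d (e - 1) A (ctrQ q B)))" for i
    unfolding symv_def by (simp_all add: signed_fun subgrp_closed V_sub)
  note i1 = Cons(1)[OF symbol_ctrQ[OF Cons(2) b(1)] Cons(3,4) b(2)]
  note i2 = Cons(1)[OF Cons(2) symbol_ctrQ[OF Cons(3) b(1)] Cons(4) b(2)]
  note i3 = Cons(1)[OF Cons(2,3) mform_ctrQ[OF Cons(4) b(1)] b(2)]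
  have p: "d - 1 + e = d + e - 1" "d + (e - 1) = d + e - 1" by simp_all
  have w1: "symb_op d A (symb_op e B \<eta>) (q # qs) bs = symb_op (d - 1) (ctrQ q A) (symb_op e B \<eta>) qs bs
      + signed d (symb_op d A (symb_op (e - 1) (ctrQ q B) \<eta>) qs bs + signed e (symb_op d A (symb_op e B (ctrQ q \<eta>)) qs bs))"
    using m val val' b by (simp add: e1 symb_op_add_form symb_op_signed_form)
  have w2: "symb_op e B (symb_op d A \<eta>) (q # qs) bs = symb_op (e - 1) (ctrQ q B) (symb_op d A \<eta>) qs bs
      + signed e (symb_op e B (symb_op (d - 1) (ctrQ q A) \<eta>) qs bs + signed d (symb_op e B (symb_op d A (ctrQ q \<eta>)) qs bs))"
    using m val val' b by (simp add: e2 symb_op_add_form symb_op_signed_form)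
  have "symb_op (d + e) (sbracket d e A B) \<eta> (q # qs) bs =
      symb_op (d + e - 1) (sbracket (d - 1) e (ctrQ q A) B) \<eta> qs bs
    + signed d (symb_op (d + e - 1) (sbracket d (e - 1) A (ctrQ q B)) \<eta> qs bs)
    + signed (d + e) (symb_op (d + e) (sbracket d e A B) (ctrQ q \<eta>) qs bs)"
    using Cons b sv sv' by (simp add: e3 symb_op_add_symb symb_op_signed_symb)
  also have "\<dots> = symb_op d A (symb_op e B \<eta>) (q # qs) bs - signed (d * e) (symb_op e B (symb_op d A \<eta>) (q # qs) bs)"
    unfolding i1[unfolded p, symmetric] i2[unfolded p, symmetric] i3[symmetric] w1 w2
    by (cases "even d"; cases "even e") (simp_all add: signed_def)
  finally show ?case by simp
qed

end

section \<open>The Leibniz rule\<close>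

text \<open>Splits the subsets by whether they contain 0, that is, the shuffles by the factor that
  receives the first argument.\<close>

lemma sum_Pow_Suc:
  "(\<Sum>I\<in>Pow {..<Suc n}. f I) = (\<Sum>I\<in>Pow {..<n}. f (insert 0 (Suc ` I))) + (\<Sum>I\<in>Pow {..<n}. f (Suc ` I))"
  for f :: "nat set \<Rightarrow> 'a::comm_monoid_add"
proof -
  let ?P = "Pow {..<n}"
  have P: "Pow {..<Suc n} = insert 0 ` (image Suc ` ?P) \<union> image Suc ` ?P"
    unfolding lessThan_Suc_eq_insert_0 Pow_insert by (auto simp: Pow_def subset_image_iff)
  have i1: "inj_on (image Suc) ?P" by (auto intro!: inj_onI)
  have i2: "inj_on (\<lambda>I. insert 0 (Suc ` I)) ?P"
  proof (rule inj_onI)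
    fix I J assume "insert 0 (Suc ` I) = insert 0 (Suc ` J)"
    then have "insert 0 (Suc ` I) - {0} = insert 0 (Suc ` J) - {0}" by simp
    then have "Suc ` I = Suc ` J" by auto
    then show "I = J" by (simp add: inj_image_eq_iff)
  qed
  have "(\<Sum>I\<in>Pow {..<Suc n}. f I) = sum f (insert 0 ` (image Suc ` ?P)) + sum f (image Suc ` ?P)"
    unfolding P by (rule sum.union_disjoint) auto
  then show ?thesis
    using i1 i2 by (simp add: image_image sum.reindex o_def)
qed

text \<open>A first argument that goes to the first factor has nothing in front of it.\<close>

lemma inversions_insert_0: "inversions (insert 0 (Suc ` I)) = inversions I"
proof -
  have "{(i, j). i \<in> insert 0 (Suc ` I) \<and> j \<notin> insert 0 (Suc ` I) \<and> j < i}
    = map_prod Suc Suc ` {(i, j). i \<in> I \<and> j \<notin> I \<and> j < i}" (is "?A = ?B")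
  proof (rule set_eqI)
    fix x show "x \<in> ?A \<longleftrightarrow> x \<in> ?B"
      by (cases x; case_tac b) (auto simp: map_prod_def image_iff)
  qed
  then show ?thesis
    by (simp add: inversions_def card_image inj_on_def map_prod_def split_beta prod_eq_iff)
qed

text \<open>Here the first argument goes to the second factor, and every argument of the first
  factor has to pass it: one new inversion for each element of \<open>I\<close>.\<close>

lemma inversions_Suc: assumes "finite I" shows "inversions (Suc ` I) = inversions I + card I"
proof -
  let ?C = "{(i, j). i \<in> I \<and> j \<notin> I \<and> j < i}"
  have "{(i, j). i \<in> Suc ` I \<and> j \<notin> Suc ` I \<and> j < i} = map_prod Suc Suc ` ?C \<union> (\<lambda>i. (Suc i, 0)) ` I" (is "?A = ?B")
  proof (rule set_eqI)
    fix x show "x \<in> ?A \<longleftrightarrow> x \<in> ?B"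
      by (cases x; case_tac b) (auto simp: map_prod_def image_iff)
  qed
  moreover have "finite ?C"
    by (rule finite_subset[of _ "SIGMA i:I. {..<i}"]) (use assms in auto)
  moreover have "card (map_prod Suc Suc ` ?C \<union> (\<lambda>i. (Suc i, 0)) ` I) = card (map_prod Suc Suc ` ?C) + card ((\<lambda>i. (Suc i, 0::nat)) ` I)"
    by (rule card_Un_disjoint) (use assms calculation in auto)
  ultimately show ?thesis
    by (simp add: inversions_def card_image inj_on_def map_prod_def split_beta prod_eq_iff)
qed

lemma Compl_shift: "{j. Suc j \<in> insert 0 (Suc ` I)} = I" "{j. Suc j \<in> - insert 0 (Suc ` I)} = - I"
  "{j. Suc j \<in> Suc ` I} = I" "{j. Suc j \<in> - Suc ` I} = - I"
  by auto

lemma signed_sum: "signed i (sum f A) = (\<Sum>x\<in>A. signed i (f x))"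
  by (simp add: signed_def sum_negf)

text \<open>The sign (-1)^|I| coming from \<open>inversions_Suc\<close> is the same for all summands
  that matter by the parity hypothesis. Homogeneity supplies this hypothesis, since arguments in
  \<open>B\<^sup>*\<close> count twice.\<close>

lemma form_mult_ConsQ:
  assumes "\<And>qs' bs'. set qs' \<subseteq> set qs \<Longrightarrow> set bs' \<subseteq> set bs \<Longrightarrow> \<xi> qs' bs' \<noteq> 0 \<Longrightarrow> even (length qs') \<longleftrightarrow> even i"
    and "\<And>x. scl S 0 x = 0"
  shows "form_mult S \<xi> \<eta> (q # qs) bs =
    form_mult S (ctrQ q \<xi>) \<eta> qs bs + signed i (form_mult S \<xi> (ctrQ q \<eta>) qs bs)"
proof -
  have s: "signed (int (inversions (Suc ` I))) (scl S (\<xi> (nths qs I) (nths bs J)) y)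
      = signed i (signed (int (inversions I)) (scl S (\<xi> (nths qs I) (nths bs J)) y))"
    if "I \<in> Pow {..<length qs}" for I J y
  proof (cases "\<xi> (nths qs I) (nths bs J) = 0")
    case False
    have "finite I" using that finite_subset by blast
    moreover have "{k. k < length qs \<and> k \<in> I} = I" using that by auto
    ultimately have "inversions (Suc ` I) = inversions I + length (nths qs I)"
      by (simp add: inversions_Suc length_nths)
    moreover have "even (length (nths qs I)) \<longleftrightarrow> even i"
      using False by (intro assms(1)) (auto dest: in_set_nthsD)
    ultimately show ?thesis by (auto simp: signed_def)
  qed (simp add: assms(2) signed_simps)
  have "form_mult S \<xi> \<eta> (q # qs) bs =
    (\<Sum>I\<in>Pow {..<length qs}. \<Sum>J\<in>Pow {..<length bs}. signed (int (inversions I))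
      (scl S (\<xi> (q # nths qs I) (nths bs J)) (\<eta> (nths qs (- I)) (nths bs (- J)))))
    + (\<Sum>I\<in>Pow {..<length qs}. \<Sum>J\<in>Pow {..<length bs}. signed (int (inversions (Suc ` I)))
      (scl S (\<xi> (nths qs I) (nths bs J)) (\<eta> (q # nths qs (- I)) (nths bs (- J)))))"
    unfolding form_mult_def
    by (simp only: sum_Pow_Suc nths_Cons Compl_shift inversions_insert_0 list.size add_0_right add_Suc_right) simp
  also have "\<dots> = form_mult S (ctrQ q \<xi>) \<eta> qs bs + signed i (form_mult S \<xi> (ctrQ q \<eta>) qs bs)"
    unfolding form_mult_def signed_sum using s by (simp add: ctr_apply)
  finally show ?thesis .
qed

lemma form_mult_ConsB:
  "form_mult S \<xi> \<eta> qs (b # bs) = form_mult S (ctrB b \<xi>) \<eta> qs bs + form_mult S \<xi> (ctrB b \<eta>) qs bs"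
  unfolding form_mult_def
  by (simp only: sum_Pow_Suc nths_Cons Compl_shift list.size add_0_right add_Suc_right)
    (simp add: ctr_apply sum.distrib)

lemma form_mult_Nil: "form_mult S \<xi> \<eta> [] [] = scl S (\<xi> [] []) (\<eta> [] [])"
  by (simp add: form_mult_def inversions_def signed_def)

text \<open>Two calculi over the same arguments, one with coefficients in \<open>S\<close> and one
  with functions. Since functions sit in degree 0 alone, the degree of a homogeneous scalar form
  fixes the weighted number of its arguments.\<close>

locale leibniz_calculus =
  E: contraction_calculus Qs Bs "elems S" G + R: contraction_calculus Qs Bs Fs H
  for Qs :: "('m \<Rightarrow> 'q::real_vector) set" and Bs :: "('m, 'b::real_vector) dsection set"
    and S :: "('m, 'e::ab_group_add) fmodule" and G :: "int \<Rightarrow> 'e set"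
    and Fs :: "('m \<Rightarrow> real) set" and H :: "int \<Rightarrow> ('m \<Rightarrow> real) set" +
  assumes scl_closed: "f \<in> Fs \<Longrightarrow> x \<in> elems S \<Longrightarrow> scl S f x \<in> elems S"
    and scl_addL: "scl S (f + g) x = scl S f x + scl S g x"
    and scl_addR: "scl S f (x + y) = scl S f x + scl S f y"
    and H_off: "i \<noteq> 0 \<Longrightarrow> H i = {0}"
begin

lemma scl_zeroL: "scl S 0 x = 0"
  using scl_addL[of 0 0 x] by simp

lemma scl_zeroR: "scl S f 0 = 0"
  using scl_addR[of f 0 0] by simp

lemma scl_signedR: "scl S f (signed i x) = signed i (scl S f x)"
proof -
  have "scl S f (- x) = - scl S f x"
    using scl_addR[of f x "- x"] by (simp add: scl_zeroR eq_neg_iff_add_eq_0 add.commute)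
  then show ?thesis by (simp add: signed_def)
qed

text \<open>The infinitesimal form of the Leibniz rule. Contractions are derivations of the product
  already, so they only have to be the same for both symbols.\<close>

definition compat :: "(('m \<Rightarrow> 'q), ('m, 'b) dsection, 'e) symb \<Rightarrow> (('m \<Rightarrow> 'q), ('m, 'b) dsection, 'm \<Rightarrow> real) symb \<Rightarrow> bool" where
  "compat A A' \<longleftrightarrow> (\<forall>qs bs. E.secs qs bs \<longrightarrow> snd (A qs bs) = snd (A' qs bs) \<and>
     (\<forall>f\<in>Fs. \<forall>x\<in>elems S. fst (A qs bs) (scl S f x) = scl S (fst (A' qs bs) f) x + scl S f (fst (A qs bs) x)))"

lemma compat_ctrQ: "compat A A' \<Longrightarrow> q \<in> Qs \<Longrightarrow> compat (ctrQ q A) (ctrQ q A')"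
  and compat_ctrB: "compat A A' \<Longrightarrow> b \<in> Bs \<Longrightarrow> compat (ctrB b A) (ctrB b A')"
  by (simp_all add: compat_def ctr_apply)

lemma homog_parity:
  assumes "R.homog i \<xi>" "E.secs qs bs" "\<xi> qs bs \<noteq> 0" shows "even (length qs) \<longleftrightarrow> even i"
proof -
  have "i - int (length qs) - 2 * int (length bs) = 0"
    using R.homog_G[OF assms(1,2)] H_off assms(3) by fastforce
  then have "i = int (length qs) + 2 * int (length bs)" by simp
  then show ?thesis by simp
qed

lemma form_mult_ConsQ':
  assumes "R.homog i \<xi>" "E.secs qs bs"
  shows "form_mult S \<xi> \<eta> (q # qs) bs =
    form_mult S (ctrQ q \<xi>) \<eta> qs bs + signed i (form_mult S \<xi> (ctrQ q \<eta>) qs bs)"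
proof (rule form_mult_ConsQ)
  fix qs' bs' assume "set qs' \<subseteq> set qs" "set bs' \<subseteq> set bs" "\<xi> qs' bs' \<noteq> 0"
  then show "even (length qs') \<longleftrightarrow> even i"
    using assms by (intro homog_parity[of i \<xi> qs' bs']) (auto simp: E.secs_def)
qed (simp add: scl_zeroL)

lemma form_mult_in:
  assumes "R.valued \<xi>" "E.valued \<eta>" "E.secs qs bs"
  shows "form_mult S \<xi> \<eta> qs bs \<in> elems S"
proof -
  have sum: "sum f A \<in> elems S" if "\<And>x. x \<in> A \<Longrightarrow> f x \<in> elems S" for f :: "nat set \<Rightarrow> 'e" and A
    using that by (induction A rule: infinite_finite_induct) (auto simp: subgrp_closed E.subE)
  have "E.secs (nths qs I) (nths bs J)" for I J
    using assms(3) by (auto simp: E.secs_def dest: in_set_nthsD)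
  then show ?thesis
    using assms(1,2) unfolding form_mult_def
    by (intro sum) (auto intro!: subgrp_signed E.subE scl_closed simp: E.valued_def R.valued_def)
qed

lemma form_mult_cong:
  assumes "\<And>qs bs. E.secs qs bs \<Longrightarrow> \<xi> qs bs = \<xi>' qs bs" "\<And>qs bs. E.secs qs bs \<Longrightarrow> \<eta> qs bs = \<eta>' qs bs"
    "E.secs qs bs"
  shows "form_mult S \<xi> \<eta> qs bs = form_mult S \<xi>' \<eta>' qs bs"
proof -
  have "E.secs (nths qs I) (nths bs J)" for I J
    using assms(3) by (auto simp: E.secs_def dest: in_set_nthsD)
  then show ?thesis using assms(1,2) by (simp add: form_mult_def)
qed

lemma form_mult_addL: "form_mult S (\<xi> + \<xi>') \<eta> = form_mult S \<xi> \<eta> + form_mult S \<xi>' \<eta>"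
  and form_mult_addR: "form_mult S \<xi> (\<eta> + \<eta>') = form_mult S \<xi> \<eta> + form_mult S \<xi> \<eta>'"
  by (simp_all add: form_mult_def fun_eq_iff plus_fun_apply scl_addL scl_addR signed_simps sum.distrib)

lemma form_mult_signedR: "form_mult S \<xi> (signed i \<eta>) = signed i (form_mult S \<xi> \<eta>)"
  by (simp add: form_mult_def fun_eq_iff signed_fun scl_signedR signed_simps signed_sum add.commute)

lemma scl_signedL: "scl S (signed i f) x = signed i (scl S f x)"
proof -
  have "scl S (- f) x = - scl S f x"
    using scl_addL[of f "- f" x] by (simp add: scl_zeroL eq_neg_iff_add_eq_0 add.commute)
  then show ?thesis by (simp add: signed_def)
qed

lemma form_mult_signedL: "form_mult S (signed i \<xi>) \<eta> = signed i (form_mult S \<xi> \<eta>)"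
  by (simp add: form_mult_def fun_eq_iff signed_fun scl_signedL signed_simps signed_sum add.commute)

text \<open>Both sides satisfy one recursion with three terms, because a contraction can hit the
  symbol, \<open>\<xi>\<close> or \<open>\<eta>\<close>. The rule is thereby reduced to arity zero,
  where it is \<open>compat\<close>.\<close>

theorem symb_op_form_mult:
  assumes "E.symbol d A" "R.symbol d A'" "compat A A'" "R.homog i \<xi>" "R.mform Fs \<xi>" "E.valued \<eta>" "E.secs qs bs"
  shows "symb_op d A (form_mult S \<xi> \<eta>) qs bs =
    form_mult S (symb_op d A' \<xi>) \<eta> qs bs + signed (d * i) (form_mult S \<xi> (symb_op d A \<eta>) qs bs)"
  using assms
proof (induction qs arbitrary: d A A' i \<xi> \<eta>)
  case Nil
  then show ?case
  proof (induction bs arbitrary: d A A' i \<xi> \<eta>)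
    case Nil
    obtain \<phi> q b where v: "A [] [] = (\<phi>, q, b)" by (metis prod.collapse)
    obtain \<phi>' where w: "A' [] [] = (\<phi>', q, b)"
      using Nil(3) v by (metis E.secs_simps(1) compat_def prod.collapse snd_conv)
    have V: "(\<phi>, q, b) \<in> E.V" using E.symbol_symv[OF Nil(1)] E.symv_V[of A "[]" "[]"] v by simp
    note [simp] = E.V_D[OF V, simplified]
    have x: "\<xi> [] [] \<in> Fs" "\<eta> [] [] \<in> elems S"
      using Nil by (auto simp: E.valued_def intro: R.mform_V)
    \<comment> \<open>A nonzero \<open>\<xi> [] []\<close> forces \<open>i\<close> to be even, so
      its signs disappear in arity zero.\<close>
    have i: "signed (d * i) (scl S (\<xi> [] []) y) = scl S (\<xi> [] []) y" "signed i (scl S (\<xi> [] []) y) = scl S (\<xi> [] []) y" for y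
      using homog_parity[OF Nil(4), of "[]" "[]"]
      by (cases "\<xi> [] [] = 0"; simp add: scl_zeroL signed_simps; simp add: signed_def)+
    have c: "\<phi> (scl S (\<xi> [] []) (\<eta> [] [])) = scl S (\<phi>' (\<xi> [] [])) (\<eta> [] []) + scl S (\<xi> [] []) (\<phi> (\<eta> [] []))"
      using Nil(3) x v w unfolding compat_def by (metis E.secs_simps(1) fst_conv)
    have q: "form_mult S \<xi> \<eta> [q] [] = scl S (\<xi> [q] []) (\<eta> [] []) + scl S (\<xi> [] []) (\<eta> [q] [])"
      using form_mult_ConsQ'[OF Nil(4), of "[]" "[]" \<eta> q] by (simp add: form_mult_Nil ctr_apply i)
    have b: "form_mult S \<xi> \<eta> [] [b] = scl S (\<xi> [] [b]) (\<eta> [] []) + scl S (\<xi> [] []) (\<eta> [] [b])"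
      by (simp add: form_mult_ConsB form_mult_Nil ctr_apply)
    show ?case
      by (simp add: v w form_mult_Nil c q b scl_addL scl_addR signed_simps i algebra_simps)
  next
    case (Cons b bs)
    have e: "ctrB b (form_mult S \<xi> \<eta>) = form_mult S (ctrB b \<xi>) \<eta> + form_mult S \<xi> (ctrB b \<eta>)"
      by (simp add: fun_eq_iff ctr_apply plus_fun_apply form_mult_ConsB)
    have e1: "ctrB b (symb_op d A' \<xi>) = symb_op (d - 2) (ctrB b A') \<xi> + symb_op d A' (ctrB b \<xi>)"
      by (simp add: fun_eq_iff ctr_apply plus_fun_apply symb_op_ConsB)
    have e2: "ctrB b (symb_op d A \<eta>) = symb_op (d - 2) (ctrB b A) \<eta> + symb_op d A (ctrB b \<eta>)"
      by (simp add: fun_eq_iff ctr_apply plus_fun_apply symb_op_ConsB)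
    have b: "b \<in> Bs" "E.secs [] bs" using Cons by simp_all
    have sg: "signed ((d - 2) * i) x = signed (d * i) x" "signed (d * (i - 2)) x = signed (d * i) x" for x :: 'e
      by (simp_all add: signed_def)
    have val: "E.valued (form_mult S (ctrB b \<xi>) \<eta>)" "E.valued (form_mult S \<xi> (ctrB b \<eta>))"
      using Cons b form_mult_in R.mform_valued R.mform_ctrB E.valued_ctrB unfolding E.valued_def by metis+
    have i1: "symb_op (d - 2) (ctrB b A) (form_mult S \<xi> \<eta>) [] bs =
      form_mult S (symb_op (d - 2) (ctrB b A') \<xi>) \<eta> [] bs + signed (d * i) (form_mult S \<xi> (symb_op (d - 2) (ctrB b A) \<eta>) [] bs)"
      using Cons b by (subst Cons(1)[of _ _ "ctrB b A'" i]) (simp_all add: E.symbol_ctrB R.symbol_ctrB compat_ctrB sg)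
    have i2: "symb_op d A (form_mult S (ctrB b \<xi>) \<eta>) [] bs =
      form_mult S (symb_op d A' (ctrB b \<xi>)) \<eta> [] bs + signed (d * i) (form_mult S (ctrB b \<xi>) (symb_op d A \<eta>) [] bs)"
      using Cons b by (subst Cons(1)[of _ _ A' "i - 2"]) (simp_all add: R.homog_ctrB R.mform_ctrB sg)
    have i3: "symb_op d A (form_mult S \<xi> (ctrB b \<eta>)) [] bs =
      form_mult S (symb_op d A' \<xi>) (ctrB b \<eta>) [] bs + signed (d * i) (form_mult S \<xi> (symb_op d A (ctrB b \<eta>)) [] bs)"
      using Cons b by (subst Cons(1)[of _ _ A' i]) (simp_all add: E.valued_ctrB)
    show ?case
      using val b Cons.prems(1)
      by (simp add: e E.symb_op_add_form E.symbol_symv i1 i2 i3 form_mult_ConsB e1 e2 form_mult_addL form_mult_addR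
          plus_fun_apply signed_simps ac_simps)
  qed
next
  case (Cons q qs)
  have b: "q \<in> Qs" "E.secs qs bs" using Cons by simp_all
  have sg: "signed ((d - 1) * i) x = signed (d * i) (signed i x)" "signed (d * (i - 1)) x = signed (d * i) (signed d x)" for x :: 'e
    by (auto simp: signed_def)
  have hs: "R.homog (i + d) (symb_op d A' \<xi>)" using Cons by (intro R.homog_symb_op)
  have e: "ctrQ q (form_mult S \<xi> \<eta>) qs' bs' = (form_mult S (ctrQ q \<xi>) \<eta> + signed i (form_mult S \<xi> (ctrQ q \<eta>))) qs' bs'"
    if "E.secs qs' bs'" for qs' bs'
    using that Cons(5) by (simp add: ctr_apply plus_fun_apply signed_fun form_mult_ConsQ')
  have e1: "ctrQ q (symb_op d A' \<xi>) = symb_op (d - 1) (ctrQ q A') \<xi> + signed d (symb_op d A' (ctrQ q \<xi>))"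
    by (simp add: fun_eq_iff ctr_apply plus_fun_apply signed_fun)
  have e2: "ctrQ q (symb_op d A \<eta>) = symb_op (d - 1) (ctrQ q A) \<eta> + signed d (symb_op d A (ctrQ q \<eta>))"
    by (simp add: fun_eq_iff ctr_apply plus_fun_apply signed_fun)
  have val: "E.valued (form_mult S (ctrQ q \<xi>) \<eta>)" "E.valued (form_mult S \<xi> (ctrQ q \<eta>))"
    using Cons b form_mult_in R.mform_valued R.mform_ctrQ E.valued_ctrQ unfolding E.valued_def by metis+
  then have val': "E.valued (signed i (form_mult S \<xi> (ctrQ q \<eta>)))"
    by (simp add: E.valued_def signed_fun subgrp_closed E.subE)
  have i1: "symb_op (d - 1) (ctrQ q A) (form_mult S \<xi> \<eta>) qs bs =
    form_mult S (symb_op (d - 1) (ctrQ q A') \<xi>) \<eta> qs bs + signed (d * i) (signed i (form_mult S \<xi> (symb_op (d - 1) (ctrQ q A) \<eta>) qs bs))"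
    using Cons b by (subst Cons(1)[of _ _ "ctrQ q A'" i]) (simp_all add: E.symbol_ctrQ R.symbol_ctrQ compat_ctrQ sg)
  have i2: "symb_op d A (form_mult S (ctrQ q \<xi>) \<eta>) qs bs =
    form_mult S (symb_op d A' (ctrQ q \<xi>)) \<eta> qs bs + signed (d * i) (signed d (form_mult S (ctrQ q \<xi>) (symb_op d A \<eta>) qs bs))"
    using Cons b by (subst Cons(1)[of _ _ A' "i - 1"]) (simp_all add: R.homog_ctrQ R.mform_ctrQ sg)
  have i3: "symb_op d A (form_mult S \<xi> (ctrQ q \<eta>)) qs bs =
    form_mult S (symb_op d A' \<xi>) (ctrQ q \<eta>) qs bs + signed (d * i) (form_mult S \<xi> (symb_op d A (ctrQ q \<eta>)) qs bs)"
    using Cons b by (subst Cons(1)[of _ _ A' i]) (simp_all add: E.valued_ctrQ)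
  have "symb_op d A (ctrQ q (form_mult S \<xi> \<eta>)) qs bs
     = symb_op d A (form_mult S (ctrQ q \<xi>) \<eta> + signed i (form_mult S \<xi> (ctrQ q \<eta>))) qs bs"
    by (rule E.symb_op_cong) (use Cons b e in \<open>simp_all add: E.symbol_symv\<close>)
  also have "\<dots> = symb_op d A (form_mult S (ctrQ q \<xi>) \<eta>) qs bs + signed i (symb_op d A (form_mult S \<xi> (ctrQ q \<eta>)) qs bs)"
    using val val' b Cons.prems(1) by (simp add: E.symb_op_add_form E.symb_op_signed_form E.symbol_symv)
  finally have L: "symb_op d A (form_mult S \<xi> \<eta>) (q # qs) bs =
      symb_op (d - 1) (ctrQ q A) (form_mult S \<xi> \<eta>) qs bs
    + signed d (symb_op d A (form_mult S (ctrQ q \<xi>) \<eta>) qs bs + signed i (symb_op d A (form_mult S \<xi> (ctrQ q \<eta>)) qs bs))"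
    by simp
  show ?case
    unfolding L i1 i2 i3 form_mult_ConsQ'[OF hs b(2)] form_mult_ConsQ'[OF Cons(5) b(2)] e1 e2
      form_mult_addL form_mult_addR form_mult_signedL form_mult_signedR plus_fun_apply signed_fun
    by (cases "even d"; cases "even i") (simp_all add: signed_def)
qed

end

section \<open>Smooth functions and sections\<close>

lemma Ck_on_continuous: "Ck_on n k V f \<Longrightarrow> continuous_map (subtopology (Euclidean_space n) V) euclideanreal f"
  by (cases k) auto

lemma Ck_on_Suc_D: "Ck_on n (Suc k) V f \<Longrightarrow> Ck_on n k V f"
proof (induction k arbitrary: f)
  case (Suc k)
  obtain g where "continuous_map (subtopology (Euclidean_space n) V) euclideanreal f"
    "\<And>i x. i < n \<Longrightarrow> x \<in> V \<Longrightarrow> ((\<lambda>t. f (x(i := t))) has_real_derivative g i x) (at (x i))"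
    "\<And>i. i < n \<Longrightarrow> Ck_on n (Suc k) V (g i)"
    using Ck_on.simps(2)[of n "Suc k" V f, THEN iffD1, OF Suc(2)] by blast
  then show ?case unfolding Ck_on.simps(2)[of n k] by (intro conjI exI[of _ g]) (auto intro: Suc(1))
qed simp

lemma Ck_on_const: "Ck_on n k V (\<lambda>x. c)"
proof (induction k arbitrary: c)
  case (Suc k)
  show ?case unfolding Ck_on.simps(2) using Suc[of 0] by (auto intro!: exI[of _ "\<lambda>_ _. 0"])
qed simp

lemma Ck_on_add: "Ck_on n k V f \<Longrightarrow> Ck_on n k V g \<Longrightarrow> Ck_on n k V (\<lambda>x. f x + g x)"
proof (induction k arbitrary: f g)
  case (Suc k)
  obtain f' g' where d: "\<And>i x. i < n \<Longrightarrow> x \<in> V \<Longrightarrow> ((\<lambda>t. f (x(i := t))) has_real_derivative f' i x) (at (x i))"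
    "\<And>i x. i < n \<Longrightarrow> x \<in> V \<Longrightarrow> ((\<lambda>t. g (x(i := t))) has_real_derivative g' i x) (at (x i))"
    "\<And>i. i < n \<Longrightarrow> Ck_on n k V (f' i)" "\<And>i. i < n \<Longrightarrow> Ck_on n k V (g' i)"
    using Suc(2,3) unfolding Ck_on.simps(2) by blast
  show ?case unfolding Ck_on.simps(2)
    using Suc(2,3)[THEN Ck_on_continuous] d Suc(1)
    by (intro conjI exI[of _ "\<lambda>i x. f' i x + g' i x"])
      (auto intro!: continuous_map_add DERIV_add)
qed (simp add: continuous_map_add)

lemma Ck_on_mult: "Ck_on n k V f \<Longrightarrow> Ck_on n k V g \<Longrightarrow> Ck_on n k V (\<lambda>x. f x * g x)"
proof (induction k arbitrary: f g)
  case (Suc k)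
  obtain f' g' where d: "\<And>i x. i < n \<Longrightarrow> x \<in> V \<Longrightarrow> ((\<lambda>t. f (x(i := t))) has_real_derivative f' i x) (at (x i))"
    "\<And>i x. i < n \<Longrightarrow> x \<in> V \<Longrightarrow> ((\<lambda>t. g (x(i := t))) has_real_derivative g' i x) (at (x i))"
    "\<And>i. i < n \<Longrightarrow> Ck_on n k V (f' i)" "\<And>i. i < n \<Longrightarrow> Ck_on n k V (g' i)"
    using Suc(2,3) unfolding Ck_on.simps(2) by blast
  have "((\<lambda>t. f (x(i := t)) * g (x(i := t))) has_real_derivative f' i x * g x + g' i x * f x) (at (x i))"
    if "i < n" "x \<in> V" for i x
    using DERIV_mult[OF d(1)[OF that] d(2)[OF that]] by simp
  then show ?case unfolding Ck_on.simps(2)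
    using Suc(2,3)[THEN Ck_on_continuous] Suc(2,3)[THEN Ck_on_Suc_D] d(3,4)
    by (intro conjI exI[of _ "\<lambda>i x. f' i x * g x + g' i x * f x"])
      (auto intro!: continuous_map_real_mult Ck_on_add Suc(1))
qed (simp add: continuous_map_real_mult)

lemma Ck_on_subset: "Ck_on n k V f \<Longrightarrow> W \<subseteq> V \<Longrightarrow> Ck_on n k W f"
proof (induction k arbitrary: f)
  case 0
  then show ?case by (auto intro: continuous_map_from_subtopology_mono)
next
  case (Suc k)
  obtain g where "continuous_map (subtopology (Euclidean_space n) V) euclideanreal f"
    "\<And>i x. i < n \<Longrightarrow> x \<in> V \<Longrightarrow> ((\<lambda>t. f (x(i := t))) has_real_derivative g i x) (at (x i))"
    "\<And>i. i < n \<Longrightarrow> Ck_on n k V (g i)"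
    using Suc(2) unfolding Ck_on.simps(2) by blast
  then show ?case unfolding Ck_on.simps(2) using Suc(1,3)
    by (intro conjI exI[of _ g]) (auto intro: continuous_map_from_subtopology_mono)
qed

text \<open>Points of the model space vanish in the coordinates from \<open>n\<close> on, so varying
  a coordinate \<open>i < n\<close> stays inside it and depends continuously on
  \<open>t\<close>.\<close>

lemma eventually_upd_in_open:
  assumes "openin (Euclidean_space n) W" "x \<in> W" "i < n"
  shows "\<forall>\<^sub>F t in nhds (x i). x(i := t) \<in> W"
proof -
  have x0: "x j = 0" if "j \<ge> n" for j
    using assms(1,2) that openin_subset topspace_Euclidean_space by fastforce
  have "continuous_map euclideanreal (Euclidean_space n) (\<lambda>t. x(i := t))"
    unfolding Euclidean_space_def continuous_map_in_subtopology continuous_map_componentwise_UNIV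
    using x0 assms(3) by (auto simp: fun_upd_def)
  then have "open {t. x(i := t) \<in> W}"
    using openin_continuous_map_preimage[OF _ assms(1)] by fastforce
  then show ?thesis
    using assms(2) eventually_nhds_in_open[of "{t. x(i := t) \<in> W}" "x i"] by (simp add: eventually_nhds_in_open)
qed

text \<open>The derivatives in \<open>Ck_on\<close> are not taken relative to \<open>W\<close>. They
  depend on \<open>f\<close> along a coordinate line near \<open>x\<close>, and openness places that
  piece of the line inside \<open>W\<close>.\<close>

lemma Ck_on_cong:
  assumes "openin (Euclidean_space n) W" "\<And>x. x \<in> W \<Longrightarrow> f x = g x" "Ck_on n k W f"
  shows "Ck_on n k W g"
proof -
  have c: "continuous_map (subtopology (Euclidean_space n) W) euclideanreal g"
    using Ck_on_continuous[OF assms(3)] assms(2) by (auto intro: continuous_map_eq)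
  show ?thesis
  proof (cases k)
    case (Suc k')
    have "((\<lambda>t. g (x(i := t))) has_real_derivative D) (at (x i))"
      if "((\<lambda>t. f (x(i := t))) has_real_derivative D) (at (x i))" "x \<in> W" "i < n" for x i D
    proof -
      have "\<forall>\<^sub>F t in nhds (x i). f (x(i := t)) = g (x(i := t))"
        using eventually_upd_in_open[OF assms(1) that(2,3)] by eventually_elim (rule assms(2))
      from DERIV_cong_ev[OF refl this refl, THEN iffD1, OF that(1)] show ?thesis .
    qed
    moreover obtain h where
      "\<And>i x. i < n \<Longrightarrow> x \<in> W \<Longrightarrow> ((\<lambda>t. f (x(i := t))) has_real_derivative h i x) (at (x i))"
      "\<And>i. i < n \<Longrightarrow> Ck_on n k' W (h i)"
      using assms(3) unfolding Suc Ck_on.simps(2) by blast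
    ultimately show ?thesis unfolding Suc Ck_on.simps(2) using c
      by (intro conjI exI[of _ h]) auto
  qed (use c in simp)
qed

section \<open>Smooth functions on a manifold\<close>

lemma smooth_fun_on_const: "smooth_fun_on M W (\<lambda>x. c)"
  by (simp add: smooth_fun_on_def smooth_Rn_def Ck_on_const)

lemma
  assumes "smooth_fun_on M W f" "smooth_fun_on M W g"
  shows smooth_fun_on_add: "smooth_fun_on M W (\<lambda>x. f x + g x)"
    and smooth_fun_on_mult: "smooth_fun_on M W (\<lambda>x. f x * g x)"
proof -
  have "Ck_on (mdim M) k (\<phi> ` (U \<inter> W)) (\<lambda>x. f (inv_into U \<phi> x))"
    "Ck_on (mdim M) k (\<phi> ` (U \<inter> W)) (\<lambda>x. g (inv_into U \<phi> x))" if "(U, \<phi>) \<in> charts M" for U \<phi> k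
    using that assms by (auto simp: smooth_fun_on_def smooth_Rn_def)
  note c = this
  show "smooth_fun_on M W (\<lambda>x. f x + g x)"
    unfolding smooth_fun_on_def smooth_Rn_def using Ck_on_add[OF c] by fast
  show "smooth_fun_on M W (\<lambda>x. f x * g x)"
    unfolding smooth_fun_on_def smooth_Rn_def using Ck_on_mult[OF c] by fast
qed

lemma smooth_fun_on_subset:
  assumes "smooth_fun_on M W f" "U \<subseteq> W" shows "smooth_fun_on M U f"
  unfolding smooth_fun_on_def smooth_Rn_def
proof (intro ballI, clarify)
  fix V \<phi> k assume "(V, \<phi>) \<in> charts M"
  then have "Ck_on (mdim M) k (\<phi> ` (V \<inter> W)) (\<lambda>x. f (inv_into V \<phi> x))"
    using assms(1) by (auto simp: smooth_fun_on_def smooth_Rn_def)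
  then show "Ck_on (mdim M) k (\<phi> ` (V \<inter> U)) (\<lambda>x. f (inv_into V \<phi> x))"
    by (rule Ck_on_subset) (use assms(2) in auto)
qed

text \<open>Serves local trivialisations, whose linearity is known only over their domain. A chart
  carries the open set \<open>W\<close> to an open set of the model space, as
  \<open>Ck_on_cong\<close> requires.\<close>

lemma smooth_fun_on_cong:
  assumes "smooth_manifold M" "open W" "\<And>p. p \<in> W \<Longrightarrow> f p = g p" "smooth_fun_on M W f"
  shows "smooth_fun_on M W g"
  unfolding smooth_fun_on_def smooth_Rn_def
proof (intro ballI, clarify)
  fix V \<phi> k assume c: "(V, \<phi>) \<in> charts M"
  then have h: "openin (Euclidean_space (mdim M)) (\<phi> ` V)"
    "homeomorphic_map (top_of_set V) (subtopology (Euclidean_space (mdim M)) (\<phi> ` V)) \<phi>"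
    using assms(1) by (auto simp: smooth_manifold_def)
  have inj: "inj_on \<phi> V" using homeomorphic_imp_injective_map[OF h(2)] by simp
  have "openin (top_of_set V) (V \<inter> W)" using assms(2) by auto
  then have "openin (subtopology (Euclidean_space (mdim M)) (\<phi> ` V)) (\<phi> ` (V \<inter> W))"
    using homeomorphic_map_openness[OF h(2), of "V \<inter> W"] by simp
  then have "openin (Euclidean_space (mdim M)) (\<phi> ` (V \<inter> W))"
    using h(1) openin_trans_full by blast
  moreover have "Ck_on (mdim M) k (\<phi> ` (V \<inter> W)) (\<lambda>x. f (inv_into V \<phi> x))"
    using assms(4) c by (auto simp: smooth_fun_on_def smooth_Rn_def)
  ultimately show "Ck_on (mdim M) k (\<phi> ` (V \<inter> W)) (\<lambda>x. g (inv_into V \<phi> x))"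
    by - (rule Ck_on_cong[where f = "\<lambda>x. f (inv_into V \<phi> x)"], use assms(3) inj in auto)
qed

lemma smooth_funs_closed:
  shows smooth_funs_const: "(\<lambda>p. c) \<in> elems (smooth_funs M)"
    and smooth_funs_zero: "0 \<in> elems (smooth_funs M)"
    and smooth_funs_one: "1 \<in> elems (smooth_funs M)"
    and smooth_funs_add: "f \<in> elems (smooth_funs M) \<Longrightarrow> g \<in> elems (smooth_funs M) \<Longrightarrow> f + g \<in> elems (smooth_funs M)"
    and smooth_funs_mult: "f \<in> elems (smooth_funs M) \<Longrightarrow> g \<in> elems (smooth_funs M) \<Longrightarrow> f * g \<in> elems (smooth_funs M)"
    and smooth_funs_neg: "f \<in> elems (smooth_funs M) \<Longrightarrow> - f \<in> elems (smooth_funs M)"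
proof -
  show c: "(\<lambda>p. c) \<in> elems (smooth_funs M)" for c
    by (simp add: smooth_funs_def smooth_fun_on_const)
  show "0 \<in> elems (smooth_funs M)" "1 \<in> elems (smooth_funs M)"
    using c[of 0] c[of 1] by (simp_all add: zero_fun_def one_fun_def)
  show "f + g \<in> elems (smooth_funs M)" if "f \<in> elems (smooth_funs M)" "g \<in> elems (smooth_funs M)" for f g
    using that by (simp add: smooth_funs_def plus_fun_def smooth_fun_on_add)
  show m: "f * g \<in> elems (smooth_funs M)" if "f \<in> elems (smooth_funs M)" "g \<in> elems (smooth_funs M)" for f g
    using that by (simp add: smooth_funs_def times_fun_def smooth_fun_on_mult)
  show "- f \<in> elems (smooth_funs M)" if "f \<in> elems (smooth_funs M)"
    using m[OF c[of "-1"] that] by (simp add: fun_Compl_def times_fun_def)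
qed

lemma pscale_real: "pscale f g = f * g" for g :: "'m \<Rightarrow> real"
  by (simp add: pscale_def fun_eq_iff)

lemma pscale_algebra:
  "pscale (f + g) s = pscale f s + pscale g s"
  "pscale f (s + t) = pscale f s + pscale f t"
  "pscale (- f) s = - pscale f s"
  "pscale f (- s) = - pscale f s"
  "pscale (f - g) s = pscale f s - pscale g s"
  "pscale f (s - t) = pscale f s - pscale f t"
  "pscale 0 s = 0" "pscale f 0 = 0"
  "pscale f (pscale g s) = pscale (f * g) s"
  by (simp_all add: pscale_def fun_eq_iff plus_fun_apply scaleR_add_left scaleR_add_right scaleR_diff_left scaleR_diff_right)

section \<open>Sections of a vector bundle and its dual\<close>

lemma section_triv:
  assumes "vector_bundle M E" "(U, t) \<in> trivs E" "p \<in> U" "v \<in> fibre E p" "w \<in> fibre E p"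
  shows "t p (a *\<^sub>R v + b *\<^sub>R w) i = a * t p v i + b * t p w i"
proof -
  have "\<forall>v\<in>fibre E p. \<forall>w\<in>fibre E p. \<forall>a b i. t p (a *\<^sub>R v + b *\<^sub>R w) i = a * t p v i + b * t p w i"
    using assms(1-3) by (auto simp: vector_bundle_def)
  then show ?thesis using assms(4,5) by blast
qed

text \<open>Sums, negatives and multiples of sections are special cases, so smoothness in
  trivialisations is verified once for all of them.\<close>

lemma sections_combination:
  assumes M: "smooth_manifold M" and E: "vector_bundle M E" and s: "s \<in> elems (sections M E)" "s' \<in> elems (sections M E)"
    and f: "f \<in> elems (smooth_funs M)" "g \<in> elems (smooth_funs M)"
  shows "pscale f s + pscale g s' \<in> elems (sections M E)"
proof -
  have "smooth_fun_on M U (\<lambda>p. t p ((pscale f s + pscale g s') p) i)" if "(U, t) \<in> trivs E" "i < brank E" for U t i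
  proof (rule smooth_fun_on_cong[OF M])
    show "open U" using E that by (auto simp: vector_bundle_def)
    show "f p * t p (s p) i + g p * t p (s' p) i = t p ((pscale f s + pscale g s') p) i" if "p \<in> U" for p
      using section_triv[OF E \<open>(U, t) \<in> trivs E\<close> that, of "s p" "s' p"] s
      by (simp add: pscale_def plus_fun_apply sections_def)
    show "smooth_fun_on M U (\<lambda>p. f p * t p (s p) i + g p * t p (s' p) i)"
      using f s that by (intro smooth_fun_on_add smooth_fun_on_mult)
        (auto simp: smooth_funs_def sections_def intro: smooth_fun_on_subset)
  qed
  moreover have "subspace (fibre E p)" for p using E by (simp add: vector_bundle_def)
  ultimately show ?thesis
    using s by (auto simp: sections_def pscale_def plus_fun_apply subspace_add subspace_scale)
qed

lemma sections_nonempty: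
  assumes M: "smooth_manifold M" and E: "vector_bundle M E"
  shows "0 \<in> elems (sections M E)"
proof -
  have sub: "subspace (fibre E p)" for p using E by (simp add: vector_bundle_def)
  have "smooth_fun_on M U (\<lambda>p. t p 0 i)" if "(U, t) \<in> trivs E" for U t i
  proof (rule smooth_fun_on_cong[OF M _ _ smooth_fun_on_const[of M U 0]])
    show "open U" using E that by (auto simp: vector_bundle_def)
    show "0 = t p 0 i" if "p \<in> U" for p
      using section_triv[OF E \<open>(U, t) \<in> trivs E\<close> that, of 0 0 0 0] subspace_0[OF sub] by simp
  qed
  then show ?thesis using subspace_0[OF sub] by (auto simp: sections_def)
qed

lemma sections_closed:
  assumes M: "smooth_manifold M" and E: "vector_bundle M E"
  shows "subgrp (elems (sections M E))"
    and "f \<in> elems (smooth_funs M) \<Longrightarrow> s \<in> elems (sections M E) \<Longrightarrow> pscale f s \<in> elems (sections M E)"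
proof -
  note c = sections_combination[OF M E]
  have one: "pscale 1 s = s" for s :: "'a \<Rightarrow> 'b" by (simp add: pscale_def)
  show "subgrp (elems (sections M E))"
  proof (rule subgrpI)
    show "x + y \<in> elems (sections M E)" if "x \<in> elems (sections M E)" "y \<in> elems (sections M E)" for x y
      using c[OF that smooth_funs_one smooth_funs_one] by (simp add: one)
    show "- x \<in> elems (sections M E)" if "x \<in> elems (sections M E)" for x
      using c[OF that that smooth_funs_neg[OF smooth_funs_one] smooth_funs_zero] by (simp add: one pscale_algebra)
  qed (rule sections_nonempty[OF M E])
  show "f \<in> elems (smooth_funs M) \<Longrightarrow> s \<in> elems (sections M E) \<Longrightarrow> pscale f s \<in> elems (sections M E)"
    using c[of s s f 0] by (simp add: smooth_funs_zero pscale_algebra)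
qed

lemma smooth_funs_sub: "subgrp (elems (smooth_funs M))"
  by (rule subgrpI) (simp_all add: smooth_funs_closed)

lemma smooth_funs_diff: "f \<in> elems (smooth_funs M) \<Longrightarrow> g \<in> elems (smooth_funs M) \<Longrightarrow> f - g \<in> elems (smooth_funs M)"
  by (rule subgrp_diff[OF smooth_funs_sub])

lemma dual_closed:
  shows "subgrp (elems (dual_module M S))"
    and "f \<in> elems (smooth_funs M) \<Longrightarrow> \<beta> \<in> elems (dual_module M S) \<Longrightarrow> (\<lambda>x. pscale f (\<beta> x)) \<in> elems (dual_module M S)"
proof -
  have scl: "scl (smooth_funs M) = (*)" by (simp add: smooth_funs_def fun_eq_iff pscale_real)
  show "subgrp (elems (dual_module M S))"
    by (rule subgrpI)
      (auto simp: dual_module_def linear_over_def smooth_funs_closed plus_fun_apply scl algebra_simps)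
  show "f \<in> elems (smooth_funs M) \<Longrightarrow> \<beta> \<in> elems (dual_module M S) \<Longrightarrow> (\<lambda>x. pscale f (\<beta> x)) \<in> elems (dual_module M S)"
    by (auto simp: dual_module_def linear_over_def smooth_funs_closed pscale_real scl algebra_simps)
qed

section \<open>Tensoriality\<close>

context contraction_calculus
begin

text \<open>The recursion sees only the first argument. Rotation lets conditions on that argument
  control every position, as in \<open>tensorialI\<close>.\<close>

lemma mform_rotateQ:
  assumes "mform C \<eta>" "secs (qs @ q # qs') bs"
  shows "\<eta> (qs @ q # qs') bs = signed (int (length qs)) (\<eta> (q # qs @ qs') bs)"
  using assms
proof (induction qs arbitrary: \<eta>)
  case (Cons r qs)
  have "\<eta> ((r # qs) @ q # qs') bs = ctrQ r \<eta> (qs @ q # qs') bs" by (simp add: ctr_apply)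
  also have "\<dots> = signed (int (length qs)) (\<eta> (r # q # qs @ qs') bs)"
    using Cons.IH[OF mform_ctrQ[OF Cons(2), of r]] Cons(3) by (auto simp only: ctr_apply secs_simps append_Cons)
  also have "\<eta> (r # q # qs @ qs') bs = - \<eta> (q # r # qs @ qs') bs"
    using mform_swap[OF Cons(2), of "[]" r q "qs @ qs'" bs] Cons(3) by simp
  finally show ?case by (simp add: signed_def)
qed (simp add: signed_def)

lemma mform_rotateB:
  assumes "mform C \<eta>" "secs qs (bs @ b # bs')"
  shows "\<eta> qs (bs @ b # bs') = \<eta> qs (b # bs @ bs')"
  using assms
proof (induction bs arbitrary: \<eta>)
  case (Cons c bs)
  have "\<eta> qs ((c # bs) @ b # bs') = ctrB c \<eta> qs (bs @ b # bs')" by (simp add: ctr_apply)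
  also have "\<dots> = \<eta> qs (c # b # bs @ bs')"
    using Cons.IH[OF mform_ctrB[OF Cons(2), of c]] Cons(3) by (simp add: ctr_apply)
  also have "\<eta> qs (c # b # bs @ bs') = \<eta> qs (b # c # bs @ bs')"
    using mform_sym[OF Cons(2), of qs "[]" c b "bs @ bs'"] Cons(3) by simp
  finally show ?case by simp
qed simp

text \<open>Rotate the two equal entries to the front one after the other; there they are
  neighbours.\<close>

lemma mform_not_distinct:
  assumes "mform C \<eta>" "secs qs bs" "\<not> distinct qs"
  shows "\<eta> qs bs = 0"
proof -
  obtain us y vs ws where q: "qs = us @ [y] @ vs @ [y] @ ws"
    using not_distinct_decomp[OF assms(3)] by blast
  have "\<eta> qs bs = signed (int (length us)) (\<eta> (y # us @ vs @ y # ws) bs)"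
    using mform_rotateQ[OF assms(1), of us y "vs @ y # ws" bs] assms(2) by (simp add: q)
  also have "\<eta> (y # us @ vs @ y # ws) bs = ctrQ y \<eta> ((us @ vs) @ y # ws) bs" by (simp add: ctr_apply)
  also have "\<dots> = signed (int (length (us @ vs))) (ctrQ y \<eta> (y # (us @ vs) @ ws) bs)"
    using assms(1,2) mform_rotateQ[OF mform_ctrQ[OF assms(1), of y], of "us @ vs" y ws bs] by (simp add: q)
  also have "\<dots> = 0"
    using mform_alt[OF assms(1), of "[]" y "us @ vs @ ws" bs] assms(2) by (simp add: q ctr_apply signed_simps)
  finally show ?thesis by (simp add: signed_simps)
qed

lemma mform_mset:
  assumes "mform C \<eta>" "secs qs bs" "mset bs' = mset bs"
  shows "\<eta> qs bs' = \<eta> qs bs"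
  using assms
proof (induction bs arbitrary: bs' \<eta>)
  case (Cons b bs)
  then have "b \<in> set bs'" by (metis list.set_intros(1) set_mset_mset)
  then obtain u v where b: "bs' = u @ b # v" by (meson split_list)
  have m: "mset (u @ v) = mset bs" using Cons(4) by (simp add: b)
  then have s: "secs qs (u @ v)" using Cons(3) by (metis secs_def secs_simps(3) set_mset_mset)
  have "\<eta> qs bs' = ctrB b \<eta> qs (u @ v)"
    using mform_rotateB[OF Cons(2), of qs u b v] s Cons(3) by (simp add: b ctr_apply)
  also have "\<dots> = \<eta> qs (b # bs)"
    using Cons.IH[OF mform_ctrB[OF Cons(2), of b] _ m] Cons(3) by (simp add: ctr_apply)
  finally show ?case .
qed simp

end

section \<open>Linearity over functions\<close>

locale tensor_calculus = contraction_calculus Qs Bs Es G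
  for Qs :: "'q::ab_group_add set" and Bs :: "'b::ab_group_add set" and Es :: "'e::ab_group_add set"
    and G :: "int \<Rightarrow> 'e set" +
  fixes Fs :: "'r::ab_group_add set" and sQ :: "'r \<Rightarrow> 'q \<Rightarrow> 'q" and sB :: "'r \<Rightarrow> 'b \<Rightarrow> 'b" and sE :: "'r \<Rightarrow> 'e \<Rightarrow> 'e"
  assumes sQ_closed: "f \<in> Fs \<Longrightarrow> q \<in> Qs \<Longrightarrow> sQ f q \<in> Qs"
    and sB_closed: "f \<in> Fs \<Longrightarrow> b \<in> Bs \<Longrightarrow> sB f b \<in> Bs"
    and sE_closed: "f \<in> Fs \<Longrightarrow> x \<in> Es \<Longrightarrow> sE f x \<in> Es"
    and sE_addL: "sE (f + g) x = sE f x + sE g x"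
    and sE_addR: "sE f (x + y) = sE f x + sE f y"
begin

lemma sE_zero: "sE 0 x = 0" "sE f 0 = 0"
  using sE_addL[of 0 0 x] sE_addR[of f 0 0] by simp_all

lemma sE_neg: "sE (- f) x = - sE f x" "sE f (- x) = - sE f x"
  using sE_addL[of f "- f" x] sE_addR[of f x "- x"]
  by (simp_all add: sE_zero eq_neg_iff_add_eq_0 add.commute)

lemma sE_signed: "sE f (signed i x) = signed i (sE f x)"
  by (simp add: signed_def sE_neg)

definition tensorial :: "('q list \<Rightarrow> 'b list \<Rightarrow> 'e) \<Rightarrow> bool" where
  "tensorial \<eta> \<longleftrightarrow>
     (\<forall>f\<in>Fs. \<forall>qs q qs' bs. secs (qs @ q # qs') bs \<longrightarrow> \<eta> (qs @ sQ f q # qs') bs = sE f (\<eta> (qs @ q # qs') bs)) \<and>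
     (\<forall>f\<in>Fs. \<forall>qs bs b bs'. secs qs (bs @ b # bs') \<longrightarrow> \<eta> qs (bs @ sB f b # bs') = sE f (\<eta> qs (bs @ b # bs')))"

lemma tensorial_Q: "tensorial \<eta> \<Longrightarrow> f \<in> Fs \<Longrightarrow> secs (qs @ q # qs') bs \<Longrightarrow> \<eta> (qs @ sQ f q # qs') bs = sE f (\<eta> (qs @ q # qs') bs)"
  and tensorial_B: "tensorial \<eta> \<Longrightarrow> f \<in> Fs \<Longrightarrow> secs qs (bs @ b # bs') \<Longrightarrow> \<eta> qs (bs @ sB f b # bs') = sE f (\<eta> qs (bs @ b # bs'))"
  by (simp_all add: tensorial_def)

lemma tensorial_ctrQ: "tensorial \<eta> \<Longrightarrow> q \<in> Qs \<Longrightarrow> tensorial (ctrQ q \<eta>)"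
  unfolding tensorial_def[of "ctrQ q \<eta>"]
  using tensorial_Q[of \<eta> _ "q # _"] tensorial_B by (auto simp: ctr_apply)

lemma tensorial_ctrB: "tensorial \<eta> \<Longrightarrow> b \<in> Bs \<Longrightarrow> tensorial (ctrB b \<eta>)"
  unfolding tensorial_def[of "ctrB b \<eta>"]
  using tensorial_Q tensorial_B[of \<eta> _ _ "b # _"] by (auto simp: ctr_apply)

lemma tensorialI:
  assumes "mform Es \<eta>"
    and "\<And>f q qs bs. f \<in> Fs \<Longrightarrow> secs (q # qs) bs \<Longrightarrow> \<eta> (sQ f q # qs) bs = sE f (\<eta> (q # qs) bs)"
    and "\<And>f b qs bs. f \<in> Fs \<Longrightarrow> secs qs (b # bs) \<Longrightarrow> \<eta> qs (sB f b # bs) = sE f (\<eta> qs (b # bs))"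
  shows "tensorial \<eta>"
  unfolding tensorial_def
proof (intro conjI ballI allI impI)
  fix f qs q qs' bs assume "f \<in> Fs" "secs (qs @ q # qs') bs"
  then show "\<eta> (qs @ sQ f q # qs') bs = sE f (\<eta> (qs @ q # qs') bs)"
    using assms(2)[of f q "qs @ qs'" bs] mform_rotateQ[OF assms(1)] by (simp add: sQ_closed sE_signed)
next
  fix f qs b bs bs' assume "f \<in> Fs" "secs qs (bs @ b # bs')"
  then show "\<eta> qs (bs @ sB f b # bs') = sE f (\<eta> qs (bs @ b # bs'))"
    using assms(3)[of f qs b "bs @ bs'"] mform_rotateB[OF assms(1)] by (simp add: sB_closed)
qed

text \<open>The symbol of multiplication by the scalar-valued form \<open>g\<close>.\<close>

definition scal :: "('q list \<Rightarrow> 'b list \<Rightarrow> 'r) \<Rightarrow> ('q, 'b, 'e) symb" where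
  "scal g = (\<lambda>qs bs. ((\<lambda>x. if x \<in> Es then sE (g qs bs) x else 0), 0, 0))"

definition rvalued :: "('q list \<Rightarrow> 'b list \<Rightarrow> 'r) \<Rightarrow> bool" where
  "rvalued g \<longleftrightarrow> (\<forall>qs bs. secs qs bs \<longrightarrow> g qs bs \<in> Fs)"

lemma rvalued_ctrQ: "rvalued g \<Longrightarrow> q \<in> Qs \<Longrightarrow> rvalued (ctrQ q g)"
  and rvalued_ctrB: "rvalued g \<Longrightarrow> b \<in> Bs \<Longrightarrow> rvalued (ctrB b g)"
  by (simp_all add: rvalued_def ctr_apply)

lemma scal_ctrQ: "ctrQ q (scal g) = scal (ctrQ q g)"
  and scal_ctrB: "ctrB b (scal g) = scal (ctrB b g)"
  by (simp_all add: scal_def fun_eq_iff ctr_apply)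

lemma symv_scal: "rvalued g \<Longrightarrow> symv (scal g)"
  using subQ subB subE
  by (auto simp: symv_def scal_def rvalued_def V_def Endo_def sE_closed sE_addR subgrp_closed)

lemma act_scal: "mform Es \<eta> \<Longrightarrow> act (scal g [] []) \<eta> = sE (g [] []) (\<eta> [] [])"
  using mform_zeroQ[of Es \<eta> "[]" "[]" "[]"] mform_zeroB[of Es \<eta> "[]" "[]" "[]"] mform_V[of Es \<eta> "[]" "[]"]
  by (simp add: scal_def)

definition smul :: "'r \<Rightarrow> ('q list \<Rightarrow> 'b list \<Rightarrow> 'e) \<Rightarrow> 'q list \<Rightarrow> 'b list \<Rightarrow> 'e" where
  "smul f \<eta> = (\<lambda>qs bs. sE f (\<eta> qs bs))"

lemma ctrQ_smul: "ctrQ q (smul f \<eta>) = smul f (ctrQ q \<eta>)"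
  and ctrB_smul: "ctrB b (smul f \<eta>) = smul f (ctrB b \<eta>)"
  by (simp_all add: smul_def fun_eq_iff ctr_apply)

text \<open>Multiplication by \<open>f\<close> fails to commute with the operator only through the
  endomorphisms of the coefficients, where it leaves the term \<open>g\<close>. For
  \<open>\<D>\<close> this will be \<open>\<rho>\<^sup>*df\<close>.\<close>

lemma symb_op_smul_form:
  assumes "\<And>qs bs x. secs qs bs \<Longrightarrow> x \<in> Es \<Longrightarrow> fst (A qs bs) (sE f x) = sE f (fst (A qs bs) x) + sE (g qs bs) x"
    and "mform Es \<eta>" "secs qs bs"
  shows "symb_op d A (smul f \<eta>) qs bs = sE f (symb_op d A \<eta> qs bs) + symb_op d (scal g) \<eta> qs bs"
  using assms
proof (induction d A \<eta> qs bs arbitrary: g rule: symb_op_induct)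
  case (Nil d A \<eta>)
  have "\<eta> [] [] \<in> Es" using Nil(2) by (simp add: mform_V)
  then show ?case
    using Nil(1)[of "[]" "[]" "\<eta> [] []"] Nil(2) by (simp add: act_scal) (simp add: act_def smul_def sE_addR)
next
  case (ConsB d A \<eta> b bs)
  have "symb_op (d - 2) (ctrB b A) (smul f \<eta>) [] bs = sE f (symb_op (d - 2) (ctrB b A) \<eta> [] bs) + symb_op (d - 2) (scal (ctrB b g)) \<eta> [] bs"
    by (rule ConsB(1)) (use ConsB(3-) in \<open>simp_all add: ctr_apply\<close>)
  moreover have "symb_op d A (smul f (ctrB b \<eta>)) [] bs = sE f (symb_op d A (ctrB b \<eta>) [] bs) + symb_op d (scal g) (ctrB b \<eta>) [] bs"
    by (rule ConsB(2)) (use ConsB(3-) in \<open>simp_all add: mform_ctrB\<close>)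
  ultimately show ?case by (simp add: ctrB_smul scal_ctrB sE_addR)
next
  case (ConsQ d A \<eta> q qs bs)
  have "symb_op (d - 1) (ctrQ q A) (smul f \<eta>) qs bs = sE f (symb_op (d - 1) (ctrQ q A) \<eta> qs bs) + symb_op (d - 1) (scal (ctrQ q g)) \<eta> qs bs"
    by (rule ConsQ(1)) (use ConsQ(3-) in \<open>simp_all add: ctr_apply\<close>)
  moreover have "symb_op d A (smul f (ctrQ q \<eta>)) qs bs = sE f (symb_op d A (ctrQ q \<eta>) qs bs) + symb_op d (scal g) (ctrQ q \<eta>) qs bs"
    by (rule ConsQ(2)) (use ConsQ(3-) in \<open>simp_all add: mform_ctrQ\<close>)
  ultimately show ?case by (simp add: ctrQ_smul scal_ctrQ sE_addR sE_signed signed_simps)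
qed

text \<open>The symbol of contraction with \<open>q\<close> followed by multiplication by
  \<open>g\<close>. Such a symbol arises from the derivative term of the bracket [f q, r]; its
  analogue \<open>conB\<close> arises from that of
  \<open>\<nabla>\<^sup>*\<^sub>r (f \<beta>)\<close>.\<close>

definition conQ :: "('q list \<Rightarrow> 'b list \<Rightarrow> 'r) \<Rightarrow> 'q \<Rightarrow> ('q, 'b, 'e) symb" where
  "conQ g q = (\<lambda>qs bs. (0, sQ (g qs bs) q, 0))"

definition conB :: "('q list \<Rightarrow> 'b list \<Rightarrow> 'r) \<Rightarrow> 'b \<Rightarrow> ('q, 'b, 'e) symb" where
  "conB g b = (\<lambda>qs bs. (0, 0, sB (g qs bs) b))"

lemma ctr_con: "ctrQ r (conQ g q) = conQ (ctrQ r g) q" "ctrB c (conQ g q) = conQ (ctrB c g) q"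
  "ctrQ r (conB g b) = conB (ctrQ r g) b" "ctrB c (conB g b) = conB (ctrB c g) b"
  by (simp_all add: conQ_def conB_def fun_eq_iff ctr_apply)

lemma symv_con: "rvalued g \<Longrightarrow> q \<in> Qs \<Longrightarrow> symv (conQ g q)" "rvalued g \<Longrightarrow> b \<in> Bs \<Longrightarrow> symv (conB g b)"
  using subQ subB subgrp_zero[OF Endo_sub]
  by (auto simp: symv_def conQ_def conB_def V_def sQ_closed sB_closed rvalued_def subgrp_closed)

text \<open>The contraction itself has degree -1, hence the shift from \<open>d\<close> to
  \<open>d + 1\<close>. The sign that this shift causes for each further odd argument is the sign of
  anticommuting contractions, supplied by \<open>mform_swap\<close>.\<close>

lemma symb_op_contractQ:
  assumes "rvalued g" "q \<in> Qs" "mform Es \<eta>" "tensorial \<eta>" "secs qs bs"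
  shows "symb_op d (conQ g q) \<eta> qs bs = symb_op (d + 1) (scal g) (ctrQ q \<eta>) qs bs"
  using assms
proof (induction qs arbitrary: d g \<eta>)
  case Nil
  then show ?case
  proof (induction bs arbitrary: d g \<eta>)
    case Nil
    then have "g [] [] \<in> Fs" by (simp add: rvalued_def)
    then show ?case
      using tensorial_Q[OF Nil(4), of "g [] []" "[]" q "[]" "[]"] mform_zeroB[OF Nil(3), of "[]" "[]" "[]"] Nil
      by (simp add: act_scal mform_ctrQ conQ_def) (simp add: ctr_apply)
  next
    case (Cons b bs)
    have "d - 2 + 1 = d + 1 - 2" by simp
    then show ?case using Cons by (simp add: mform_ctrB rvalued_ctrB tensorial_ctrB scal_ctrB ctrB_ctrQ ctr_con)
  qed
next
  case (Cons r qs)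
  have "symb_op d (conQ g q) \<eta> (r # qs) bs =
    symb_op d (scal (ctrQ r g)) (ctrQ q \<eta>) qs bs + signed d (symb_op (d + 1) (scal g) (ctrQ q (ctrQ r \<eta>)) qs bs)"
    using Cons by (simp add: mform_ctrQ rvalued_ctrQ tensorial_ctrQ ctr_con)
  also have "symb_op (d + 1) (scal g) (ctrQ q (ctrQ r \<eta>)) qs bs = symb_op (d + 1) (scal g) (signed 1 (ctrQ r (ctrQ q \<eta>))) qs bs"
    using Cons mform_swap[OF Cons(4), of "[]" r q]
    by (intro symb_op_cong) (auto simp: symv_scal ctr_apply signed_def)
  also have "\<dots> = signed 1 (symb_op (d + 1) (scal g) (ctrQ r (ctrQ q \<eta>)) qs bs)"
    using Cons by (simp add: symb_op_signed_form symv_scal)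
  finally show ?case by (simp add: scal_ctrQ signed_simps)
qed

lemma symb_op_contractB:
  assumes "rvalued g" "b \<in> Bs" "mform Es \<eta>" "tensorial \<eta>" "secs qs bs"
  shows "symb_op (d - 2) (conB g b) \<eta> qs bs = symb_op d (scal g) (ctrB b \<eta>) qs bs"
  using assms
proof (induction qs arbitrary: d g \<eta>)
  case Nil
  then show ?case
  proof (induction bs arbitrary: d g \<eta>)
    case Nil
    then have "g [] [] \<in> Fs" by (simp add: rvalued_def)
    then show ?case
      using tensorial_B[OF Nil(4), of "g [] []" "[]" "[]" b "[]"] mform_zeroQ[OF Nil(3), of "[]" "[]" "[]"] Nil
      by (simp add: act_scal mform_ctrB conB_def) (simp add: ctr_apply)
  next
    case (Cons c bs)
    have "symb_op (d - 2) (conB g b) \<eta> [] (c # bs) =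
      symb_op (d - 2) (scal (ctrB c g)) (ctrB b \<eta>) [] bs + symb_op d (scal g) (ctrB b (ctrB c \<eta>)) [] bs"
      using Cons.IH[of "ctrB c g" \<eta> "d - 2"] Cons by (simp only: symb_op_simps mform_ctrB rvalued_ctrB tensorial_ctrB ctr_con secs_simps)
    also have "symb_op d (scal g) (ctrB b (ctrB c \<eta>)) [] bs = symb_op d (scal g) (ctrB c (ctrB b \<eta>)) [] bs"
      using Cons mform_sym[OF Cons(4), of _ "[]" c b]
      by (intro symb_op_cong) (auto simp: symv_scal ctr_apply)
    finally show ?case by (simp add: scal_ctrB)
  qed
next
  case (Cons r qs)
  have "d - 2 - 1 = d - 1 - 2" by simp
  then show ?case
    using Cons.IH[of "ctrQ r g" \<eta> "d - 1"] Cons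
    by (simp add: mform_ctrQ rvalued_ctrQ tensorial_ctrQ scal_ctrQ ctrB_ctrQ signed_minus2 ctr_con)
qed

definition vscale :: "'r \<Rightarrow> ('e \<Rightarrow> 'e) \<times> 'q \<times> 'b \<Rightarrow> ('e \<Rightarrow> 'e) \<times> 'q \<times> 'b" where
  "vscale f v = ((\<lambda>x. sE f (fst v x)), sQ f (fst (snd v)), sB f (snd (snd v)))"

lemma vscale_V: "f \<in> Fs \<Longrightarrow> v \<in> V \<Longrightarrow> vscale f v \<in> V"
  by (cases v) (simp add: vscale_def V_def sQ_closed sB_closed Endo_def sE_closed sE_addR sE_zero)

lemma symb_op_vscale:
  assumes "f \<in> Fs" "symv A" "mform Es \<eta>" "tensorial \<eta>" "secs qs bs"
  shows "symb_op d (\<lambda>qs bs. vscale f (A qs bs)) \<eta> qs bs = sE f (symb_op d A \<eta> qs bs)"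
  using assms
proof (induction d A \<eta> qs bs rule: symb_op_induct)
  case (Nil d A \<eta>)
  have v: "A [] [] \<in> V" using Nil by (simp add: symv_V)
  show ?case
    using tensorial_Q[OF Nil(4,1), of "[]" "fst (snd (A [] []))" "[]" "[]"] tensorial_B[OF Nil(4,1), of "[]" "[]" "snd (snd (A [] []))" "[]"]
      V_D[OF v]
    by (simp add: act_def vscale_def sE_addR)
next
  case (ConsB d A \<eta> b bs)
  have "ctrB b (\<lambda>qs bs. vscale f (A qs bs)) = (\<lambda>qs bs. vscale f (ctrB b A qs bs))"
    by (simp add: fun_eq_iff ctr_apply)
  then show ?case using ConsB by (simp add: symv_ctrB mform_ctrB tensorial_ctrB sE_addR)
next
  case (ConsQ d A \<eta> q qs bs)
  have "ctrQ q (\<lambda>qs bs. vscale f (A qs bs)) = (\<lambda>qs bs. vscale f (ctrQ q A qs bs))"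
    by (simp add: fun_eq_iff ctr_apply)
  then show ?case using ConsQ by (simp add: symv_ctrQ mform_ctrQ tensorial_ctrQ sE_addR sE_signed)
qed

text \<open>
  The two derivation terms cancel: that of the coefficients appears with the sign of the
  commutator with the contraction, and that of the brackets \<open>[f q, r]\<close> and \<open>\<nabla>\<^sup>*\<^sub>q (f \<beta>)\<close> as a contraction.
\<close>

theorem tensorial_symb_op:
  assumes A: "mform V A" and \<eta>: "mform Es \<eta>" "tensorial \<eta>"
    and g: "\<And>f. f \<in> Fs \<Longrightarrow> rvalued (g f)"
    and der: "\<And>f qs bs x. f \<in> Fs \<Longrightarrow> secs qs bs \<Longrightarrow> x \<in> Es \<Longrightarrow>
      fst (A qs bs) (sE f x) = sE f (fst (A qs bs) x) + sE (g f qs bs) x"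
    and AQ: "\<And>f q qs bs. f \<in> Fs \<Longrightarrow> secs (q # qs) bs \<Longrightarrow>
      A (sQ f q # qs) bs = vscale f (A (q # qs) bs) + (0, sQ (g f qs bs) q, 0)"
    and AB: "\<And>f b qs bs. f \<in> Fs \<Longrightarrow> secs qs (b # bs) \<Longrightarrow>
      A qs (sB f b # bs) = vscale f (A qs (b # bs)) + (0, 0, sB (- g f qs bs) b)"
    and neg: "\<And>f. f \<in> Fs \<Longrightarrow> - f \<in> Fs"
  shows "tensorial (symb_op 1 A \<eta>)"
proof (rule tensorialI)
  show "mform Es (symb_op 1 A \<eta>)" using A \<eta> by (simp add: mform_symb_op)
next
  fix f q qs bs assume f: "f \<in> Fs" and s: "secs (q # qs) bs"
  then have q: "q \<in> Qs" "secs qs bs" "sQ f q \<in> Qs" by (simp_all add: sQ_closed)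
  have sv: "symv (\<lambda>qs bs. vscale f (ctrQ q A qs bs))" "symv (conQ (g f) q)"
    using symv_con(1)[OF g[OF f] q(1)] vscale_V[OF f] mform_V[OF A] q by (auto simp: symv_def ctr_apply)
  have "symb_op 0 (ctrQ (sQ f q) A) \<eta> qs bs
      = symb_op 0 ((\<lambda>qs bs. vscale f (ctrQ q A qs bs)) + conQ (g f) q) \<eta> qs bs"
    using q A AQ f by (intro symb_op_cong) (auto simp: mform_symv[OF mform_ctrQ] plus_fun_apply ctr_apply conQ_def)
  also have "\<dots> = sE f (symb_op 0 (ctrQ q A) \<eta> qs bs) + symb_op 1 (scal (g f)) (ctrQ q \<eta>) qs bs"
    using sv symb_op_contractQ[OF g[OF f] q(1) \<eta> q(2), of 0] \<eta> q f A
    by (simp add: symb_op_add_symb symb_op_vscale symv_ctrQ mform_symv)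
  finally have 1: "symb_op 0 (ctrQ (sQ f q) A) \<eta> qs bs
      = sE f (symb_op 0 (ctrQ q A) \<eta> qs bs) + symb_op 1 (scal (g f)) (ctrQ q \<eta>) qs bs" .
  have "symb_op 1 A (ctrQ (sQ f q) \<eta>) qs bs = symb_op 1 A (smul f (ctrQ q \<eta>)) qs bs"
    using q A tensorial_Q[OF \<eta>(2) f, of "[]" q] by (intro symb_op_cong) (auto simp: mform_symv smul_def ctr_apply)
  also have "\<dots> = sE f (symb_op 1 A (ctrQ q \<eta>) qs bs) + symb_op 1 (scal (g f)) (ctrQ q \<eta>) qs bs"
    using q \<eta> der[OF f] by (intro symb_op_smul_form) (auto simp: mform_ctrQ)
  finally show "symb_op 1 A \<eta> (sQ f q # qs) bs = sE f (symb_op 1 A \<eta> (q # qs) bs)"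
    using 1 by (simp add: sE_addR sE_signed) (simp add: signed_def sE_neg)
next
  fix f b qs bs assume f: "f \<in> Fs" and s: "secs qs (b # bs)"
  then have b: "b \<in> Bs" "secs qs bs" "sB f b \<in> Bs" by (simp_all add: sB_closed)
  have g': "rvalued (\<lambda>qs bs. - g f qs bs)"
    using g[OF f] neg by (simp add: rvalued_def)
  have sv: "symv (\<lambda>qs bs. vscale f (ctrB b A qs bs))" "symv (conB (\<lambda>qs bs. - g f qs bs) b)"
    using symv_con(2)[OF g' b(1)] vscale_V[OF f] mform_V[OF A] b by (auto simp: symv_def ctr_apply)
  have "symb_op (1 - 2) (ctrB (sB f b) A) \<eta> qs bs
      = symb_op (1 - 2) ((\<lambda>qs bs. vscale f (ctrB b A qs bs)) + conB (\<lambda>qs bs. - g f qs bs) b) \<eta> qs bs"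
    using b A AB f by (intro symb_op_cong) (auto simp: mform_symv[OF mform_ctrB] plus_fun_apply ctr_apply conB_def)
  also have "\<dots> = sE f (symb_op (1 - 2) (ctrB b A) \<eta> qs bs) + symb_op 1 (scal (\<lambda>qs bs. - g f qs bs)) (ctrB b \<eta>) qs bs"
    unfolding symb_op_contractB[OF g' b(1) \<eta> b(2), of 1, symmetric]
    using sv \<eta> b f A by (simp add: symb_op_add_symb symb_op_vscale symv_ctrB mform_symv)
  also have "symb_op 1 (scal (\<lambda>qs bs. - g f qs bs)) (ctrB b \<eta>) qs bs = symb_op 1 (signed 1 (scal (g f))) (ctrB b \<eta>) qs bs"
    using b symv_scal[OF g'] by (intro symb_op_cong) (auto simp: scal_def signed_def sE_neg fun_eq_iff)
  also have "\<dots> = - symb_op 1 (scal (g f)) (ctrB b \<eta>) qs bs"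
    using b \<eta> symv_scal[OF g[OF f]] by (simp add: symb_op_signed_symb mform_ctrB) (simp add: signed_def)
  finally have 1: "symb_op (1 - 2) (ctrB (sB f b) A) \<eta> qs bs
      = sE f (symb_op (1 - 2) (ctrB b A) \<eta> qs bs) - symb_op 1 (scal (g f)) (ctrB b \<eta>) qs bs" by simp
  have "symb_op 1 A (ctrB (sB f b) \<eta>) qs bs = symb_op 1 A (smul f (ctrB b \<eta>)) qs bs"
    using b A tensorial_B[OF \<eta>(2) f, of _ "[]" b] by (intro symb_op_cong) (auto simp: mform_symv smul_def ctr_apply)
  also have "\<dots> = sE f (symb_op 1 A (ctrB b \<eta>) qs bs) + symb_op 1 (scal (g f)) (ctrB b \<eta>) qs bs"
    using b \<eta> der[OF f] by (intro symb_op_smul_form) (auto simp: mform_ctrB)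
  \<comment> \<open>Contraction with \<open>b\<close> is even and brings no sign, so the
    cancellation here relies on the minus sign in \<open>AB\<close>.\<close>
  finally show "symb_op 1 A \<eta> qs (sB f b # bs) = sE f (symb_op 1 A \<eta> qs (b # bs))"
    using 1 unfolding symb_op_ConsB by (simp add: sE_addR)
qed

end

section \<open>Algebra of a split Lie 2-algebroid\<close>

definition fscale :: "('m \<Rightarrow> real) \<Rightarrow> ('a \<Rightarrow> 'm \<Rightarrow> real) \<Rightarrow> 'a \<Rightarrow> 'm \<Rightarrow> real" where
  "fscale f \<beta> = (\<lambda>x. f * \<beta> x)"

lemma fscale_algebra:
  "fscale (f + g) s = fscale f s + fscale g s"
  "fscale f (s + t) = fscale f s + fscale f t"
  "fscale (- f) s = - fscale f s"
  "fscale f (- s) = - fscale f s"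
  "fscale (f - g) s = fscale f s - fscale g s"
  "fscale f (s - t) = fscale f s - fscale f t"
  "fscale 0 s = 0" "fscale f 0 = 0"
  "fscale f (fscale g s) = fscale (f * g) s"
  by (simp_all add: fscale_def fun_eq_iff plus_fun_apply algebra_simps)

declare minus_apply [simp del] uminus_apply [simp del] times_fun_apply [simp del] zero_fun_apply [simp del]

lemmas fun_apply = plus_fun_apply minus_apply uminus_apply times_fun_apply zero_fun_apply

text \<open>Unlike the general rules, these do not unfold the operations on functions on \<open>M\<close>.\<close>

lemma op_apply:
  fixes X Y :: "'a \<Rightarrow> 'm \<Rightarrow> real"
  shows "(X + Y) z = X z + Y z" "(X - Y) z = X z - Y z" "(- X) z = - X z" "(0 :: 'a \<Rightarrow> 'm \<Rightarrow> real) z = 0"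
    "fscale f X z = f * X z" "lie_bracket V W f = V (W f) - W (V f)"
  by (simp_all add: fun_apply fscale_def lie_bracket_def)

lemma additive_on:
  fixes f :: "'a::ab_group_add \<Rightarrow> 'b::ab_group_add"
  assumes "subgrp H" "\<And>x y. x \<in> H \<Longrightarrow> y \<in> H \<Longrightarrow> f (x + y) = f x + f y"
  shows additive_on_zero: "f 0 = 0"
    and additive_on_neg: "x \<in> H \<Longrightarrow> f (- x) = - f x"
    and additive_on_diff: "x \<in> H \<Longrightarrow> y \<in> H \<Longrightarrow> f (x - y) = f x - f y"
proof -
  show z: "f 0 = 0" using assms(2)[of 0 0] assms(1) by (simp add: subgrp_closed)
  show n: "f (- x) = - f x" if "x \<in> H" for x
    using assms(2)[of x "- x"] that assms(1) z by (simp add: subgrp_closed eq_neg_iff_add_eq_0 add.commute)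
  show "f (x - y) = f x - f y" if "x \<in> H" "y \<in> H"
    using assms(2)[of x "- y"] n that assms(1) by (simp add: subgrp_closed)
qed

section \<open>Vector fields as derivations\<close>

locale vfields =
  fixes M :: "'m::{t2_space,second_countable_topology} manifold"
begin

abbreviation "Fs \<equiv> elems (smooth_funs M)"
abbreviation "XX \<equiv> elems (vector_fields M)"

lemma Fs_closed [simp]:
  "0 \<in> Fs" "1 \<in> Fs" "(\<lambda>p. c) \<in> Fs"
  "f \<in> Fs \<Longrightarrow> g \<in> Fs \<Longrightarrow> f + g \<in> Fs" "f \<in> Fs \<Longrightarrow> g \<in> Fs \<Longrightarrow> f - g \<in> Fs"
  "f \<in> Fs \<Longrightarrow> g \<in> Fs \<Longrightarrow> f * g \<in> Fs" "f \<in> Fs \<Longrightarrow> - f \<in> Fs"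
  by (simp_all add: smooth_funs_closed smooth_funs_diff smooth_funs_const)

lemma X_closed [simp]: "X \<in> XX \<Longrightarrow> f \<in> Fs \<Longrightarrow> X f \<in> Fs"
  and X_add [simp]: "X \<in> XX \<Longrightarrow> f \<in> Fs \<Longrightarrow> g \<in> Fs \<Longrightarrow> X (f + g) = X f + X g"
  and X_mult [simp]: "X \<in> XX \<Longrightarrow> f \<in> Fs \<Longrightarrow> g \<in> Fs \<Longrightarrow> X (f * g) = X f * g + f * X g"
  and X_outside: "X \<in> XX \<Longrightarrow> f \<notin> Fs \<Longrightarrow> X f = 0"
  and X_const: "X \<in> XX \<Longrightarrow> f \<in> Fs \<Longrightarrow> X (\<lambda>p. c * f p) = (\<lambda>p. c * X f p)"
  unfolding vector_fields_def fmodule.simps mem_Collect_eq by blast+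

lemma Fs_sub: "subgrp Fs" by (rule smooth_funs_sub)

lemma X_zero [simp]: "X \<in> XX \<Longrightarrow> X 0 = 0"
  and X_neg [simp]: "X \<in> XX \<Longrightarrow> f \<in> Fs \<Longrightarrow> X (- f) = - X f"
  and X_diff [simp]: "X \<in> XX \<Longrightarrow> f \<in> Fs \<Longrightarrow> g \<in> Fs \<Longrightarrow> X (f - g) = X f - X g"
  by (rule additive_on_zero[OF Fs_sub, of X] additive_on_neg[OF Fs_sub, of X] additive_on_diff[OF Fs_sub, of X]; simp)+

lemma XX_iff: "X \<in> XX \<longleftrightarrow> (\<forall>f\<in>Fs. X f \<in> Fs) \<and> (\<forall>f\<in>Fs. \<forall>g\<in>Fs. X (f + g) = X f + X g) \<and>
    (\<forall>c. \<forall>f\<in>Fs. X (\<lambda>p. c * f p) = (\<lambda>p. c * X f p)) \<and>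
    (\<forall>f\<in>Fs. \<forall>g\<in>Fs. X (f * g) = X f * g + f * X g) \<and> (\<forall>f. f \<notin> Fs \<longrightarrow> X f = 0)"
  by (simp only: vector_fields_def fmodule.simps mem_Collect_eq)

lemma XX_sub: "subgrp XX"
proof (rule subgrpI)
  show "0 \<in> XX" by (simp add: XX_iff op_apply) (simp add: zero_fun_def)
  show "X + Y \<in> XX" if "X \<in> XX" "Y \<in> XX" for X Y
    unfolding XX_iff[of "X + Y"] using that
    by (simp add: op_apply X_const X_outside algebra_simps) (simp add: fun_eq_iff fun_apply algebra_simps)
  show "- X \<in> XX" if "X \<in> XX" for X
    unfolding XX_iff[of "- X"] using that
    by (simp add: op_apply X_const X_outside algebra_simps) (simp add: fun_eq_iff fun_apply)
qed

lemma fscale_XX [simp]: "f \<in> Fs \<Longrightarrow> X \<in> XX \<Longrightarrow> fscale f X \<in> XX"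
  unfolding XX_iff[of "fscale f X"]
  by (simp add: op_apply X_const X_outside algebra_simps) (simp add: fun_eq_iff fun_apply)

lemma XX_closed [simp]:
  "0 \<in> XX" "X \<in> XX \<Longrightarrow> Y \<in> XX \<Longrightarrow> X + Y \<in> XX" "X \<in> XX \<Longrightarrow> Y \<in> XX \<Longrightarrow> X - Y \<in> XX" "X \<in> XX \<Longrightarrow> - X \<in> XX"
  using XX_sub by (simp_all add: subgrp_closed)

lemma lie_bracket_XX [simp]: assumes "X \<in> XX" "Y \<in> XX" shows "lie_bracket X Y \<in> XX"
proof -
  have "X (Y (\<lambda>p. c * f p)) = (\<lambda>p. c * X (Y f) p)" if "f \<in> Fs" for c f
    using assms that by (simp add: X_const)
  moreover have "Y (X (\<lambda>p. c * f p)) = (\<lambda>p. c * Y (X f) p)" if "f \<in> Fs" for c f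
    using assms that by (simp add: X_const)
  ultimately show ?thesis
    unfolding XX_iff[of "lie_bracket X Y"] using assms
    by (simp add: op_apply X_const X_outside algebra_simps) (simp add: fun_eq_iff fun_apply algebra_simps)
qed

lemma XX_eqI: "X \<in> XX \<Longrightarrow> Y \<in> XX \<Longrightarrow> (\<And>f. f \<in> Fs \<Longrightarrow> X f = Y f) \<Longrightarrow> X = Y"
  using X_outside by (metis ext)

lemma lie_bracket_simps [simp]:
  "X \<in> XX \<Longrightarrow> Y \<in> XX \<Longrightarrow> Z \<in> XX \<Longrightarrow> lie_bracket (X + Y) Z = lie_bracket X Z + lie_bracket Y Z"
  "X \<in> XX \<Longrightarrow> Y \<in> XX \<Longrightarrow> Z \<in> XX \<Longrightarrow> lie_bracket X (Y + Z) = lie_bracket X Y + lie_bracket X Z"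
  "X \<in> XX \<Longrightarrow> Y \<in> XX \<Longrightarrow> f \<in> Fs \<Longrightarrow> lie_bracket X (fscale f Y) = fscale f (lie_bracket X Y) + fscale (X f) Y"
  "X \<in> XX \<Longrightarrow> Y \<in> XX \<Longrightarrow> f \<in> Fs \<Longrightarrow> lie_bracket (fscale f X) Y = fscale f (lie_bracket X Y) - fscale (Y f) X"
  by (rule XX_eqI; simp add: op_apply algebra_simps)+

lemma lie_bracket_skew: "lie_bracket X Y = - lie_bracket Y X"
  by (simp add: lie_bracket_def fun_eq_iff fun_apply)

lemma lie_bracket_jacobi:
  assumes [simp]: "X \<in> XX" "Y \<in> XX" "Z \<in> XX"
  shows "lie_bracket X (lie_bracket Y Z) - lie_bracket Y (lie_bracket X Z) = lie_bracket (lie_bracket X Y) Z"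
  by (rule XX_eqI) (simp_all add: op_apply algebra_simps)

end

section \<open>The structure maps and the axioms as rules of calculation\<close>

locale split_lie2 =
  fixes L :: "('m::{t2_space,second_countable_topology}, 'q::real_vector, 'b::real_vector) split_data"
  assumes split: "split_lie_2_algebroid L"
begin

sublocale vfields "base L" .

abbreviation "QQ \<equiv> elems (secQ L)"
abbreviation "BB \<equiv> elems (secB L)"
abbreviation "BD \<equiv> elems (secBd L)"

lemmas ax = split[unfolded split_lie_2_algebroid_def]

lemma base_facts: "smooth_manifold (base L)" "vector_bundle (base L) (bundleQ L)" "vector_bundle (base L) (bundleB L)"
  using ax by simp_all

lemma secX_eq: "secX L = vector_fields (base L)" and Cinf_eq: "Cinf L = smooth_funs (base L)"
  by (simp_all add: secX_def Cinf_def)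

lemma scl_eqs [simp]:
  "scl (secQ L) f q = pscale f q" "scl (secB L) f c = pscale f c" "scl (secBd L) f \<beta> = fscale f \<beta>"
  "scl (vector_fields M) f X = fscale f X" "scl (smooth_funs M) f g = f * g"
  by (simp_all only: secQ_def secB_def sections_def secBd_def dual_module_def vector_fields_def fscale_def smooth_funs_def
      pscale_real fmodule.simps)

lemma sub: "subgrp QQ" "subgrp BB" "subgrp BD"
  using sections_closed(1)[OF base_facts(1,2)] sections_closed(1)[OF base_facts(1,3)] dual_closed(1)
  by (simp_all add: secQ_def secB_def secBd_def)

lemma scale_closed [simp]:
  "f \<in> Fs \<Longrightarrow> q \<in> QQ \<Longrightarrow> pscale f q \<in> QQ" "f \<in> Fs \<Longrightarrow> c \<in> BB \<Longrightarrow> pscale f c \<in> BB"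
  "f \<in> Fs \<Longrightarrow> \<beta> \<in> BD \<Longrightarrow> fscale f \<beta> \<in> BD"
  using sections_closed(2)[OF base_facts(1,2)] sections_closed(2)[OF base_facts(1,3)]
    dual_closed(2)[of f "base L" \<beta> "secB L"]
  by (simp_all add: secQ_def secB_def secBd_def fscale_def pscale_real)

lemma closed [simp]:
  "0 \<in> QQ" "q \<in> QQ \<Longrightarrow> r \<in> QQ \<Longrightarrow> q + r \<in> QQ" "q \<in> QQ \<Longrightarrow> r \<in> QQ \<Longrightarrow> q - r \<in> QQ" "q \<in> QQ \<Longrightarrow> - q \<in> QQ"
  "0 \<in> BB" "c \<in> BB \<Longrightarrow> d \<in> BB \<Longrightarrow> c + d \<in> BB" "c \<in> BB \<Longrightarrow> d \<in> BB \<Longrightarrow> c - d \<in> BB" "c \<in> BB \<Longrightarrow> - c \<in> BB"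
  "0 \<in> BD" "\<beta> \<in> BD \<Longrightarrow> \<gamma> \<in> BD \<Longrightarrow> \<beta> + \<gamma> \<in> BD" "\<beta> \<in> BD \<Longrightarrow> \<gamma> \<in> BD \<Longrightarrow> \<beta> - \<gamma> \<in> BD" "\<beta> \<in> BD \<Longrightarrow> - \<beta> \<in> BD"
  using sub by (simp_all add: subgrp_closed)

lemma rho_tensorial: "linear_over (base L) (secQ L) (vector_fields (base L)) (anchor L)"
  and ell_tensorial: "linear_over (base L) (secBd L) (secQ L) (ell L)"
  using ax by (simp_all add: secX_eq)

lemma rho_simps [simp]:
  "q \<in> QQ \<Longrightarrow> anchor L q \<in> XX"
  "q \<in> QQ \<Longrightarrow> r \<in> QQ \<Longrightarrow> anchor L (q + r) = anchor L q + anchor L r"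
  "f \<in> Fs \<Longrightarrow> q \<in> QQ \<Longrightarrow> anchor L (pscale f q) = fscale f (anchor L q)"
  using rho_tensorial by (simp_all add: linear_over_def)

lemma rho_simps' [simp]:
  "anchor L 0 = 0" "q \<in> QQ \<Longrightarrow> anchor L (- q) = - anchor L q"
  "q \<in> QQ \<Longrightarrow> r \<in> QQ \<Longrightarrow> anchor L (q - r) = anchor L q - anchor L r"
  by (rule additive_on[OF sub(1), of "anchor L"]; simp)+

lemma ell_simps [simp]:
  "\<beta> \<in> BD \<Longrightarrow> ell L \<beta> \<in> QQ"
  "\<beta> \<in> BD \<Longrightarrow> \<gamma> \<in> BD \<Longrightarrow> ell L (\<beta> + \<gamma>) = ell L \<beta> + ell L \<gamma>"
  "f \<in> Fs \<Longrightarrow> \<beta> \<in> BD \<Longrightarrow> ell L (fscale f \<beta>) = pscale f (ell L \<beta>)"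
  using ell_tensorial by (simp_all add: linear_over_def)

lemma ell_simps' [simp]:
  "ell L 0 = 0" "\<beta> \<in> BD \<Longrightarrow> ell L (- \<beta>) = - ell L \<beta>"
  "\<beta> \<in> BD \<Longrightarrow> \<gamma> \<in> BD \<Longrightarrow> ell L (\<beta> - \<gamma>) = ell L \<beta> - ell L \<gamma>"
  by (rule additive_on[OF sub(3), of "ell L"]; simp)+

lemma dull: "dull_bracket L" using ax by simp

lemma brk_closed [simp]: "q \<in> QQ \<Longrightarrow> r \<in> QQ \<Longrightarrow> brk L q r \<in> QQ"
  and brk_skew: "q \<in> QQ \<Longrightarrow> r \<in> QQ \<Longrightarrow> brk L q r = - brk L r q"
  and brk_addR [simp]: "q \<in> QQ \<Longrightarrow> r \<in> QQ \<Longrightarrow> s \<in> QQ \<Longrightarrow> brk L q (r + s) = brk L q r + brk L q s"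
  and brk_scaleR [simp]: "q \<in> QQ \<Longrightarrow> r \<in> QQ \<Longrightarrow> f \<in> Fs \<Longrightarrow> brk L q (pscale f r) = pscale f (brk L q r) + pscale (anchor L q f) r"
  and rho_brk [simp]: "q \<in> QQ \<Longrightarrow> r \<in> QQ \<Longrightarrow> anchor L (brk L q r) = lie_bracket (anchor L q) (anchor L r)"
  using dull unfolding dull_bracket_def Cinf_eq by blast+

lemma brk_addL [simp]: "q \<in> QQ \<Longrightarrow> r \<in> QQ \<Longrightarrow> s \<in> QQ \<Longrightarrow> brk L (r + s) q = brk L r q + brk L s q"
  using brk_skew[of "r + s" q] brk_skew[of r q] brk_skew[of s q] by simp

lemma brk_scaleL [simp]:
  "q \<in> QQ \<Longrightarrow> r \<in> QQ \<Longrightarrow> f \<in> Fs \<Longrightarrow> brk L (pscale f q) r = pscale f (brk L q r) - pscale (anchor L r f) q"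
  using brk_skew[of "pscale f q" r] brk_skew[of q r] by (simp add: pscale_algebra)

lemma brk_simps' [simp]:
  assumes "q \<in> QQ"
  shows "brk L q 0 = 0" "r \<in> QQ \<Longrightarrow> brk L q (- r) = - brk L q r"
    "r \<in> QQ \<Longrightarrow> s \<in> QQ \<Longrightarrow> brk L q (r - s) = brk L q r - brk L q s"
    "brk L 0 q = 0" "r \<in> QQ \<Longrightarrow> brk L (- r) q = - brk L r q"
    "r \<in> QQ \<Longrightarrow> s \<in> QQ \<Longrightarrow> brk L (r - s) q = brk L r q - brk L s q"
  by ((rule additive_on[OF sub(1), of "brk L q"]; simp add: assms)+, (rule additive_on[OF sub(1), of "\<lambda>x. brk L x q"]; simp add: assms)+)

text \<open>Values lie in a real vector space, so a skew-symmetric expression vanishes on equal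
  arguments.\<close>

lemma two_cancel: "x + x = (0::'a \<Rightarrow> 'v::real_vector) \<Longrightarrow> x = 0"
  by (simp add: fun_eq_iff fun_apply scaleR_2[symmetric])

lemma brk_self [simp]: "q \<in> QQ \<Longrightarrow> brk L q q = 0"
  using brk_skew[of q q] two_cancel[of "brk L q q"] by (metis add.right_inverse)

lemma connB: "connection (base L) (secQ L) (anchor L) (secB L) (nabB L)"
  using ax by simp

lemma nabB_simps [simp]:
  "q \<in> QQ \<Longrightarrow> c \<in> BB \<Longrightarrow> nabB L q c \<in> BB"
  "q \<in> QQ \<Longrightarrow> r \<in> QQ \<Longrightarrow> c \<in> BB \<Longrightarrow> nabB L (q + r) c = nabB L q c + nabB L r c"
  "f \<in> Fs \<Longrightarrow> q \<in> QQ \<Longrightarrow> c \<in> BB \<Longrightarrow> nabB L (pscale f q) c = pscale f (nabB L q c)"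
  "q \<in> QQ \<Longrightarrow> c \<in> BB \<Longrightarrow> d \<in> BB \<Longrightarrow> nabB L q (c + d) = nabB L q c + nabB L q d"
  "q \<in> QQ \<Longrightarrow> f \<in> Fs \<Longrightarrow> c \<in> BB \<Longrightarrow> nabB L q (pscale f c) = pscale f (nabB L q c) + pscale (anchor L q f) c"
  using connB by (simp_all add: connection_def linear_over_def)

lemma BD_iff: "\<beta> \<in> BD \<longleftrightarrow> (\<forall>c\<in>BB. \<beta> c \<in> Fs) \<and> (\<forall>c\<in>BB. \<forall>d\<in>BB. \<beta> (c + d) = \<beta> c + \<beta> d) \<and>
    (\<forall>f\<in>Fs. \<forall>c\<in>BB. \<beta> (pscale f c) = f * \<beta> c) \<and> (\<forall>c. c \<notin> BB \<longrightarrow> \<beta> c = 0)"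
  by (auto simp: secBd_def dual_module_def linear_over_def)

lemma BD_simps [simp]:
  "\<beta> \<in> BD \<Longrightarrow> c \<in> BB \<Longrightarrow> \<beta> c \<in> Fs"
  "\<beta> \<in> BD \<Longrightarrow> c \<in> BB \<Longrightarrow> d \<in> BB \<Longrightarrow> \<beta> (c + d) = \<beta> c + \<beta> d"
  "\<beta> \<in> BD \<Longrightarrow> f \<in> Fs \<Longrightarrow> c \<in> BB \<Longrightarrow> \<beta> (pscale f c) = f * \<beta> c"
  by (auto simp: BD_iff)

lemma BD_outside: "\<beta> \<in> BD \<Longrightarrow> c \<notin> BB \<Longrightarrow> \<beta> c = 0"
  unfolding BD_iff by blast

lemma nabBd_apply: "c \<in> BB \<Longrightarrow> nabBd L q \<beta> c = anchor L q (\<beta> c) - \<beta> (nabB L q c)"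
  by (simp add: nabBd_def)

text \<open>The Leibniz term of the anchor cancels that of the connection on \<open>B\<close>, so
  the dual derivative is again linear over functions.\<close>

lemma nabBd_closed [simp]: "q \<in> QQ \<Longrightarrow> \<beta> \<in> BD \<Longrightarrow> nabBd L q \<beta> \<in> BD"
  by (simp add: BD_iff[of "nabBd L q \<beta>"] nabBd_apply algebra_simps) (simp add: nabBd_def)

lemma nabBd_simps [simp]:
  "q \<in> QQ \<Longrightarrow> r \<in> QQ \<Longrightarrow> \<beta> \<in> BD \<Longrightarrow> nabBd L (q + r) \<beta> = nabBd L q \<beta> + nabBd L r \<beta>"
  "f \<in> Fs \<Longrightarrow> q \<in> QQ \<Longrightarrow> \<beta> \<in> BD \<Longrightarrow> nabBd L (pscale f q) \<beta> = fscale f (nabBd L q \<beta>)"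
  "q \<in> QQ \<Longrightarrow> \<beta> \<in> BD \<Longrightarrow> \<gamma> \<in> BD \<Longrightarrow> nabBd L q (\<beta> + \<gamma>) = nabBd L q \<beta> + nabBd L q \<gamma>"
  "q \<in> QQ \<Longrightarrow> f \<in> Fs \<Longrightarrow> \<beta> \<in> BD \<Longrightarrow> nabBd L q (fscale f \<beta>) = fscale f (nabBd L q \<beta>) + fscale (anchor L q f) \<beta>"
  by (rule ext; simp add: nabBd_def op_apply BD_outside algebra_simps)+

lemma nabBd_zero [simp]: "q \<in> QQ \<Longrightarrow> nabBd L q 0 = 0" "\<beta> \<in> BD \<Longrightarrow> nabBd L 0 \<beta> = 0"
  by (rule additive_on_zero[OF sub(3), of "nabBd L q"] additive_on_zero[OF sub(1), of "\<lambda>q. nabBd L q \<beta>"]; simp)+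

lemma nabBd_simps' [simp]:
  assumes "q \<in> QQ" "\<beta> \<in> BD"
  shows "nabBd L q (- \<beta>) = - nabBd L q \<beta>" "\<gamma> \<in> BD \<Longrightarrow> nabBd L q (\<beta> - \<gamma>) = nabBd L q \<beta> - nabBd L q \<gamma>"
    "nabBd L (- q) \<beta> = - nabBd L q \<beta>" "r \<in> QQ \<Longrightarrow> nabBd L (q - r) \<beta> = nabBd L q \<beta> - nabBd L r \<beta>"
  by ((rule additive_on[OF sub(3), of "nabBd L q"]; simp add: assms)+, (rule additive_on[OF sub(1), of "\<lambda>q. nabBd L q \<beta>"]; simp add: assms)+)

lemma om: "three_form_Bd L" using ax by simp

lemma om_closed [simp]: "q \<in> QQ \<Longrightarrow> r \<in> QQ \<Longrightarrow> s \<in> QQ \<Longrightarrow> omega L q r s \<in> BD"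
  and om_add1 [simp]: "q \<in> QQ \<Longrightarrow> q' \<in> QQ \<Longrightarrow> r \<in> QQ \<Longrightarrow> s \<in> QQ \<Longrightarrow> omega L (q + q') r s = omega L q r s + omega L q' r s"
  and om_add2 [simp]: "q \<in> QQ \<Longrightarrow> q' \<in> QQ \<Longrightarrow> r \<in> QQ \<Longrightarrow> s \<in> QQ \<Longrightarrow> omega L r (q + q') s = omega L r q s + omega L r q' s"
  and om_add3 [simp]: "q \<in> QQ \<Longrightarrow> q' \<in> QQ \<Longrightarrow> r \<in> QQ \<Longrightarrow> s \<in> QQ \<Longrightarrow> omega L r s (q + q') = omega L r s q + omega L r s q'"
  and om_scale1 [simp]: "f \<in> Fs \<Longrightarrow> q \<in> QQ \<Longrightarrow> r \<in> QQ \<Longrightarrow> s \<in> QQ \<Longrightarrow> omega L (pscale f q) r s = fscale f (omega L q r s)"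
  and om_scale2 [simp]: "f \<in> Fs \<Longrightarrow> q \<in> QQ \<Longrightarrow> r \<in> QQ \<Longrightarrow> s \<in> QQ \<Longrightarrow> omega L r (pscale f q) s = fscale f (omega L r q s)"
  and om_scale3 [simp]: "f \<in> Fs \<Longrightarrow> q \<in> QQ \<Longrightarrow> r \<in> QQ \<Longrightarrow> s \<in> QQ \<Longrightarrow> omega L r s (pscale f q) = fscale f (omega L r s q)"
  and om_swap12: "q \<in> QQ \<Longrightarrow> r \<in> QQ \<Longrightarrow> s \<in> QQ \<Longrightarrow> omega L r q s = - omega L q r s"
  and om_swap23: "q \<in> QQ \<Longrightarrow> r \<in> QQ \<Longrightarrow> s \<in> QQ \<Longrightarrow> omega L q s r = - omega L q r s"
  using om unfolding three_form_Bd_def linear_over_def scl_eqs by blast+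

lemma om_simps' [simp]:
  assumes "q \<in> QQ" "r \<in> QQ"
  shows "omega L 0 q r = 0" "omega L q 0 r = 0" "omega L q r 0 = 0"
    "s \<in> QQ \<Longrightarrow> omega L (- s) q r = - omega L s q r" "s \<in> QQ \<Longrightarrow> omega L q (- s) r = - omega L q s r"
    "s \<in> QQ \<Longrightarrow> omega L q r (- s) = - omega L q r s"
    "s \<in> QQ \<Longrightarrow> t \<in> QQ \<Longrightarrow> omega L (s - t) q r = omega L s q r - omega L t q r"
    "s \<in> QQ \<Longrightarrow> t \<in> QQ \<Longrightarrow> omega L q (s - t) r = omega L q s r - omega L q t r"
    "s \<in> QQ \<Longrightarrow> t \<in> QQ \<Longrightarrow> omega L q r (s - t) = omega L q r s - omega L q r t"
  by (rule additive_on[OF sub(1), of "\<lambda>x. omega L x q r"] additive_on[OF sub(1), of "\<lambda>x. omega L q x r"]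
      additive_on[OF sub(1), of "\<lambda>x. omega L q r x"]; simp add: assms)+

lemma om_self [simp]: "q \<in> QQ \<Longrightarrow> r \<in> QQ \<Longrightarrow> omega L q q r = 0" "q \<in> QQ \<Longrightarrow> r \<in> QQ \<Longrightarrow> omega L r q q = 0"
proof -
  have c: "x = - x \<Longrightarrow> x = 0" for x :: "('m, 'b) dsection"
    by (auto simp: fun_eq_iff fun_apply)
  show "q \<in> QQ \<Longrightarrow> r \<in> QQ \<Longrightarrow> omega L q q r = 0" using om_swap12[of q q r] c by blast
  show "q \<in> QQ \<Longrightarrow> r \<in> QQ \<Longrightarrow> omega L r q q = 0" using om_swap23[of r q q] c by blast
qed

lemma axiom_i: "\<beta> \<in> BD \<Longrightarrow> \<gamma> \<in> BD \<Longrightarrow> nabBd L (ell L \<beta>) \<gamma> = - nabBd L (ell L \<gamma>) \<beta>"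
  unfolding eq_neg_iff_add_eq_0 using ax by blast

lemma axiom_ii: "q \<in> QQ \<Longrightarrow> \<beta> \<in> BD \<Longrightarrow> brk L q (ell L \<beta>) = ell L (nabBd L q \<beta>)"
  and axiom_iii: "q \<in> QQ \<Longrightarrow> r \<in> QQ \<Longrightarrow> s \<in> QQ \<Longrightarrow>
    brk L q (brk L r s) - brk L (brk L q r) s - brk L r (brk L q s) = - ell L (omega L q r s)"
  and axiom_iv: "q \<in> QQ \<Longrightarrow> r \<in> QQ \<Longrightarrow> \<beta> \<in> BD \<Longrightarrow>
    nabBd L q (nabBd L r \<beta>) - nabBd L r (nabBd L q \<beta>) - nabBd L (brk L q r) \<beta> = - omega L q r (ell L \<beta>)"
  and axiom_v: "q \<in> QQ \<Longrightarrow> r \<in> QQ \<Longrightarrow> s \<in> QQ \<Longrightarrow> t \<in> QQ \<Longrightarrow> d_omega L q r s t = 0"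
  using ax unfolding curvBd_def by blast+

text \<open>
  Comparing \<open>[\<ell>(\<beta>), f q]\<close> computed by the Leibniz rule with \<open>-\<ell>(\<nabla>\<^sup>*\<^bsub>f q\<^esub> \<beta>)\<close> gives
  \<open>(\<rho>(\<ell>(\<beta>)) f) q = 0\<close> for all \<open>q\<close>; for \<open>q = \<ell>(\<beta>)\<close> the anchor turns this into \<open>(\<rho>(\<ell>(\<beta>)) f)\<^sup>2 = 0\<close>.
\<close>

lemma rho_ell [simp]: assumes [simp]: "\<beta> \<in> BD" shows "anchor L (ell L \<beta>) = 0"
proof (rule XX_eqI)
  fix f assume [simp]: "f \<in> Fs"
  have "pscale (anchor L (ell L \<beta>) f) q = 0" if [simp]: "q \<in> QQ" for q
  proof -
    have "brk L (ell L \<beta>) r = - ell L (nabBd L r \<beta>)" if "r \<in> QQ" for r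
      using brk_skew[of "ell L \<beta>" r] axiom_ii[of r \<beta>] that by simp
    from this[of "pscale f q"] this[of q] show ?thesis by (simp add: pscale_algebra)
  qed
  from this[of "ell L \<beta>"] have "anchor L (pscale (anchor L (ell L \<beta>) f) (ell L \<beta>)) f = 0" by (simp add: op_apply)
  then show "anchor L (ell L \<beta>) f = 0 f" by (simp add: op_apply) (simp add: fun_eq_iff fun_apply)
qed simp_all

end

section \<open>The operator of a collection of structure objects\<close>

text \<open>Structure objects take at most three arguments in \<open>Q\<close>, so four or more form
  a single case.\<close>

lemma list4_cases:
  obtains "xs = []" | a where "xs = [a]" | a b where "xs = [a, b]" | a b c where "xs = [a, b, c]"
  | a b c d ys where "xs = a # b # c # d # ys"
  by (metis list.exhaust)

lemma list2_cases:
  obtains "xs = []" | a where "xs = [a]" | a b ys where "xs = a # b # ys"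
  by (metis list.exhaust)

section \<open>A criterion for square zero\<close>

context contraction_calculus
begin

lemma mform_V_I:
  assumes E: "\<And>qs bs. secs qs bs \<Longrightarrow> fst (A qs bs) \<in> Endo"
    and out: "\<And>qs bs x. x \<notin> Es \<Longrightarrow> fst (A qs bs) x = 0"
    and x: "\<And>x. x \<in> Es \<Longrightarrow> mform Es (\<lambda>qs bs. fst (A qs bs) x)"
    and q: "mform Qs (\<lambda>qs bs. fst (snd (A qs bs)))" and b: "mform Bs (\<lambda>qs bs. snd (snd (A qs bs)))"
  shows "mform V A"
proof -
  have eq: "v = w" if "\<And>x. x \<in> Es \<Longrightarrow> fst v x = fst w x" "\<And>x. x \<notin> Es \<Longrightarrow> fst v x = fst w x"
    "fst (snd v) = fst (snd w)" "snd (snd v) = snd (snd w)" for v w :: "('e \<Rightarrow> 'e) \<times> 'q \<times> 'b"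
    using that by (metis ext prod_eqI)
  show ?thesis
    unfolding mform_def
  proof (intro conjI allI impI)
    fix qs bs assume "secs qs bs"
    then show "A qs bs \<in> V"
      using E mform_V[OF q] mform_V[OF b] by (auto simp: V_def mem_Times_iff)
  next
    fix qs r s qs' bs assume a: "secs (qs @ r # s # qs') bs"
    show "A (qs @ (r + s) # qs') bs = A (qs @ r # qs') bs + A (qs @ s # qs') bs"
      by (rule eq) (use mform_addQ[OF x a] mform_addQ[OF q a] mform_addQ[OF b a] out in \<open>simp_all add: plus_fun_apply\<close>)
  next
    fix qs bs r s bs' assume a: "secs qs (bs @ r # s # bs')"
    show "A qs (bs @ (r + s) # bs') = A qs (bs @ r # bs') + A qs (bs @ s # bs')"
      by (rule eq) (use mform_addB[OF x a] mform_addB[OF q a] mform_addB[OF b a] out in \<open>simp_all add: plus_fun_apply\<close>)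
  next
    fix qs r qs' bs assume a: "secs (qs @ r # qs') bs"
    show "A (qs @ r # r # qs') bs = 0"
      by (rule eq) (use mform_alt[OF x a] mform_alt[OF q a] mform_alt[OF b a] out in \<open>simp_all add: zero_fun_apply\<close>)
  next
    fix qs bs r s bs' assume a: "secs qs (bs @ r # s # bs')"
    show "A qs (bs @ r # s # bs') = A qs (bs @ s # r # bs')"
      by (rule eq) (use mform_sym[OF x a] mform_sym[OF q a] mform_sym[OF b a] out in simp_all)
  qed
qed

text \<open>Without odd arguments the recursion only ever inserts sections of
  \<open>B\<^sup>*\<close> into the symbol. This is why \<open>sqB\<close> below concerns lists of
  such sections alone.\<close>

lemma symb_op_symb_eq_0_Nil:
  assumes "\<And>bs. set bs \<subseteq> Bs \<Longrightarrow> A [] bs = 0" "mform Es \<eta>" "set bs \<subseteq> Bs"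
  shows "symb_op d A \<eta> [] bs = 0"
  using assms
proof (induction bs arbitrary: d A \<eta>)
  case (Cons b bs)
  have "symb_op (d - 2) (ctrB b A) \<eta> [] bs = 0"
    by (rule Cons.IH) (use Cons(2-) in \<open>simp_all add: ctr_apply\<close>)
  moreover have "symb_op d A (ctrB b \<eta>) [] bs = 0"
    by (rule Cons.IH) (use Cons(2-) in \<open>simp_all add: mform_ctrB\<close>)
  ultimately show ?case by simp
qed (simp add: act_zero_symb)

text \<open>Pushing a contraction past both copies of the operator leaves the commutator of the
  contracted with the full operator, plus the square on the contracted form, to which induction
  applies. Hence there is one family of bracket conditions for each kind of argument.\<close>

theorem symb_op_square_zero:
  assumes D: "symbol 1 D" and \<eta>: "mform Es \<eta>" and s: "secs qs bs"
    and sq0: "\<And>x. x \<in> Es \<Longrightarrow> fst (D [] []) (fst (D [] []) x) = 0"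
    and sqQ: "\<And>q qs bs. q \<in> Qs \<Longrightarrow> secs qs bs \<Longrightarrow> sbracket 0 1 (ctrQ q D) D qs bs = 0"
    and sqB: "\<And>b bs. b \<in> Bs \<Longrightarrow> set bs \<subseteq> Bs \<Longrightarrow> sbracket (-1) 1 (ctrB b D) D [] bs = 0"
  shows "symb_op 1 D (symb_op 1 D \<eta>) qs bs = 0"
  using \<eta> s
proof (induction qs arbitrary: \<eta>)
  case Nil
  then show ?case
  proof (induction bs arbitrary: \<eta>)
    case Nil
    \<comment> \<open>A value of degree 1 contains no contraction, so in arity zero the square is
      that of the endomorphism.\<close>
    have "D [] [] \<in> Vdeg 1" using symbol_Vdeg[OF D, of "[]" "[]"] by simp
    from Vdeg_D[OF this] obtain \<phi> where d: "D [] [] = (\<phi>, 0, 0)" "\<phi> \<in> Endo" by (cases "D [] []") auto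
    have z: "\<eta> [0] [] = 0" "\<eta> [] [0] = 0" "\<eta> [0, 0] [] = 0" "\<eta> [0] [0] = 0" "\<eta> [] [0, 0] = 0" "\<eta> [] [] \<in> Es"
      using mform_zeroQ[OF Nil(1), of "[]" "[]" "[]"] mform_zeroB[OF Nil(1), of "[]" "[]" "[]"] mform_V[OF Nil(1), of "[]" "[]"]
        mform_zeroQ[OF Nil(1), of "[]" "[0]" "[]"] mform_zeroQ[OF Nil(1), of "[]" "[]" "[0]"]
        mform_zeroB[OF Nil(1), of "[]" "[]" "[0]"] subQ subB
      by (simp_all add: subgrp_closed)
    have m: "mform Es (symb_op 1 D \<eta>)" using D Nil by (simp add: mform_symb_op symbol_mform)
    show ?case
      using mform_zeroQ[OF m, of "[]" "[]" "[]"] mform_zeroB[OF m, of "[]" "[]" "[]"] sq0[of "\<eta> [] []"] z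
      by (simp add: d)
  next
    case (Cons b bs)
    have b: "b \<in> Bs" "set bs \<subseteq> Bs" "secs [] bs" using Cons by (auto simp: secs_def)
    have D': "symbol (-1) (ctrB b D)" using symbol_ctrB[OF D b(1)] by simp
    have e: "ctrB b (symb_op 1 D \<eta>) = symb_op (-1) (ctrB b D) \<eta> + symb_op 1 D (ctrB b \<eta>)"
      by (simp add: fun_eq_iff ctr_apply plus_fun_apply symb_op_ConsB)
    have v: "valued (symb_op (-1) (ctrB b D) \<eta>)" "valued (symb_op 1 D (ctrB b \<eta>))"
      using Cons b D D' by (simp_all add: mform_valued mform_symb_op symbol_mform mform_ctrB)
    have "symb_op (-1) (ctrB b D) (symb_op 1 D \<eta>) [] bs + symb_op 1 D (symb_op (-1) (ctrB b D) \<eta>) [] bs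
        = symb_op 0 (sbracket (-1) 1 (ctrB b D) D) \<eta> [] bs"
      using symb_op_sbracket[OF D' D Cons(2) b(3)] by (simp add: signed_def)
    also have "\<dots> = 0" by (rule symb_op_symb_eq_0_Nil) (use sqB b Cons in auto)
    finally show ?case
      using Cons.IH[OF mform_ctrB[OF Cons(2) b(1)] b(3)] v b D
      by (simp add: e symb_op_add_form symbol_symv add.assoc[symmetric])
  qed
next
  case (Cons q qs)
  have q: "q \<in> Qs" "secs qs bs" using Cons by auto
  have D': "symbol 0 (ctrQ q D)" using symbol_ctrQ[OF D q(1)] by simp
  have e: "ctrQ q (symb_op 1 D \<eta>) = symb_op 0 (ctrQ q D) \<eta> + signed 1 (symb_op 1 D (ctrQ q \<eta>))"
    by (simp add: fun_eq_iff ctr_apply plus_fun_apply signed_fun)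
  have v: "valued (symb_op 0 (ctrQ q D) \<eta>)" "valued (symb_op 1 D (ctrQ q \<eta>))"
    using Cons q D D' by (simp_all add: mform_valued mform_symb_op symbol_mform mform_ctrQ)
  then have v': "valued (signed 1 (symb_op 1 D (ctrQ q \<eta>)))"
    by (simp add: valued_def signed_fun subgrp_closed subE)
  have "symb_op 0 (ctrQ q D) (symb_op 1 D \<eta>) qs bs - symb_op 1 D (symb_op 0 (ctrQ q D) \<eta>) qs bs
      = symb_op 1 (sbracket 0 1 (ctrQ q D) D) \<eta> qs bs"
    using symb_op_sbracket[OF D' D Cons(2) q(2)] by (simp add: signed_def)
  also have "\<dots> = 0" by (rule symb_op_symb_eq_0) (use sqQ q Cons in auto)
  finally have "symb_op 0 (ctrQ q D) (symb_op 1 D \<eta>) qs bs = symb_op 1 D (symb_op 0 (ctrQ q D) \<eta>) qs bs" by simp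
  moreover have "symb_op 1 D (ctrQ q (symb_op 1 D \<eta>)) qs bs = symb_op 1 D (symb_op 0 (ctrQ q D) \<eta>) qs bs + signed 1 (symb_op 1 D (symb_op 1 D (ctrQ q \<eta>)) qs bs)"
    using v v' q D by (simp add: e symb_op_add_form symb_op_signed_form symbol_symv)
  moreover have "symb_op 1 D (symb_op 1 D (ctrQ q \<eta>)) qs bs = 0"
    by (rule Cons.IH[OF mform_ctrQ[OF Cons(2) q(1)] q(2)])
  ultimately show ?case by (simp add: signed_simps) (simp add: signed_def)
qed

end

text \<open>One shape for several uses: the values of the operator on constants, the brackets with
  values in \<open>Q\<close> and in \<open>B\<^sup>*\<close>, and the generators of the function
  algebra (there with the unit element in place of a coefficient).\<close>

definition str_form :: "('x \<Rightarrow> 'z::zero) \<Rightarrow> ('q \<Rightarrow> 'x \<Rightarrow> 'z) \<Rightarrow> ('q \<Rightarrow> 'q \<Rightarrow> 'x \<Rightarrow> 'z) \<Rightarrow> ('q \<Rightarrow> 'q \<Rightarrow> 'q \<Rightarrow> 'x \<Rightarrow> 'z) \<Rightarrow>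
    ('b \<Rightarrow> 'x \<Rightarrow> 'z) \<Rightarrow> ('b \<Rightarrow> 'q \<Rightarrow> 'x \<Rightarrow> 'z) \<Rightarrow> 'x \<Rightarrow> 'q list \<Rightarrow> 'b list \<Rightarrow> 'z" where
  "str_form del nab w2 w3 \<phi>0 \<phi>1 e = (\<lambda>qs bs. case (qs, bs) of
            ([], []) \<Rightarrow> del e
          | ([q], []) \<Rightarrow> nab q e
          | ([q1, q2], []) \<Rightarrow> w2 q1 q2 e
          | ([q1, q2, q3], []) \<Rightarrow> w3 q1 q2 q3 e
          | ([], [\<beta>]) \<Rightarrow> \<phi>0 \<beta> e
          | ([q], [\<beta>]) \<Rightarrow> \<phi>1 \<beta> q e
          | _ \<Rightarrow> 0)"

lemma str_form_simps [simp]: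
  "str_form del nab w2 w3 p0 p1 e [] [] = del e"
  "str_form del nab w2 w3 p0 p1 e [q] [] = nab q e"
  "str_form del nab w2 w3 p0 p1 e [q, r] [] = w2 q r e"
  "str_form del nab w2 w3 p0 p1 e [q, r, s] [] = w3 q r s e"
  "str_form del nab w2 w3 p0 p1 e (q # r # s # t # qs) bs = 0"
  "str_form del nab w2 w3 p0 p1 e [] [b] = p0 b e"
  "str_form del nab w2 w3 p0 p1 e [q] [b] = p1 b q e"
  "str_form del nab w2 w3 p0 p1 e (q # r # qs) (b # bs) = 0"
  "str_form del nab w2 w3 p0 p1 e qs (b # c # bs) = 0"
  by (simp_all add: str_form_def split: list.split)

lemma str_form_dual:
  "(\<lambda>qs bs. case (qs, bs) of ([q], []) \<Rightarrow> \<tau> q | _ \<Rightarrow> 0) =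
    str_form (\<lambda>_. 0) (\<lambda>q _. \<tau> q) (\<lambda>_ _ _. 0) (\<lambda>_ _ _ _. 0) (\<lambda>_ _. 0) (\<lambda>_ _ _. 0) ()"
  "(\<lambda>qs bs. case (qs, bs) of ([], [\<beta>]) \<Rightarrow> \<sigma> \<beta> | _ \<Rightarrow> 0) =
    str_form (\<lambda>_. 0) (\<lambda>_ _. 0) (\<lambda>_ _ _. 0) (\<lambda>_ _ _ _. 0) (\<lambda>\<beta> _. \<sigma> \<beta>) (\<lambda>_ _ _. 0) ()"
  by (simp_all add: str_form_def fun_eq_iff split: list.split)

context contraction_calculus
begin

text \<open>Among the arguments in \<open>Q\<close>, additivity is asked for the first only;
  skew-symmetry carries it to the others. Skew-symmetry and vanishing on equal arguments are listed
  separately because \<open>C\<close> may have 2-torsion.\<close>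

lemma mform_str_form:
  assumes C: "subgrp C"
    and closed: "del x \<in> C" "\<And>q. q \<in> Qs \<Longrightarrow> nab q x \<in> C" "\<And>q r. q \<in> Qs \<Longrightarrow> r \<in> Qs \<Longrightarrow> w2 q r x \<in> C"
      "\<And>q r s. q \<in> Qs \<Longrightarrow> r \<in> Qs \<Longrightarrow> s \<in> Qs \<Longrightarrow> w3 q r s x \<in> C"
      "\<And>b. b \<in> Bs \<Longrightarrow> p0 b x \<in> C" "\<And>q b. b \<in> Bs \<Longrightarrow> q \<in> Qs \<Longrightarrow> p1 b q x \<in> C"
    and add: "\<And>q q'. q \<in> Qs \<Longrightarrow> q' \<in> Qs \<Longrightarrow> nab (q + q') x = nab q x + nab q' x"
      "\<And>q q' r. q \<in> Qs \<Longrightarrow> q' \<in> Qs \<Longrightarrow> r \<in> Qs \<Longrightarrow> w2 (q + q') r x = w2 q r x + w2 q' r x"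
      "\<And>q q' r s. q \<in> Qs \<Longrightarrow> q' \<in> Qs \<Longrightarrow> r \<in> Qs \<Longrightarrow> s \<in> Qs \<Longrightarrow> w3 (q + q') r s x = w3 q r s x + w3 q' r s x"
      "\<And>q q' b. q \<in> Qs \<Longrightarrow> q' \<in> Qs \<Longrightarrow> b \<in> Bs \<Longrightarrow> p1 b (q + q') x = p1 b q x + p1 b q' x"
      "\<And>b b'. b \<in> Bs \<Longrightarrow> b' \<in> Bs \<Longrightarrow> p0 (b + b') x = p0 b x + p0 b' x"
      "\<And>b b' q. b \<in> Bs \<Longrightarrow> b' \<in> Bs \<Longrightarrow> q \<in> Qs \<Longrightarrow> p1 (b + b') q x = p1 b q x + p1 b' q x"
    and alt: "\<And>q r. q \<in> Qs \<Longrightarrow> r \<in> Qs \<Longrightarrow> w2 r q x = - w2 q r x"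
      "\<And>q r s. q \<in> Qs \<Longrightarrow> r \<in> Qs \<Longrightarrow> s \<in> Qs \<Longrightarrow> w3 r q s x = - w3 q r s x"
      "\<And>q r s. q \<in> Qs \<Longrightarrow> r \<in> Qs \<Longrightarrow> s \<in> Qs \<Longrightarrow> w3 q s r x = - w3 q r s x"
      "\<And>q. q \<in> Qs \<Longrightarrow> w2 q q x = 0"
      "\<And>q r. q \<in> Qs \<Longrightarrow> r \<in> Qs \<Longrightarrow> w3 q q r x = 0"
      "\<And>q r. q \<in> Qs \<Longrightarrow> r \<in> Qs \<Longrightarrow> w3 r q q x = 0"
  shows "mform C (str_form del nab w2 w3 p0 p1 x)" (is "mform C ?f")
proof -
  have q: "q + q' \<in> Qs" if "q \<in> Qs" "q' \<in> Qs" for q q'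
    using that subQ by (simp add: subgrp_closed)
  have w2: "w2 r (q + q') x = w2 r q x + w2 r q' x" if "q \<in> Qs" "q' \<in> Qs" "r \<in> Qs" for q q' r
    using that q alt(1)[of "q + q'" r] alt(1)[of q r] alt(1)[of q' r] by (simp add: add)
  have w3: "w3 r (q + q') s x = w3 r q s x + w3 r q' s x" if "q \<in> Qs" "q' \<in> Qs" "r \<in> Qs" "s \<in> Qs" for q q' r s
    using that q alt(2)[of "q + q'" r s] alt(2)[of q r s] alt(2)[of q' r s] by (simp add: add)
  have w3': "w3 r s (q + q') x = w3 r s q x + w3 r s q' x" if "q \<in> Qs" "q' \<in> Qs" "r \<in> Qs" "s \<in> Qs" for q q' r s
    using that q alt(3)[of r "q + q'" s] alt(3)[of r q s] alt(3)[of r q' s] w3[of q q' r s] by simp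
  show ?thesis
    unfolding mform_def
  proof (intro conjI allI impI)
    fix qs bs assume "secs qs bs"
    then show "?f qs bs \<in> C"
      using C by (cases qs rule: list4_cases; cases bs rule: list2_cases) (simp_all add: closed subgrp_closed)
  next
    fix qs q r qs' bs assume "secs (qs @ q # r # qs') bs"
    then show "?f (qs @ (q + r) # qs') bs = ?f (qs @ q # qs') bs + ?f (qs @ r # qs') bs"
      by (cases qs rule: list4_cases; cases qs' rule: list4_cases; cases bs rule: list2_cases)
        (simp_all add: add w2 w3 w3')
  next
    fix qs bs b c bs' assume "secs qs (bs @ b # c # bs')"
    then show "?f qs (bs @ (b + c) # bs') = ?f qs (bs @ b # bs') + ?f qs (bs @ c # bs')"
      by (cases qs rule: list4_cases; cases bs rule: list2_cases; cases bs' rule: list2_cases) (simp_all add: add)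
  next
    fix qs q qs' bs assume "secs (qs @ q # qs') bs"
    then show "?f (qs @ q # q # qs') bs = 0"
      by (cases qs rule: list4_cases; cases qs' rule: list4_cases; cases bs rule: list2_cases) (simp_all add: alt(4-6))
  next
    fix qs bs b c bs' assume "secs qs (bs @ b # c # bs')"
    then show "?f qs (bs @ b # c # bs') = ?f qs (bs @ c # b # bs')"
      by (cases bs rule: list2_cases) simp_all
  qed
qed

end

section \<open>The brackets as contraction parts of the symbol\<close>

context split_lie2
begin

text \<open>The sign is that of Cartan calculus: the value on \<open>q\<close> and \<open>r\<close>
  belongs to the commutator of the contraction by \<open>r\<close> with the Lie derivative along
  \<open>q\<close>, in this order, which is minus the contraction by [q, r]. The signs in
  \<open>bracketB\<close> have the same origin.\<close>

definition bracketQ :: "('m \<Rightarrow> 'q) list \<Rightarrow> ('m, 'b) dsection list \<Rightarrow> 'm \<Rightarrow> 'q" where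
  "bracketQ = str_form (\<lambda>_. 0) (\<lambda>_ _. 0) (\<lambda>q r _. - brk L q r) (\<lambda>_ _ _ _. 0) (\<lambda>\<beta> _. ell L \<beta>) (\<lambda>_ _ _. 0) ()"

definition bracketB :: "('m \<Rightarrow> 'q) list \<Rightarrow> ('m, 'b) dsection list \<Rightarrow> ('m, 'b) dsection" where
  "bracketB = str_form (\<lambda>_. 0) (\<lambda>_ _. 0) (\<lambda>_ _ _. 0) (\<lambda>q r s _. - omega L q r s) (\<lambda>_ _. 0) (\<lambda>\<beta> q _. - nabBd L q \<beta>) ()"

lemma bracketQ_simps [simp]:
  "bracketQ [] [] = 0" "bracketQ [q] bs = 0" "bracketQ [q, r] [] = - brk L q r" "bracketQ (q # r # s # qs) bs = 0"
  "bracketQ [] [b] = ell L b" "bracketQ (q # qs) (b # bs) = 0" "bracketQ qs (b # c # bs) = 0"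
  by (simp_all add: bracketQ_def str_form_def split: list.split)

lemma bracketB_simps [simp]:
  "bracketB [] bs = 0" "bracketB [q] [] = 0" "bracketB [q, r] bs = 0" "bracketB [q, r, s] [] = - omega L q r s" "bracketB (q # r # s # t # qs) bs = 0"
  "bracketB [q] [b] = - nabBd L q b" "bracketB (q # r # qs) (b # bs) = 0" "bracketB qs (b # c # bs) = 0"
  by (simp_all add: bracketB_def str_form_def split: list.split)

end

text \<open>The \<open>op_\<close> assumptions concern the coefficient and the \<open>arg_\<close>
  assumptions the inserted sections. Only \<open>nb\<close> has a Leibniz term in the coefficient.
  The three degrees -2, -1, 0 are what makes the list of flatness equations finite.\<close>

locale rep_data = split_lie2 L
  for L :: "('m::{t2_space,second_countable_topology}, 'q::real_vector, 'b::real_vector) split_data" +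
  fixes S :: "('m, 'e::ab_group_add) fmodule" and G :: "int \<Rightarrow> 'e set"
    and del :: "'e \<Rightarrow> 'e" and nb :: "('m \<Rightarrow> 'q) \<Rightarrow> 'e \<Rightarrow> 'e" and w2 :: "('m \<Rightarrow> 'q) \<Rightarrow> ('m \<Rightarrow> 'q) \<Rightarrow> 'e \<Rightarrow> 'e"
    and w3 :: "('m \<Rightarrow> 'q) \<Rightarrow> ('m \<Rightarrow> 'q) \<Rightarrow> ('m \<Rightarrow> 'q) \<Rightarrow> 'e \<Rightarrow> 'e"
    and p0 :: "('m, 'b) dsection \<Rightarrow> 'e \<Rightarrow> 'e" and p1 :: "('m, 'b) dsection \<Rightarrow> ('m \<Rightarrow> 'q) \<Rightarrow> 'e \<Rightarrow> 'e"
  assumes S_sub: "subgrp (elems S)"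
    and S_scl: "f \<in> Fs \<Longrightarrow> x \<in> elems S \<Longrightarrow> scl S f x \<in> elems S"
    and S_addL: "scl S (f + g) x = scl S f x + scl S g x"
    and S_addR: "scl S f (x + y) = scl S f x + scl S f y"
    and G_sub': "subgrp (G i)" and G_in: "G i \<subseteq> elems S" and G_zero: "i < -2 \<or> 0 < i \<Longrightarrow> G i = {0}"
    and G_dec: "x \<in> elems S \<Longrightarrow> \<exists>a\<in>G (-2). \<exists>b\<in>G (-1). \<exists>c\<in>G 0. x = a + b + c"
    and op_in: "x \<in> elems S \<Longrightarrow> del x \<in> elems S" "x \<in> elems S \<Longrightarrow> q \<in> QQ \<Longrightarrow> nb q x \<in> elems S"
      "x \<in> elems S \<Longrightarrow> q \<in> QQ \<Longrightarrow> r \<in> QQ \<Longrightarrow> w2 q r x \<in> elems S"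
      "x \<in> elems S \<Longrightarrow> q \<in> QQ \<Longrightarrow> r \<in> QQ \<Longrightarrow> s \<in> QQ \<Longrightarrow> w3 q r s x \<in> elems S"
      "x \<in> elems S \<Longrightarrow> b \<in> BD \<Longrightarrow> p0 b x \<in> elems S"
      "x \<in> elems S \<Longrightarrow> b \<in> BD \<Longrightarrow> q \<in> QQ \<Longrightarrow> p1 b q x \<in> elems S"
    and op_add: "x \<in> elems S \<Longrightarrow> y \<in> elems S \<Longrightarrow> del (x + y) = del x + del y"
      "x \<in> elems S \<Longrightarrow> y \<in> elems S \<Longrightarrow> q \<in> QQ \<Longrightarrow> nb q (x + y) = nb q x + nb q y"
      "x \<in> elems S \<Longrightarrow> y \<in> elems S \<Longrightarrow> q \<in> QQ \<Longrightarrow> r \<in> QQ \<Longrightarrow> w2 q r (x + y) = w2 q r x + w2 q r y"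
      "x \<in> elems S \<Longrightarrow> y \<in> elems S \<Longrightarrow> q \<in> QQ \<Longrightarrow> r \<in> QQ \<Longrightarrow> s \<in> QQ \<Longrightarrow> w3 q r s (x + y) = w3 q r s x + w3 q r s y"
      "x \<in> elems S \<Longrightarrow> y \<in> elems S \<Longrightarrow> b \<in> BD \<Longrightarrow> p0 b (x + y) = p0 b x + p0 b y"
      "x \<in> elems S \<Longrightarrow> y \<in> elems S \<Longrightarrow> b \<in> BD \<Longrightarrow> q \<in> QQ \<Longrightarrow> p1 b q (x + y) = p1 b q x + p1 b q y"
    and op_scl: "x \<in> elems S \<Longrightarrow> f \<in> Fs \<Longrightarrow> del (scl S f x) = scl S f (del x)"
      "x \<in> elems S \<Longrightarrow> f \<in> Fs \<Longrightarrow> q \<in> QQ \<Longrightarrow> nb q (scl S f x) = scl S f (nb q x) + scl S (anchor L q f) x"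
      "x \<in> elems S \<Longrightarrow> f \<in> Fs \<Longrightarrow> q \<in> QQ \<Longrightarrow> r \<in> QQ \<Longrightarrow> w2 q r (scl S f x) = scl S f (w2 q r x)"
      "x \<in> elems S \<Longrightarrow> f \<in> Fs \<Longrightarrow> q \<in> QQ \<Longrightarrow> r \<in> QQ \<Longrightarrow> s \<in> QQ \<Longrightarrow> w3 q r s (scl S f x) = scl S f (w3 q r s x)"
      "x \<in> elems S \<Longrightarrow> f \<in> Fs \<Longrightarrow> b \<in> BD \<Longrightarrow> p0 b (scl S f x) = scl S f (p0 b x)"
      "x \<in> elems S \<Longrightarrow> f \<in> Fs \<Longrightarrow> b \<in> BD \<Longrightarrow> q \<in> QQ \<Longrightarrow> p1 b q (scl S f x) = scl S f (p1 b q x)"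
    and arg_add: "x \<in> elems S \<Longrightarrow> q \<in> QQ \<Longrightarrow> q' \<in> QQ \<Longrightarrow> nb (q + q') x = nb q x + nb q' x"
      "x \<in> elems S \<Longrightarrow> q \<in> QQ \<Longrightarrow> q' \<in> QQ \<Longrightarrow> r \<in> QQ \<Longrightarrow> w2 (q + q') r x = w2 q r x + w2 q' r x"
      "x \<in> elems S \<Longrightarrow> q \<in> QQ \<Longrightarrow> q' \<in> QQ \<Longrightarrow> r \<in> QQ \<Longrightarrow> s \<in> QQ \<Longrightarrow> w3 (q + q') r s x = w3 q r s x + w3 q' r s x"
      "x \<in> elems S \<Longrightarrow> q \<in> QQ \<Longrightarrow> q' \<in> QQ \<Longrightarrow> b \<in> BD \<Longrightarrow> p1 b (q + q') x = p1 b q x + p1 b q' x"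
      "x \<in> elems S \<Longrightarrow> b \<in> BD \<Longrightarrow> b' \<in> BD \<Longrightarrow> p0 (b + b') x = p0 b x + p0 b' x"
      "x \<in> elems S \<Longrightarrow> b \<in> BD \<Longrightarrow> b' \<in> BD \<Longrightarrow> q \<in> QQ \<Longrightarrow> p1 (b + b') q x = p1 b q x + p1 b' q x"
    and arg_scl: "x \<in> elems S \<Longrightarrow> f \<in> Fs \<Longrightarrow> q \<in> QQ \<Longrightarrow> nb (pscale f q) x = scl S f (nb q x)"
      "x \<in> elems S \<Longrightarrow> f \<in> Fs \<Longrightarrow> q \<in> QQ \<Longrightarrow> r \<in> QQ \<Longrightarrow> w2 (pscale f q) r x = scl S f (w2 q r x)"
      "x \<in> elems S \<Longrightarrow> f \<in> Fs \<Longrightarrow> q \<in> QQ \<Longrightarrow> r \<in> QQ \<Longrightarrow> s \<in> QQ \<Longrightarrow> w3 (pscale f q) r s x = scl S f (w3 q r s x)"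
      "x \<in> elems S \<Longrightarrow> f \<in> Fs \<Longrightarrow> q \<in> QQ \<Longrightarrow> b \<in> BD \<Longrightarrow> p1 b (pscale f q) x = scl S f (p1 b q x)"
      "x \<in> elems S \<Longrightarrow> f \<in> Fs \<Longrightarrow> b \<in> BD \<Longrightarrow> p0 (fscale f b) x = scl S f (p0 b x)"
      "x \<in> elems S \<Longrightarrow> f \<in> Fs \<Longrightarrow> b \<in> BD \<Longrightarrow> q \<in> QQ \<Longrightarrow> p1 (fscale f b) q x = scl S f (p1 b q x)"
    and arg_alt: "x \<in> elems S \<Longrightarrow> q \<in> QQ \<Longrightarrow> r \<in> QQ \<Longrightarrow> w2 r q x = - w2 q r x"
      "x \<in> elems S \<Longrightarrow> q \<in> QQ \<Longrightarrow> r \<in> QQ \<Longrightarrow> s \<in> QQ \<Longrightarrow> w3 r q s x = - w3 q r s x"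
      "x \<in> elems S \<Longrightarrow> q \<in> QQ \<Longrightarrow> r \<in> QQ \<Longrightarrow> s \<in> QQ \<Longrightarrow> w3 q s r x = - w3 q r s x"
      "x \<in> elems S \<Longrightarrow> q \<in> QQ \<Longrightarrow> w2 q q x = 0"
      "x \<in> elems S \<Longrightarrow> q \<in> QQ \<Longrightarrow> r \<in> QQ \<Longrightarrow> w3 q q r x = 0"
      "x \<in> elems S \<Longrightarrow> q \<in> QQ \<Longrightarrow> r \<in> QQ \<Longrightarrow> w3 r q q x = 0"
    and op_deg: "x \<in> G i \<Longrightarrow> del x \<in> G (i + 1)" "x \<in> G i \<Longrightarrow> q \<in> QQ \<Longrightarrow> nb q x \<in> G i"
      "x \<in> G i \<Longrightarrow> q \<in> QQ \<Longrightarrow> r \<in> QQ \<Longrightarrow> w2 q r x \<in> G (i - 1)"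
      "x \<in> G i \<Longrightarrow> q \<in> QQ \<Longrightarrow> r \<in> QQ \<Longrightarrow> s \<in> QQ \<Longrightarrow> w3 q r s x \<in> G (i - 2)"
      "x \<in> G i \<Longrightarrow> b \<in> BD \<Longrightarrow> p0 b x \<in> G (i - 1)"
      "x \<in> G i \<Longrightarrow> b \<in> BD \<Longrightarrow> q \<in> QQ \<Longrightarrow> p1 b q x \<in> G (i - 2)"
begin

sublocale tensor_calculus QQ BD "elems S" G Fs pscale fscale "scl S"
  by unfold_locales (use sub S_sub G_sub' G_in S_scl S_addL S_addR in auto)

abbreviation "str \<equiv> str_form del nb w2 w3 p0 p1"

definition rep_symbol :: "('m \<Rightarrow> 'q, ('m, 'b) dsection, 'e) symb" where
  "rep_symbol qs bs = ((\<lambda>x. if x \<in> elems S then str x qs bs else 0), bracketQ qs bs, bracketB qs bs)"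

lemma mform_str: "x \<in> elems S \<Longrightarrow> mform (elems S) (str x)"
  by (rule mform_str_form[OF S_sub]; rule op_in arg_add arg_alt; assumption)

lemma mform_bracketQ: "mform QQ bracketQ"
  unfolding bracketQ_def
proof (rule mform_str_form[OF sub(1)])
  show "- brk L r q = - (- brk L q r)" if "q \<in> QQ" "r \<in> QQ" for q r
    using that brk_skew[of r q] by simp
qed simp_all

lemma mform_bracketB: "mform BD bracketB"
  unfolding bracketB_def
proof (rule mform_str_form[OF sub(3)])
  show "- omega L r q s = - (- omega L q r s)" "- omega L q s r = - (- omega L q r s)"
    if "q \<in> QQ" "r \<in> QQ" "s \<in> QQ" for q r s
    using that om_swap12[of q r s] om_swap23[of q r s] by simp_all
qed simp_all

lemma str_add: "x \<in> elems S \<Longrightarrow> y \<in> elems S \<Longrightarrow> secs qs bs \<Longrightarrow> str (x + y) qs bs = str x qs bs + str y qs bs"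
  by (cases qs rule: list4_cases; cases bs rule: list2_cases) (simp_all add: op_add)

lemma str_deg: "x \<in> G i \<Longrightarrow> secs qs bs \<Longrightarrow> str x qs bs \<in> G (i + (1 - int (length qs) - 2 * int (length bs)))"
  using G_sub' by (cases qs rule: list4_cases; cases bs rule: list2_cases) (simp_all add: op_deg subgrp_closed)

lemma rep_symbol_Endo: "secs qs bs \<Longrightarrow> fst (rep_symbol qs bs) \<in> Endo"
  using mform_V[OF mform_str] S_sub by (simp add: rep_symbol_def Endo_def str_add subgrp_closed)

lemma mform_rep_symbol: "mform V rep_symbol"
proof (rule mform_V_I)
  show "mform (elems S) (\<lambda>qs bs. fst (rep_symbol qs bs) x)" if "x \<in> elems S" for x
    using mform_str[OF that] that by (simp add: rep_symbol_def)
qed (use mform_bracketQ mform_bracketB in \<open>simp_all add: rep_symbol_Endo\<close>, simp_all add: rep_symbol_def)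

lemma symbol_rep_symbol: "symbol 1 rep_symbol"
  unfolding symbol_def
proof (intro conjI allI impI)
  fix qs bs assume s: "secs qs bs"
  have "fst (rep_symbol qs bs) x \<in> G (i + (1 - int (length qs) - 2 * int (length bs)))" if "x \<in> G i" for x i
    using str_deg[OF that s] that G_in by (auto simp: rep_symbol_def)
  moreover have "bracketQ qs bs \<noteq> 0 \<longrightarrow> 1 - int (length qs) - 2 * int (length bs) = -1"
    using s by (cases qs rule: list4_cases; cases bs rule: list2_cases) simp_all
  moreover have "bracketB qs bs \<noteq> 0 \<longrightarrow> 1 - int (length qs) - 2 * int (length bs) = -2"
    using s by (cases qs rule: list4_cases; cases bs rule: list2_cases) simp_all
  ultimately show "rep_symbol qs bs \<in> Vdeg (1 - int (length qs) - 2 * int (length bs))"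
    using rep_symbol_Endo[OF s] mform_V[OF mform_bracketQ s] mform_V[OF mform_bracketB s] by (auto simp: Vdeg_def rep_symbol_def)
qed (rule mform_rep_symbol)

lemma supported_rep_symbol: "supported 3 rep_symbol"
  unfolding supported_def
proof (intro allI impI)
  fix qs bs assume "secs qs bs" "3 < int (length qs + length bs)"
  then show "rep_symbol qs bs = 0"
    by (cases qs rule: list4_cases; cases bs rule: list2_cases) (simp_all add: rep_symbol_def zero_prod_def fun_eq_iff zero_fun_apply)
qed

text \<open>The derivative of \<open>f\<close> has a single nonzero component, with one argument in
  \<open>Q\<close>. The corrections demanded by the criterion are the Leibniz terms of
  \<open>nb\<close>, of [f q, r] and of \<open>\<nabla>\<^sup>*\<^sub>q (f \<beta>)\<close>.\<close>

lemma tensorial_symb_op_rep_symbol: assumes "mform (elems S) \<eta>" "tensorial \<eta>" shows "tensorial (symb_op 1 rep_symbol \<eta>)"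
proof (rule tensorial_symb_op[OF mform_rep_symbol assms, where g = "\<lambda>f qs bs. case (qs, bs) of ([q], []) \<Rightarrow> anchor L q f | _ \<Rightarrow> 0"])
  fix f assume f: "f \<in> Fs"
  let ?g = "\<lambda>qs bs. case (qs, bs) of ([q], []) \<Rightarrow> anchor L q f | _ \<Rightarrow> 0"
  show "rvalued ?g"
    using f by (auto simp: rvalued_def split: list.split)
  show "- f \<in> Fs" using f by simp
  have z: "scl S 0 x = 0" "scl S f 0 = 0" for x by (simp_all add: sE_zero)
  show "fst (rep_symbol qs bs) (scl S f x) = scl S f (fst (rep_symbol qs bs) x) + scl S (?g qs bs) x"
    if "secs qs bs" "x \<in> elems S" for qs bs x
    using that f by (cases qs rule: list4_cases; cases bs rule: list2_cases) (simp_all add: rep_symbol_def S_scl op_scl z)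
  show "rep_symbol (pscale f q # qs) bs = vscale f (rep_symbol (q # qs) bs) + (0, pscale (?g qs bs) q, 0)"
    if "secs (q # qs) bs" for q qs bs
    using that f by (cases qs rule: list4_cases; cases bs rule: list2_cases)
      (auto simp: rep_symbol_def vscale_def fun_eq_iff fun_apply arg_scl z pscale_algebra fscale_algebra)
  show "rep_symbol qs (fscale f b # bs) = vscale f (rep_symbol qs (b # bs)) + (0, 0, fscale (- ?g qs bs) b)"
    if "secs qs (b # bs)" for b qs bs
    using that f by (cases qs rule: list4_cases; cases bs rule: list2_cases)
      (auto simp: rep_symbol_def vscale_def fun_eq_iff fun_apply arg_scl z pscale_algebra fscale_algebra)
qed

text \<open>An endomorphism of such a degree leaves the range of the grading, and contractions have
  degree -1 or -2.\<close>

lemma Vdeg_small: assumes "v \<in> Vdeg d" "d < -2" shows "v = 0"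
proof -
  obtain \<phi> q b where v: "v = (\<phi>, q, b)" by (metis prod.collapse)
  have "\<phi> x = 0" for x
  proof (cases "x \<in> elems S")
    case True
    then obtain a b c where x: "a \<in> G (-2)" "b \<in> G (-1)" "c \<in> G 0" "x = a + b + c"
      using G_dec by blast
    have "\<phi> a = 0" "\<phi> b = 0" "\<phi> c = 0"
      using Vdeg_D(6)[OF assms(1) x(1)] Vdeg_D(6)[OF assms(1) x(2)] Vdeg_D(6)[OF assms(1) x(3)] assms(2)
      by (simp_all add: v G_zero)
    moreover have "a \<in> elems S" "b \<in> elems S" "c \<in> elems S" using x G_in by blast+
    ultimately show ?thesis
      using Vdeg_D(1)[OF assms(1)] S_sub by (simp add: v x(4) Endo_add subgrp_closed)
  qed (use Vdeg_D(1)[OF assms(1)] in \<open>simp add: v Endo_outside\<close>)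
  then show ?thesis using Vdeg_D(4,5)[OF assms(1)] assms(2) by (auto simp: v zero_prod_def fun_eq_iff zero_fun_apply)
qed

end

section \<open>The operator on forms and its structure objects\<close>

context rep_data
begin

text \<open>Translates between arguments addressed by index, as in \<open>forms\<close>, and lists
  split around an entry, as in the calculus. Repeated or permuted arguments are reduced to
  neighbours by \<open>mform_not_distinct\<close> and \<open>mform_mset\<close>.\<close>

lemma forms_iff:
  "\<eta> \<in> forms L S \<longleftrightarrow> (\<forall>qs bs. \<not> secs qs bs \<longrightarrow> \<eta> qs bs = 0) \<and> mform (elems S) \<eta> \<and> tensorial \<eta> \<and> (\<exists>N. supported N \<eta>)"
proof
  assume a: "\<eta> \<in> forms L S"
  then have out: "\<And>qs bs. \<not> secs qs bs \<Longrightarrow> \<eta> qs bs = 0"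
    and val: "\<And>qs bs. secs qs bs \<Longrightarrow> \<eta> qs bs \<in> elems S"
    and alt: "\<And>qs bs. secs qs bs \<Longrightarrow> \<not> distinct qs \<Longrightarrow> \<eta> qs bs = 0"
    and sym: "\<And>qs bs bs'. secs qs bs \<Longrightarrow> mset bs' = mset bs \<Longrightarrow> \<eta> qs bs' = \<eta> qs bs"
    and linQ: "\<And>qs bs i. secs qs bs \<Longrightarrow> i < length qs \<Longrightarrow> linear_over (base L) (secQ L) S (\<lambda>q. \<eta> (qs[i := q]) bs)"
    and linB: "\<And>qs bs i. secs qs bs \<Longrightarrow> i < length bs \<Longrightarrow> linear_over (base L) (secBd L) S (\<lambda>b. \<eta> qs (bs[i := b]))"
    unfolding forms_def secs_def mem_Collect_eq by blast+
  obtain N where N: "\<And>qs bs. N < length qs + length bs \<Longrightarrow> \<eta> qs bs = 0"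
    using a unfolding forms_def mem_Collect_eq by blast
  have lQ: "linear_over (base L) (secQ L) S (\<lambda>r. \<eta> (qs @ r # qs') bs)" if "secs (qs @ q # qs') bs" for qs q qs' bs
    using linQ[OF that, of "length qs"] by simp
  have lB: "linear_over (base L) (secBd L) S (\<lambda>c. \<eta> qs (bs @ c # bs'))" if "secs qs (bs @ b # bs')" for qs bs b bs'
    using linB[OF that, of "length bs"] by simp
  have "mform (elems S) \<eta>"
    unfolding mform_def
  proof (intro conjI allI impI)
    fix qs q r qs' bs assume s: "secs (qs @ q # r # qs') bs"
    then show "\<eta> (qs @ (q + r) # qs') bs = \<eta> (qs @ q # qs') bs + \<eta> (qs @ r # qs') bs"
      using lQ[of qs q qs' bs] by (simp add: linear_over_def)
  next
    fix qs bs b c bs' assume s: "secs qs (bs @ b # c # bs')"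
    then show "\<eta> qs (bs @ (b + c) # bs') = \<eta> qs (bs @ b # bs') + \<eta> qs (bs @ c # bs')"
      using lB[of qs bs b bs'] by (simp add: linear_over_def)
  qed (use val in simp, rule alt, simp, simp, rule sym, simp_all)
  moreover have "tensorial \<eta>"
    unfolding tensorial_def using lQ lB by (auto simp: linear_over_def)
  moreover have "supported (int N) \<eta>" using N by (simp add: supported_def)
  ultimately show "(\<forall>qs bs. \<not> secs qs bs \<longrightarrow> \<eta> qs bs = 0) \<and> mform (elems S) \<eta> \<and> tensorial \<eta> \<and> (\<exists>N. supported N \<eta>)"
    using out by blast
next
  assume a: "(\<forall>qs bs. \<not> secs qs bs \<longrightarrow> \<eta> qs bs = 0) \<and> mform (elems S) \<eta> \<and> tensorial \<eta> \<and> (\<exists>N. supported N \<eta>)"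
  then have out: "\<And>qs bs. \<not> secs qs bs \<Longrightarrow> \<eta> qs bs = 0" and m: "mform (elems S) \<eta>" and l: "tensorial \<eta>" by auto
  from a obtain N where N: "supported N \<eta>" by blast
  show "\<eta> \<in> forms L S"
    unfolding forms_def secs_def[symmetric] mem_Collect_eq
  proof (intro conjI allI impI)
    fix qs bs i assume s: "secs qs bs" "i < length qs"
    then obtain u q v where q: "qs = u @ q # v" "length u = i" by (metis id_take_nth_drop length_take min.absorb4)
    show "linear_over (base L) (secQ L) S (\<lambda>q. \<eta> (qs[i := q]) bs)"
      using s(1) mform_V[OF m] mform_addQ[OF m] tensorial_Q[OF l]
      by (auto simp: linear_over_def q(1) q(2)[symmetric])
  next
    fix qs bs i assume s: "secs qs bs" "i < length bs"
    then obtain u q v where q: "bs = u @ q # v" "length u = i" by (metis id_take_nth_drop length_take min.absorb4)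
    show "linear_over (base L) (secBd L) S (\<lambda>b. \<eta> qs (bs[i := b]))"
      using s(1) mform_V[OF m] mform_addB[OF m] tensorial_B[OF l]
      by (auto simp: linear_over_def q(1) q(2)[symmetric])
  next
    show "\<exists>N. \<forall>qs bs. N < length qs + length bs \<longrightarrow> \<eta> qs bs = 0"
    proof (intro exI allI impI)
      fix qs :: "('m \<Rightarrow> 'q) list" and bs :: "('m, 'b) dsection list" assume "nat N < length qs + length bs"
      then show "\<eta> qs bs = 0" using out supported_0[OF N, of qs bs] by (cases "secs qs bs") auto
    qed
  next
    fix qs bs assume "\<not> secs qs bs" then show "\<eta> qs bs = 0" by (rule out)
  next
    fix qs bs assume "secs qs bs" then show "\<eta> qs bs \<in> elems S" by (rule mform_V[OF m])
  next
    fix qs bs assume "secs qs bs" "\<not> distinct qs" then show "\<eta> qs bs = 0" by (rule mform_not_distinct[OF m])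
  next
    fix qs bs bs' assume "secs qs bs" "mset bs' = mset bs" then show "\<eta> qs bs' = \<eta> qs bs" by (rule mform_mset[OF m])
  qed
qed

text \<open>Cut off outside the sections, where \<open>symb_op\<close> may be nonzero but a form has
  to vanish.\<close>

definition rep_op :: "('m, 'q, 'b, 'e) form \<Rightarrow> ('m, 'q, 'b, 'e) form" where
  "rep_op \<eta> = on_sections L (symb_op 1 rep_symbol \<eta>)"

lemma rep_op_apply: "rep_op \<eta> qs bs = (if secs qs bs then symb_op 1 rep_symbol \<eta> qs bs else 0)"
  by (simp add: rep_op_def on_sections_def secs_def)

lemma mform_cong: "mform C \<eta> \<Longrightarrow> (\<And>qs bs. secs qs bs \<Longrightarrow> \<eta>' qs bs = \<eta> qs bs) \<Longrightarrow> mform C \<eta>'"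
  unfolding mform_def by (simp add: sub(1,3)[THEN subgrp_add])

lemma tensorial_cong: "tensorial \<eta> \<Longrightarrow> (\<And>qs bs. secs qs bs \<Longrightarrow> \<eta>' qs bs = \<eta> qs bs) \<Longrightarrow> tensorial \<eta>'"
  unfolding tensorial_def by simp

lemma forms_mform: "\<eta> \<in> forms L S \<Longrightarrow> mform (elems S) \<eta>"
  by (simp add: forms_iff)

lemma rep_op_forms: assumes "\<eta> \<in> forms L S" shows "rep_op \<eta> \<in> forms L S"
proof -
  obtain N where N: "supported N \<eta>" and m: "mform (elems S) \<eta>" "tensorial \<eta>" using assms by (auto simp: forms_iff)
  have "supported (N + 3) (rep_op \<eta>)"
    using symb_op_supported_0[OF mform_rep_symbol m(1) supported_rep_symbol N] by (simp add: supported_def rep_op_apply)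
  moreover have "mform (elems S) (rep_op \<eta>)"
    by (rule mform_cong[OF mform_symb_op[OF mform_rep_symbol m(1)]]) (simp add: rep_op_apply)
  moreover have "tensorial (rep_op \<eta>)"
    by (rule tensorial_cong[OF tensorial_symb_op_rep_symbol[OF m]]) (simp add: rep_op_apply)
  ultimately show ?thesis by (auto simp: forms_iff rep_op_apply)
qed

lemma rep_op_hom:
  assumes "\<eta> \<in> hom_forms L S G j" shows "rep_op \<eta> \<in> hom_forms L S G (j + 1)"
proof -
  have f: "\<eta> \<in> forms L S" and h: "homog j \<eta>" using assms by (auto simp: hom_forms_def homog_def)
  then show ?thesis
    using symb_op_G[OF symbol_rep_symbol h forms_mform[OF f]] rep_op_forms[OF f] G_sub' by (auto simp: hom_forms_def rep_op_apply subgrp_closed)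
qed

lemma rep_op_add: "\<eta> \<in> forms L S \<Longrightarrow> \<eta>' \<in> forms L S \<Longrightarrow> rep_op (\<eta> + \<eta>') = rep_op \<eta> + rep_op \<eta>'"
  by (auto simp: fun_eq_iff rep_op_apply plus_fun_apply symb_op_add_form mform_symv[OF mform_rep_symbol] mform_valued[OF forms_mform])

text \<open>Every contraction of a constant form is zero, so all arguments go into the symbol. This
  is how the structure objects are read off from the operator.\<close>

lemma symb_op_const:
  assumes "mform V A" "e \<in> elems S" "secs qs bs"
  shows "symb_op d A (const_form e) qs bs = fst (A qs bs) e"
  using assms(1,3)
proof (induction qs arbitrary: d A)
  case Nil
  then show ?case
  proof (induction bs arbitrary: d A)
    case Nil
    then show ?case by (simp add: act_def const_form_def)
  next
    case (Cons b bs)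
    have "ctrB b (const_form e) = (0 :: ('m \<Rightarrow> 'q) list \<Rightarrow> ('m, 'b) dsection list \<Rightarrow> 'e)"
      by (simp add: fun_eq_iff ctr_apply const_form_def zero_fun_apply)
    then show ?case using Cons by (simp add: mform_ctrB symb_op_zero_form mform_symv) (simp add: ctr_apply)
  qed
next
  case (Cons q qs)
  have "ctrQ q (const_form e) = (0 :: ('m \<Rightarrow> 'q) list \<Rightarrow> ('m, 'b) dsection list \<Rightarrow> 'e)"
    by (simp add: fun_eq_iff ctr_apply const_form_def zero_fun_apply)
  then show ?case using Cons by (simp add: mform_ctrQ symb_op_zero_form mform_symv signed_simps) (simp add: ctr_apply)
qed

lemma rep_op_const: "e \<in> elems S \<Longrightarrow> rep_op (const_form e) = on_sections L (str e)"
  by (auto simp: fun_eq_iff rep_op_def on_sections_def symb_op_const mform_rep_symbol secs_def) (simp add: rep_symbol_def)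

theorem has_structure: "has_structure_objects L S rep_op del nb w2 w3 p0 p1"
  unfolding has_structure_objects_def using rep_op_const by (simp add: str_form_def)

lemma op_neg:
  assumes "x \<in> elems S"
  shows "q \<in> QQ \<Longrightarrow> nb (- q) x = - nb q x" "q \<in> QQ \<Longrightarrow> r \<in> QQ \<Longrightarrow> w2 (- q) r x = - w2 q r x"
    "q \<in> QQ \<Longrightarrow> r \<in> QQ \<Longrightarrow> w2 r (- q) x = - w2 r q x"
    "q \<in> QQ \<Longrightarrow> r \<in> QQ \<Longrightarrow> s \<in> QQ \<Longrightarrow> w3 (- q) r s x = - w3 q r s x"
    "q \<in> QQ \<Longrightarrow> r \<in> QQ \<Longrightarrow> s \<in> QQ \<Longrightarrow> w3 r s (- q) x = - w3 r s q x"
    "b \<in> BD \<Longrightarrow> p0 (- b) x = - p0 b x"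
    "b \<in> BD \<Longrightarrow> q \<in> QQ \<Longrightarrow> p1 (- b) q x = - p1 b q x" "b \<in> BD \<Longrightarrow> q \<in> QQ \<Longrightarrow> p1 b (- q) x = - p1 b q x"
  using assms mform_negQ[OF mform_str[OF assms], of "[]" q "[]" "[]"]
    mform_negQ[OF mform_str[OF assms], of "[]" q "[r]" "[]"] mform_negQ[OF mform_str[OF assms], of "[r]" q "[]" "[]"]
    mform_negQ[OF mform_str[OF assms], of "[]" q "[r, s]" "[]"] mform_negQ[OF mform_str[OF assms], of "[r, s]" q "[]" "[]"]
    mform_negB[OF mform_str[OF assms], of "[]" "[]" b "[]"] mform_negB[OF mform_str[OF assms], of "[q]" "[]" b "[]"]
    mform_negQ[OF mform_str[OF assms], of "[]" q "[]" "[b]"]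
  by simp_all

lemma op_zero:
  assumes "x \<in> elems S"
  shows "r \<in> QQ \<Longrightarrow> w2 0 r x = 0" "r \<in> QQ \<Longrightarrow> w2 r 0 x = 0"
    "r \<in> QQ \<Longrightarrow> s \<in> QQ \<Longrightarrow> w3 0 r s x = 0" "r \<in> QQ \<Longrightarrow> s \<in> QQ \<Longrightarrow> w3 r s 0 x = 0"
    "p0 0 x = 0" "q \<in> QQ \<Longrightarrow> p1 0 q x = 0" "b \<in> BD \<Longrightarrow> p1 b 0 x = 0" "nb 0 x = 0"
  using assms mform_zeroQ[OF mform_str[OF assms], of "[]" "[]" "[]"]
    mform_zeroQ[OF mform_str[OF assms], of "[]" "[r]" "[]"] mform_zeroQ[OF mform_str[OF assms], of "[r]" "[]" "[]"]
    mform_zeroQ[OF mform_str[OF assms], of "[]" "[r, s]" "[]"] mform_zeroQ[OF mform_str[OF assms], of "[r, s]" "[]" "[]"]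
    mform_zeroB[OF mform_str[OF assms], of "[]" "[]" "[]"] mform_zeroB[OF mform_str[OF assms], of "[q]" "[]" "[]"]
    mform_zeroQ[OF mform_str[OF assms], of "[]" "[]" "[b]"]
  by simp_all

section \<open>Evaluation of the curvature in low arity\<close>

lemma rep_symbol_simps:
  "x \<in> elems S \<Longrightarrow> fst (rep_symbol qs bs) x = str x qs bs"
  "fst (snd (rep_symbol qs bs)) = bracketQ qs bs" "snd (snd (rep_symbol qs bs)) = bracketB qs bs" "fst (rep_symbol [] []) 0 = 0"
  using Endo_zero[OF rep_symbol_Endo[of "[]" "[]"]] by (simp_all add: rep_symbol_def)

lemmas symbol_eval = rep_symbol_simps ctr_apply fun_apply signed_def fst_add snd_add op_in op_zero op_neg

lemma V_eq_0:
  assumes "v \<in> V" "\<And>x. x \<in> elems S \<Longrightarrow> fst v x = 0" "snd v = 0" shows "v = 0"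
proof -
  have "fst v x = 0" for x
    using assms(2)[of x] Endo_outside[OF V_D(1)[OF assms(1)], of x] by blast
  then show ?thesis using assms(3) by (simp add: prod_eq_iff fun_eq_iff zero_fun_apply)
qed

lemma sbracketQ_V: "q \<in> QQ \<Longrightarrow> secs qs bs \<Longrightarrow> sbracket 0 1 (ctrQ q rep_symbol) rep_symbol qs bs \<in> V"
  using symv_V[OF symv_sbracket[of 0 "ctrQ q rep_symbol" 1 rep_symbol]] symbol_ctrQ[OF symbol_rep_symbol, of q] symbol_rep_symbol by simp

lemma sbracketB_V: "b \<in> BD \<Longrightarrow> secs qs bs \<Longrightarrow> sbracket (-1) 1 (ctrB b rep_symbol) rep_symbol qs bs \<in> V"
  using symv_V[OF symv_sbracket[of "-1" "ctrB b rep_symbol" 1 rep_symbol]] symbol_ctrB[OF symbol_rep_symbol, of b] symbol_rep_symbol by simp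

text \<open>The bracket has total degree 1, so on k arguments in \<open>Q\<close> and l in
  \<open>B\<^sup>*\<close> its value has degree 1 - k - 2l, which is below -2 as soon as k + 2l
  exceeds 3. In \<open>sbracketB_small\<close> the total degree is 0 and the bound becomes
  2.\<close>

lemma sbracketQ_small:
  assumes "q \<in> QQ" "secs qs bs" "3 < int (length qs) + 2 * int (length bs)"
  shows "sbracket 0 1 (ctrQ q rep_symbol) rep_symbol qs bs = 0"
proof -
  have "symbol 0 (ctrQ q rep_symbol)" using symbol_ctrQ[OF symbol_rep_symbol assms(1)] by simp
  from sbracket_Vdeg[OF this symbol_rep_symbol assms(2)] show ?thesis by (rule Vdeg_small) (use assms(3) in simp)
qed

lemma sbracketB_small:
  assumes "b \<in> BD" "secs qs bs" "2 < int (length qs) + 2 * int (length bs)"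
  shows "sbracket (-1) 1 (ctrB b rep_symbol) rep_symbol qs bs = 0"
proof -
  have "symbol (-1) (ctrB b rep_symbol)" using symbol_ctrB[OF symbol_rep_symbol assms(1)] by simp
  from sbracket_Vdeg[OF this symbol_rep_symbol assms(2)] show ?thesis by (rule Vdeg_small) (use assms(3) in simp)
qed

text \<open>Fixes the position of a bracket among the arguments, so that equal terms become
  syntactically equal.\<close>

lemma arg_move:
  assumes "x \<in> elems S" "q \<in> QQ" "r \<in> QQ" "s \<in> QQ"
  shows "w2 s (brk L q r) x = - w2 (brk L q r) s x"
    "t \<in> QQ \<Longrightarrow> w3 s t (brk L q r) x = w3 (brk L q r) s t x"
  using assms arg_alt(1)[of x s "brk L q r"] arg_alt(2)[of x s "brk L q r" t] arg_alt(3)[of x s "brk L q r" t] by simp_all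

end

text \<open>The coefficient part of the square, one equation for each arity with k + 2l \<le> 4; the
  names list the arguments. The contraction part is the same for all representations and is settled
  by the axioms of the algebroid.\<close>

locale flat_rep_data = rep_data +
  assumes flat_del: "x \<in> elems S \<Longrightarrow> del (del x) = 0"
    and flat_q: "x \<in> elems S \<Longrightarrow> q \<in> QQ \<Longrightarrow> nb q (del x) = del (nb q x)"
    and flat_qq: "x \<in> elems S \<Longrightarrow> q \<in> QQ \<Longrightarrow> r \<in> QQ \<Longrightarrow>
      nb q (nb r x) - nb r (nb q x) - nb (brk L q r) x + w2 q r (del x) + del (w2 q r x) = 0"
    and flat_qqq: "x \<in> elems S \<Longrightarrow> q \<in> QQ \<Longrightarrow> r \<in> QQ \<Longrightarrow> s \<in> QQ \<Longrightarrow>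
      nb q (w2 r s x) - nb r (w2 q s x) + nb s (w2 q r x) - w2 r s (nb q x) + w2 q s (nb r x) - w2 q r (nb s x)
      - w2 (brk L q r) s x + w2 (brk L q s) r x - w2 (brk L r s) q x
      + w3 q r s (del x) - del (w3 q r s x) - p0 (omega L q r s) x = 0"
    and flat_qqqq: "x \<in> elems S \<Longrightarrow> q \<in> QQ \<Longrightarrow> r \<in> QQ \<Longrightarrow> s \<in> QQ \<Longrightarrow> t \<in> QQ \<Longrightarrow>
      nb q (w3 r s t x) - nb r (w3 q s t x) + nb s (w3 q r t x) - nb t (w3 q r s x)
      - w3 r s t (nb q x) + w3 q s t (nb r x) - w3 q r t (nb s x) + w3 q r s (nb t x)
      - w3 (brk L q r) s t x + w3 (brk L q s) r t x - w3 (brk L q t) r s x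
      - w3 (brk L r s) q t x + w3 (brk L r t) q s x - w3 (brk L s t) q r x
      + w2 q r (w2 s t x) + w2 s t (w2 q r x) - w2 q s (w2 r t x) - w2 r t (w2 q s x) + w2 q t (w2 r s x) + w2 r s (w2 q t x)
      + p1 (omega L r s t) q x - p1 (omega L q s t) r x + p1 (omega L q r t) s x - p1 (omega L q r s) t x = 0"
    and flat_b: "x \<in> elems S \<Longrightarrow> b \<in> BD \<Longrightarrow> p0 b (del x) + del (p0 b x) + nb (ell L b) x = 0"
    and flat_qb: "x \<in> elems S \<Longrightarrow> q \<in> QQ \<Longrightarrow> b \<in> BD \<Longrightarrow>
      nb q (p0 b x) - p0 b (nb q x) - p0 (nabBd L q b) x - w2 q (ell L b) x + p1 b q (del x) - del (p1 b q x) = 0"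
    and flat_qqb: "x \<in> elems S \<Longrightarrow> q \<in> QQ \<Longrightarrow> r \<in> QQ \<Longrightarrow> b \<in> BD \<Longrightarrow>
      nb q (p1 b r x) - nb r (p1 b q x) - p1 b r (nb q x) + p1 b q (nb r x) - p1 b (brk L q r) x
      - p1 (nabBd L q b) r x + p1 (nabBd L r b) q x
      + w2 q r (p0 b x) + p0 b (w2 q r x) + w3 q r (ell L b) x = 0"
    and flat_bb: "x \<in> elems S \<Longrightarrow> b \<in> BD \<Longrightarrow> c \<in> BD \<Longrightarrow>
      p0 b (p0 c x) + p0 c (p0 b x) + p1 c (ell L b) x + p1 b (ell L c) x = 0"
begin

text \<open>From here to \<open>curv_bb\<close> the contraction part vanishes for reasons of degree
  or by one axiom: Jacobi up to \<open>\<ell>\<close> for qqq, \<open>axiom_v\<close> for qqqq,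
  \<open>axiom_ii\<close> for qb, \<open>axiom_iv\<close> for qqb and \<open>axiom_i\<close> for
  bb.\<close>

lemma curv_q: "q \<in> QQ \<Longrightarrow> sbracket 0 1 (ctrQ q rep_symbol) rep_symbol [] [] = 0"
  by (rule V_eq_0[OF sbracketQ_V]) (simp_all add: symbol_eval prod_eq_iff flat_q)

lemma curv_qq: assumes "q \<in> QQ" "r \<in> QQ" shows "sbracket 0 1 (ctrQ q rep_symbol) rep_symbol [r] [] = 0"
proof (rule V_eq_0[OF sbracketQ_V])
  fix x assume x: "x \<in> elems S"
  have "fst (sbracket 0 1 (ctrQ q rep_symbol) rep_symbol [r] []) x =
      nb q (nb r x) - nb r (nb q x) - nb (brk L q r) x + w2 q r (del x) + del (w2 q r x)"
    using assms x by (simp add: symbol_eval algebra_simps)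
  then show "fst (sbracket 0 1 (ctrQ q rep_symbol) rep_symbol [r] []) x = 0" using flat_qq assms x by simp
qed (use assms in \<open>simp_all add: symbol_eval prod_eq_iff\<close>)

lemma curv_qqq: assumes "q \<in> QQ" "r \<in> QQ" "s \<in> QQ" shows "sbracket 0 1 (ctrQ q rep_symbol) rep_symbol [r, s] [] = 0"
proof (rule V_eq_0[OF sbracketQ_V])
  fix x assume x: "x \<in> elems S"
  have "fst (sbracket 0 1 (ctrQ q rep_symbol) rep_symbol [r, s] []) x =
      nb q (w2 r s x) - nb r (w2 q s x) + nb s (w2 q r x) - w2 r s (nb q x) + w2 q s (nb r x) - w2 q r (nb s x)
      - w2 (brk L q r) s x + w2 (brk L q s) r x - w2 (brk L r s) q x
      + w3 q r s (del x) - del (w3 q r s x) - p0 (omega L q r s) x"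
    using assms x by (simp add: symbol_eval arg_move algebra_simps)
  then show "fst (sbracket 0 1 (ctrQ q rep_symbol) rep_symbol [r, s] []) x = 0" using flat_qqq assms x by simp
next
  have "brk L s (brk L q r) = - brk L (brk L q r) s" using assms by (simp add: brk_skew[of s])
  then show "snd (sbracket 0 1 (ctrQ q rep_symbol) rep_symbol [r, s] []) = 0"
    using axiom_iii[OF assms] assms by (simp add: symbol_eval prod_eq_iff) (simp add: algebra_simps eq_neg_iff_add_eq_0)
qed (use assms in simp_all)

lemma curv_qqqq:
  assumes "q \<in> QQ" "r \<in> QQ" "s \<in> QQ" "t \<in> QQ" shows "sbracket 0 1 (ctrQ q rep_symbol) rep_symbol [r, s, t] [] = 0"
proof (rule V_eq_0[OF sbracketQ_V])
  fix x assume x: "x \<in> elems S"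
  have "fst (sbracket 0 1 (ctrQ q rep_symbol) rep_symbol [r, s, t] []) x =
      nb q (w3 r s t x) - nb r (w3 q s t x) + nb s (w3 q r t x) - nb t (w3 q r s x)
      - w3 r s t (nb q x) + w3 q s t (nb r x) - w3 q r t (nb s x) + w3 q r s (nb t x)
      - w3 (brk L q r) s t x + w3 (brk L q s) r t x - w3 (brk L q t) r s x
      - w3 (brk L r s) q t x + w3 (brk L r t) q s x - w3 (brk L s t) q r x
      + w2 q r (w2 s t x) + w2 s t (w2 q r x) - w2 q s (w2 r t x) - w2 r t (w2 q s x) + w2 q t (w2 r s x) + w2 r s (w2 q t x)
      + p1 (omega L r s t) q x - p1 (omega L q s t) r x + p1 (omega L q r t) s x - p1 (omega L q r s) t x"
    using assms x by (simp add: symbol_eval arg_move algebra_simps)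
  then show "fst (sbracket 0 1 (ctrQ q rep_symbol) rep_symbol [r, s, t] []) x = 0" using flat_qqqq assms x by simp
next
  have m: "omega L a b (brk L c d) = omega L (brk L c d) a b" if "a \<in> QQ" "b \<in> QQ" "c \<in> QQ" "d \<in> QQ" for a b c d
    using that om_swap12[of a "brk L c d" b] om_swap23[of a "brk L c d" b] by simp
  have "snd (snd (sbracket 0 1 (ctrQ q rep_symbol) rep_symbol [r, s, t] [])) = - d_omega L q r s t"
    using assms by (simp add: symbol_eval m d_omega_def algebra_simps)
  moreover have "fst (snd (sbracket 0 1 (ctrQ q rep_symbol) rep_symbol [r, s, t] [])) = 0"
    using assms by (simp add: symbol_eval)
  ultimately show "snd (sbracket 0 1 (ctrQ q rep_symbol) rep_symbol [r, s, t] []) = 0"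
    using axiom_v[OF assms] by (simp add: prod_eq_iff)
qed (use assms in simp_all)

lemma curv_qb: assumes "q \<in> QQ" "b \<in> BD" shows "sbracket 0 1 (ctrQ q rep_symbol) rep_symbol [] [b] = 0"
proof (rule V_eq_0[OF sbracketQ_V])
  fix x assume x: "x \<in> elems S"
  have "fst (sbracket 0 1 (ctrQ q rep_symbol) rep_symbol [] [b]) x =
      nb q (p0 b x) - p0 b (nb q x) - p0 (nabBd L q b) x - w2 q (ell L b) x + p1 b q (del x) - del (p1 b q x)"
    using assms x by (simp add: symbol_eval algebra_simps)
  then show "fst (sbracket 0 1 (ctrQ q rep_symbol) rep_symbol [] [b]) x = 0" using flat_qb assms x by simp
qed (use assms axiom_ii in \<open>simp_all add: symbol_eval prod_eq_iff\<close>)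

lemma curv_qqb: assumes "q \<in> QQ" "r \<in> QQ" "b \<in> BD" shows "sbracket 0 1 (ctrQ q rep_symbol) rep_symbol [r] [b] = 0"
proof (rule V_eq_0[OF sbracketQ_V])
  fix x assume x: "x \<in> elems S"
  have "fst (sbracket 0 1 (ctrQ q rep_symbol) rep_symbol [r] [b]) x =
      nb q (p1 b r x) - nb r (p1 b q x) - p1 b r (nb q x) + p1 b q (nb r x) - p1 b (brk L q r) x
      - p1 (nabBd L q b) r x + p1 (nabBd L r b) q x
      + w2 q r (p0 b x) + p0 b (w2 q r x) + w3 q r (ell L b) x"
    using assms x by (simp add: symbol_eval algebra_simps)
  then show "fst (sbracket 0 1 (ctrQ q rep_symbol) rep_symbol [r] [b]) x = 0" using flat_qqb assms x by simp
next
  show "snd (sbracket 0 1 (ctrQ q rep_symbol) rep_symbol [r] [b]) = 0"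
    using axiom_iv[OF assms] assms by (simp add: symbol_eval prod_eq_iff) (simp add: algebra_simps eq_neg_iff_add_eq_0)
qed (use assms in simp_all)

lemma curv_b: assumes "b \<in> BD" shows "sbracket (-1) 1 (ctrB b rep_symbol) rep_symbol [] [] = 0"
  using assms flat_b[OF _ assms] by (intro V_eq_0[OF sbracketB_V]) (simp_all add: symbol_eval prod_eq_iff ac_simps)

lemma curv_bb: assumes "b \<in> BD" "c \<in> BD" shows "sbracket (-1) 1 (ctrB b rep_symbol) rep_symbol [] [c] = 0"
  using assms flat_bb[OF _ assms] axiom_i[OF assms]
  by (intro V_eq_0[OF sbracketB_V]) (simp_all add: symbol_eval prod_eq_iff algebra_simps)

theorem sbracketQ_zero: "q \<in> QQ \<Longrightarrow> secs qs bs \<Longrightarrow> sbracket 0 1 (ctrQ q rep_symbol) rep_symbol qs bs = 0"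
  using sbracketQ_small[of q qs bs]
  by (cases qs rule: list4_cases; cases bs rule: list2_cases)
    (simp_all add: curv_q curv_qq curv_qqq curv_qqqq curv_qb curv_qqb del: sbracket_simps)

theorem sbracketB_zero: "b \<in> BD \<Longrightarrow> set bs \<subseteq> BD \<Longrightarrow> sbracket (-1) 1 (ctrB b rep_symbol) rep_symbol [] bs = 0"
  using sbracketB_small[of b "[]" bs]
  by (cases bs rule: list2_cases) (simp_all add: curv_b curv_bb secs_def del: sbracket_simps)

lemma rep_op_square: assumes "\<eta> \<in> forms L S" shows "rep_op (rep_op \<eta>) = 0"
proof -
  have "symb_op 1 rep_symbol (rep_op \<eta>) qs bs = 0" if "secs qs bs" for qs bs
  proof -
    have "symb_op 1 rep_symbol (rep_op \<eta>) qs bs = symb_op 1 rep_symbol (symb_op 1 rep_symbol \<eta>) qs bs"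
      using that mform_rep_symbol by (intro symb_op_cong) (simp_all add: mform_symv rep_op_apply)
    also have "\<dots> = 0"
      by (rule symb_op_square_zero[OF symbol_rep_symbol forms_mform[OF assms] that])
        (simp_all add: sbracketQ_zero sbracketB_zero rep_symbol_simps op_in flat_del)
    finally show ?thesis .
  qed
  then show ?thesis by (simp add: fun_eq_iff rep_op_apply zero_fun_apply)
qed

end

section \<open>The homological vector field\<close>

text \<open>Functions sit in degree 0 and are differentiated by the anchor. Flatness asks that the
  anchor preserve brackets and, on a section of \<open>B\<^sup>*\<close>, that it vanish on the
  image of \<open>\<ell>\<close>, which is \<open>rho_ell\<close>; the other equations are
  trivial.\<close>

lemma (in split_lie2) functions_flat:
  "flat_rep_data L (smooth_funs (base L)) (funs_grading L) (\<lambda>_. 0) (\<lambda>q. anchor L q)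
     (\<lambda>_ _ _. 0) (\<lambda>_ _ _ _. 0) (\<lambda>_ _. 0) (\<lambda>_ _ _. 0)"
proof unfold_locales
  show "\<exists>a\<in>funs_grading L (- 2). \<exists>b\<in>funs_grading L (- 1). \<exists>c\<in>funs_grading L 0. x = a + b + c" if "x \<in> Fs" for x
    using that by (simp add: funs_grading_def Cinf_eq)
  show "subgrp (funs_grading L i)" for i
    using Fs_sub by (auto simp: funs_grading_def Cinf_eq subgrp_def)
qed (use Fs_sub in \<open>auto simp: funs_grading_def Cinf_eq op_apply algebra_simps split: if_splits\<close>)

text \<open>Each argument ends up in one of the two factors, so a single bad argument kills every
  summand.\<close>

lemma form_mult_outside:
  assumes "\<And>qs bs. \<not> (set qs \<subseteq> A \<and> set bs \<subseteq> B) \<Longrightarrow> \<xi> qs bs = 0"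
    and "\<And>qs bs. \<not> (set qs \<subseteq> A \<and> set bs \<subseteq> B) \<Longrightarrow> \<eta> qs bs = 0"
    and "\<And>x. scl S 0 x = 0" "\<And>f. scl S f 0 = 0" "\<not> (set qs \<subseteq> A \<and> set bs \<subseteq> B)"
  shows "form_mult S \<xi> \<eta> qs bs = 0"
proof -
  have part: "set xs \<subseteq> set (nths xs I) \<union> set (nths xs (- I))" for xs :: "'z list" and I
  proof
    fix x assume "x \<in> set xs"
    then obtain i where "i < length xs" "x = xs ! i" by (auto simp: in_set_conv_nth)
    then show "x \<in> set (nths xs I) \<union> set (nths xs (- I))" by (cases "i \<in> I") (auto simp: set_nths)
  qed
  have "scl S (\<xi> (nths qs I) (nths bs J)) (\<eta> (nths qs (- I)) (nths bs (- J))) = 0" for I J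
  proof -
    have "\<not> (set (nths qs I) \<subseteq> A \<and> set (nths bs J) \<subseteq> B) \<or> \<not> (set (nths qs (- I)) \<subseteq> A \<and> set (nths bs (- J)) \<subseteq> B)"
      using part[of qs I] part[of bs J] assms(5) by blast
    then show ?thesis using assms(1-4) by metis
  qed
  then show ?thesis by (simp add: form_mult_def signed_simps)
qed

context rep_data
begin

interpretation R: flat_rep_data L "smooth_funs (base L)" "funs_grading L" "\<lambda>_. 0" "\<lambda>q. anchor L q"
    "\<lambda>_ _ _. 0" "\<lambda>_ _ _ _. 0" "\<lambda>_ _. 0" "\<lambda>_ _ _. 0"
  by (rule functions_flat)

interpretation leibniz_calculus QQ BD S G Fs "funs_grading L"
  by unfold_locales (auto simp: S_scl S_addL S_addR funs_grading_def)

lemma rep_op_form_mult: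
  assumes \<xi>: "\<xi> \<in> hom_forms L (smooth_funs (base L)) (funs_grading L) i" and \<eta>: "\<eta> \<in> forms L S"
  shows "rep_op (form_mult S \<xi> \<eta>) = form_mult S (R.rep_op \<xi>) \<eta> + signed i (form_mult S \<xi> (rep_op \<eta>))"
proof (intro ext)
  fix qs bs
  have x: "\<xi> \<in> forms L (smooth_funs (base L))" "R.homog i \<xi>" using \<xi> by (auto simp: hom_forms_def R.homog_def)
  have x0: "\<xi> qs bs = 0" if "\<not> secs qs bs" for qs bs using that x(1) by (simp add: R.forms_iff)
  have e0: "\<eta> qs bs = 0" if "\<not> secs qs bs" for qs bs using that \<eta> by (simp add: forms_iff)
  show "rep_op (form_mult S \<xi> \<eta>) qs bs = (form_mult S (R.rep_op \<xi>) \<eta> + signed i (form_mult S \<xi> (rep_op \<eta>))) qs bs"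
  proof (cases "secs qs bs")
    case True
    \<comment> \<open>Both symbols contain the brackets of the same algebroid. On coefficients only
      \<open>nb\<close> has a Leibniz term, and its derivation is the anchor.\<close>
    have c: "compat rep_symbol R.rep_symbol"
      unfolding compat_def
    proof (intro allI impI conjI ballI)
      fix qs bs f x assume s: "secs qs bs" and f: "f \<in> Fs" "x \<in> elems S"
      show "fst (rep_symbol qs bs) (scl S f x) = scl S (fst (R.rep_symbol qs bs) f) x + scl S f (fst (rep_symbol qs bs) x)"
        using s f by (cases qs rule: list4_cases; cases bs rule: list2_cases)
          (simp_all add: rep_symbol_def R.rep_symbol_def S_scl op_scl sE_zero)
    qed (simp add: rep_symbol_def R.rep_symbol_def)
    have "rep_op (form_mult S \<xi> \<eta>) qs bs = symb_op 1 rep_symbol (form_mult S \<xi> \<eta>) qs bs"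
      using True by (simp add: rep_op_apply)
    also have "\<dots> = form_mult S (symb_op 1 R.rep_symbol \<xi>) \<eta> qs bs + signed (1 * i) (form_mult S \<xi> (symb_op 1 rep_symbol \<eta>) qs bs)"
      by (rule symb_op_form_mult[OF symbol_rep_symbol R.symbol_rep_symbol c x(2) R.forms_mform[OF x(1)] mform_valued[OF forms_mform[OF \<eta>]] True])
    also have "form_mult S (symb_op 1 R.rep_symbol \<xi>) \<eta> qs bs = form_mult S (R.rep_op \<xi>) \<eta> qs bs"
      by (rule form_mult_cong[OF _ _ True]) (simp_all add: R.rep_op_apply)
    also have "form_mult S \<xi> (symb_op 1 rep_symbol \<eta>) qs bs = form_mult S \<xi> (rep_op \<eta>) qs bs"
      by (rule form_mult_cong[OF _ _ True]) (simp_all add: rep_op_apply)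
    finally show ?thesis by (simp add: plus_fun_apply signed_fun)
  next
    case False
    have f: "\<not> (set qs \<subseteq> QQ \<and> set bs \<subseteq> BD)" using False by (simp add: secs_def)
    have z: "scl S 0 x = 0" "scl S f 0 = 0" for f x by (simp_all add: sE_zero)
    have "form_mult S (R.rep_op \<xi>) \<eta> qs bs = 0"
      by (rule form_mult_outside[OF _ _ z f]) (simp_all add: R.rep_op_apply e0 secs_def[symmetric])
    moreover have "form_mult S \<xi> (rep_op \<eta>) qs bs = 0"
      by (rule form_mult_outside[OF _ _ z f]) (simp_all add: rep_op_apply x0 secs_def[symmetric])
    ultimately have "form_mult S (R.rep_op \<xi>) \<eta> qs bs = 0" "form_mult S \<xi> (rep_op \<eta>) qs bs = 0" .
    then show ?thesis using False by (simp add: rep_op_apply plus_fun_apply signed_fun signed_simps)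
  qed
qed

theorem rep_op_derivation: "degree_one_derivation L S G R.rep_op rep_op"
  unfolding degree_one_derivation_def Cinf_eq using rep_op_hom rep_op_add rep_op_form_mult by blast

end

context split_lie2
begin

interpretation R: flat_rep_data L "smooth_funs (base L)" "funs_grading L" "\<lambda>_. 0" "\<lambda>q. anchor L q"
    "\<lambda>_ _ _. 0" "\<lambda>_ _ _ _. 0" "\<lambda>_ _. 0" "\<lambda>_ _ _. 0"
  by (rule functions_flat)

text \<open>Confines the image of a generator to two arities: (2, 0) and (0, 1) for a section of
  \<open>Q\<^sup>*\<close>, (3, 0) and (1, 1) for a section of \<open>B\<close>.\<close>

lemma hom_funs_zero:
  assumes "\<eta> \<in> hom_forms L S (funs_grading L) j" "int (length qs) + 2 * int (length bs) \<noteq> j"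
  shows "\<eta> qs bs = 0"
proof -
  have "\<eta> qs bs \<in> funs_grading L (j - int (length qs) - 2 * int (length bs))"
    using assms(1) unfolding hom_forms_def by blast
  then show ?thesis using assms(2) by (simp add: funs_grading_def)
qed

lemma on_sections_apply: "on_sections L g qs bs = (if R.secs qs bs then g qs bs else 0)"
  by (simp add: on_sections_def R.secs_def)

lemma Q_on_dual_section:
  assumes \<tau>: "\<tau> \<in> elems (dual_module (base L) (secQ L))"
  shows "R.rep_op (on_sections L (\<lambda>qs bs. case (qs, bs) of ([q], []) \<Rightarrow> \<tau> q | _ \<Rightarrow> 0)) =
          on_sections L (\<lambda>qs bs. case (qs, bs) of
              ([q1, q2], []) \<Rightarrow> anchor L q1 (\<tau> q2) - anchor L q2 (\<tau> q1) - \<tau> (brk L q1 q2)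
            | ([], [\<beta>]) \<Rightarrow> \<tau> (ell L \<beta>)
            | _ \<Rightarrow> 0)" (is "R.rep_op (on_sections L ?g) = on_sections L ?h")
proof -
  have t': "\<tau> q \<in> Fs" if "q \<in> QQ" for q
    using \<tau> that by (auto simp: dual_module_def linear_over_def)
  have t: "\<tau> (q + r) = \<tau> q + \<tau> r" "f \<in> Fs \<Longrightarrow> \<tau> (pscale f q) = f * \<tau> q" if "q \<in> QQ" "r \<in> QQ" for q r f
    using \<tau> that by (auto simp: dual_module_def linear_over_def)
  have t0: "\<tau> 0 = 0" "q \<in> QQ \<Longrightarrow> \<tau> (- q) = - \<tau> q" for q
    using additive_on_zero[OF sub(1), of \<tau>] additive_on_neg[OF sub(1), of \<tau> q] t by auto
  note t = t t'
  have m: "R.mform Fs ?g"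
    unfolding str_form_dual by (rule R.mform_str_form[OF Fs_sub]) (simp_all add: t)
  have l: "R.tensorial ?g"
    unfolding R.tensorial_def
  proof (intro conjI allI impI ballI)
    fix f qs q qs' bs assume "f \<in> Fs" "R.secs (qs @ q # qs') bs"
    then show "?g (qs @ pscale f q # qs') bs = scl (smooth_funs (base L)) f (?g (qs @ q # qs') bs)"
      using t by (cases qs rule: list2_cases; cases qs'; cases bs) simp_all
  next
    fix f qs bs b bs' assume "f \<in> Fs" "R.secs qs (bs @ b # bs')"
    then show "?g qs (bs @ fscale f b # bs') = scl (smooth_funs (base L)) f (?g qs (bs @ b # bs'))"
      by (cases qs rule: list2_cases; cases bs) simp_all
  qed
  have "R.supported 1 (on_sections L ?g)"
    unfolding R.supported_def
  proof (intro allI impI)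
    fix qs bs assume "R.secs qs bs" "1 < int (length qs + length bs)"
    then show "on_sections L ?g qs bs = 0"
      by (cases qs rule: list2_cases; cases bs) (simp_all add: on_sections_apply)
  qed
  then have f: "on_sections L ?g \<in> forms L (smooth_funs (base L))"
    unfolding R.forms_iff using R.mform_cong[OF m, of "on_sections L ?g"] R.tensorial_cong[OF l, of "on_sections L ?g"]
    by (auto simp: on_sections_apply)
  have h: "on_sections L ?g \<in> hom_forms L (smooth_funs (base L)) (funs_grading L) 1"
    unfolding hom_forms_def mem_Collect_eq
  proof (intro conjI allI f)
    fix qs bs show "on_sections L ?g qs bs \<in> funs_grading L (1 - int (length qs) - 2 * int (length bs))"
      using t by (cases qs rule: list2_cases; cases bs) (simp_all add: on_sections_apply funs_grading_def Cinf_eq)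
  qed
  have z: "R.rep_op (on_sections L ?g) qs bs = 0" if "int (length qs) + 2 * int (length bs) \<noteq> 2" for qs bs
    using hom_funs_zero[OF R.rep_op_hom[OF h]] that by simp
  show ?thesis
  proof (rule ext, rule ext)
    fix qs bs
    show "R.rep_op (on_sections L ?g) qs bs = on_sections L ?h qs bs"
    proof (cases "R.secs qs bs")
      case True
      then show ?thesis
        using z[of qs bs] t t0
        by (cases qs rule: list4_cases; cases bs rule: list2_cases)
          (simp_all add: on_sections_apply R.rep_op_apply R.rep_symbol_def ctr_apply signed_def act_def algebra_simps)
    qed (simp add: R.rep_op_apply on_sections_apply)
  qed
qed

lemma Q_on_section:
  assumes b: "c \<in> BB"
  shows "R.rep_op (on_sections L (\<lambda>qs bs. case (qs, bs) of ([], [\<beta>]) \<Rightarrow> \<beta> c | _ \<Rightarrow> 0)) =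
          on_sections L (\<lambda>qs bs. case (qs, bs) of
              ([q], [\<beta>]) \<Rightarrow> \<beta> (nabB L q c)
            | ([q1, q2, q3], []) \<Rightarrow> - omega L q1 q2 q3 c
            | _ \<Rightarrow> 0)" (is "R.rep_op (on_sections L ?g) = on_sections L ?h")
proof -
  have m: "R.mform Fs ?g"
    unfolding str_form_dual by (rule R.mform_str_form[OF Fs_sub]) (simp_all add: b op_apply)
  have l: "R.tensorial ?g"
    unfolding R.tensorial_def
  proof (intro conjI allI impI ballI)
    fix f qs q qs' bs assume "f \<in> Fs" "R.secs (qs @ q # qs') bs"
    then show "?g (qs @ pscale f q # qs') bs = scl (smooth_funs (base L)) f (?g (qs @ q # qs') bs)"
      by (cases bs rule: list2_cases; cases qs) simp_all
  next
    fix f qs bs b bs' assume "f \<in> Fs" "R.secs qs (bs @ b # bs')"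
    then show "?g qs (bs @ fscale f b # bs') = scl (smooth_funs (base L)) f (?g qs (bs @ b # bs'))"
      by (cases bs rule: list2_cases; cases bs'; cases qs) (simp_all add: op_apply)
  qed
  have "R.supported 1 (on_sections L ?g)"
    unfolding R.supported_def
  proof (intro allI impI)
    fix qs bs assume "R.secs qs bs" "1 < int (length qs + length bs)"
    then show "on_sections L ?g qs bs = 0"
      by (cases bs rule: list2_cases; cases qs) (simp_all add: on_sections_apply)
  qed
  then have f: "on_sections L ?g \<in> forms L (smooth_funs (base L))"
    unfolding R.forms_iff using R.mform_cong[OF m, of "on_sections L ?g"] R.tensorial_cong[OF l, of "on_sections L ?g"]
    by (auto simp: on_sections_apply)
  have h: "on_sections L ?g \<in> hom_forms L (smooth_funs (base L)) (funs_grading L) 2"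
    unfolding hom_forms_def mem_Collect_eq
  proof (intro conjI allI f)
    fix qs bs show "on_sections L ?g qs bs \<in> funs_grading L (2 - int (length qs) - 2 * int (length bs))"
      using b by (cases bs rule: list2_cases; cases qs) (simp_all add: on_sections_apply funs_grading_def Cinf_eq)
  qed
  have z: "R.rep_op (on_sections L ?g) qs bs = 0" if "int (length qs) + 2 * int (length bs) \<noteq> 3" for qs bs
    using hom_funs_zero[OF R.rep_op_hom[OF h]] that by simp
  \<comment> \<open>The symbol contains the dual connection \<open>nabBd\<close>, while the value to
    be matched is written with \<open>nabB\<close>.\<close>
  have v: "\<beta> (nabB L q c) = anchor L q (\<beta> c) - nabBd L q \<beta> c" for q \<beta>
    using b by (simp add: nabBd_apply)
  show ?thesis
  proof (rule ext, rule ext)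
    fix qs bs
    show "R.rep_op (on_sections L ?g) qs bs = on_sections L ?h qs bs"
    proof (cases "R.secs qs bs")
      case True
      then show ?thesis
        using z[of qs bs] b
        by (cases qs rule: list4_cases; cases bs rule: list2_cases)
          (simp_all add: on_sections_apply R.rep_op_apply R.rep_symbol_def ctr_apply signed_def act_def op_apply v algebra_simps)
    qed (simp add: R.rep_op_apply on_sections_apply)
  qed
qed

theorem homological: "homological_vector_field L R.rep_op"
  unfolding homological_vector_field_def
proof (intro conjI ballI)
  show "degree_one_derivation L (Cinf L) (funs_grading L) R.rep_op R.rep_op"
    using R.rep_op_derivation by (simp add: Cinf_eq)
  show "R.rep_op (R.rep_op \<xi>) = 0" if "\<xi> \<in> forms L (Cinf L)" for \<xi>
    using R.rep_op_square that by (simp add: Cinf_eq)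
  show "R.rep_op (const_form f) = on_sections L (\<lambda>qs bs. case (qs, bs) of ([q], []) \<Rightarrow> anchor L q f | _ \<Rightarrow> 0)"
    if "f \<in> elems (Cinf L)" for f
  proof -
    have "str_form (\<lambda>_. 0) (\<lambda>q. anchor L q) (\<lambda>_ _ _. 0) (\<lambda>_ _ _ _. 0) (\<lambda>_ _. 0) (\<lambda>_ _ _. 0) f qs bs
      = (case (qs, bs) of ([q], []) \<Rightarrow> anchor L q f | _ \<Rightarrow> 0)" for qs :: "('m \<Rightarrow> 'q) list" and bs :: "('m, 'b) dsection list"
      by (cases qs rule: list4_cases; cases bs rule: list2_cases) simp_all
    then show ?thesis using R.rep_op_const that by (simp add: Cinf_eq on_sections_def fun_eq_iff)
  qed
qed (use Q_on_dual_section Q_on_section in simp_all)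

end

section \<open>The adjoint representation\<close>

locale adjoint_data = split_lie2 L
  for L :: "('m::{t2_space,second_countable_topology}, 'q::real_vector, 'b::real_vector) split_data" +
  fixes nQ :: "'m vfield \<Rightarrow> ('m \<Rightarrow> 'q) \<Rightarrow> ('m \<Rightarrow> 'q)"
    and nB :: "'m vfield \<Rightarrow> ('m, 'b) dsection \<Rightarrow> ('m, 'b) dsection"
  assumes connQ: "TM_connection (base L) (secQ L) nQ"
    and connBd: "TM_connection (base L) (secBd L) nB"
begin

lemma nQ_closed [simp]: "X \<in> XX \<Longrightarrow> q \<in> QQ \<Longrightarrow> nQ X q \<in> QQ"
  and nQ_addL [simp]: "X \<in> XX \<Longrightarrow> Y \<in> XX \<Longrightarrow> q \<in> QQ \<Longrightarrow> nQ (X + Y) q = nQ X q + nQ Y q"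
  and nQ_addR [simp]: "X \<in> XX \<Longrightarrow> q \<in> QQ \<Longrightarrow> r \<in> QQ \<Longrightarrow> nQ X (q + r) = nQ X q + nQ X r"
  and nQ_scaleL [simp]: "f \<in> Fs \<Longrightarrow> X \<in> XX \<Longrightarrow> q \<in> QQ \<Longrightarrow> nQ (fscale f X) q = pscale f (nQ X q)"
  and nQ_scaleR [simp]: "f \<in> Fs \<Longrightarrow> X \<in> XX \<Longrightarrow> q \<in> QQ \<Longrightarrow> nQ X (pscale f q) = pscale f (nQ X q) + pscale (X f) q"
  using connQ unfolding connection_def linear_over_def scl_eqs by blast+

lemma nB_closed [simp]: "X \<in> XX \<Longrightarrow> b \<in> BD \<Longrightarrow> nB X b \<in> BD"
  and nB_addL [simp]: "X \<in> XX \<Longrightarrow> Y \<in> XX \<Longrightarrow> b \<in> BD \<Longrightarrow> nB (X + Y) b = nB X b + nB Y b"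
  and nB_addR [simp]: "X \<in> XX \<Longrightarrow> b \<in> BD \<Longrightarrow> c \<in> BD \<Longrightarrow> nB X (b + c) = nB X b + nB X c"
  and nB_scaleL [simp]: "f \<in> Fs \<Longrightarrow> X \<in> XX \<Longrightarrow> b \<in> BD \<Longrightarrow> nB (fscale f X) b = fscale f (nB X b)"
  and nB_scaleR [simp]: "f \<in> Fs \<Longrightarrow> X \<in> XX \<Longrightarrow> b \<in> BD \<Longrightarrow> nB X (fscale f b) = fscale f (nB X b) + fscale (X f) b"
  using connBd unfolding connection_def linear_over_def scl_eqs by blast+

lemma nQ_simps [simp]:
  "X \<in> XX \<Longrightarrow> nQ X 0 = 0"
  "X \<in> XX \<Longrightarrow> q \<in> QQ \<Longrightarrow> nQ X (- q) = - nQ X q"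
  "X \<in> XX \<Longrightarrow> q \<in> QQ \<Longrightarrow> r \<in> QQ \<Longrightarrow> nQ X (q - r) = nQ X q - nQ X r"
  "q \<in> QQ \<Longrightarrow> nQ 0 q = 0"
  "X \<in> XX \<Longrightarrow> q \<in> QQ \<Longrightarrow> nQ (- X) q = - nQ X q"
  "X \<in> XX \<Longrightarrow> Y \<in> XX \<Longrightarrow> q \<in> QQ \<Longrightarrow> nQ (X - Y) q = nQ X q - nQ Y q"
  by (rule additive_on[OF sub(1), of "nQ X"] additive_on[OF XX_sub, of "\<lambda>X. nQ X q"]; simp)+

lemma nB_simps [simp]:
  "X \<in> XX \<Longrightarrow> nB X 0 = 0"
  "X \<in> XX \<Longrightarrow> b \<in> BD \<Longrightarrow> nB X (- b) = - nB X b"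
  "X \<in> XX \<Longrightarrow> b \<in> BD \<Longrightarrow> c \<in> BD \<Longrightarrow> nB X (b - c) = nB X b - nB X c"
  "b \<in> BD \<Longrightarrow> nB 0 b = 0"
  "X \<in> XX \<Longrightarrow> b \<in> BD \<Longrightarrow> nB (- X) b = - nB X b"
  "X \<in> XX \<Longrightarrow> Y \<in> XX \<Longrightarrow> b \<in> BD \<Longrightarrow> nB (X - Y) b = nB X b - nB Y b"
  by (rule additive_on[OF sub(3), of "nB X"] additive_on[OF XX_sub, of "\<lambda>X. nB X b"]; simp)+

section \<open>Basic connections, basic curvature and the mixed curvature terms\<close>

abbreviation "nY \<equiv> nab_bas_TM L nQ"

lemma nY_closed [simp]: "q \<in> QQ \<Longrightarrow> X \<in> XX \<Longrightarrow> nY q X \<in> XX"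
  and nY_addL [simp]: "q \<in> QQ \<Longrightarrow> r \<in> QQ \<Longrightarrow> X \<in> XX \<Longrightarrow> nY (q + r) X = nY q X + nY r X"
  and nY_addR [simp]: "q \<in> QQ \<Longrightarrow> X \<in> XX \<Longrightarrow> Y \<in> XX \<Longrightarrow> nY q (X + Y) = nY q X + nY q Y"
  and nY_scaleL [simp]: "f \<in> Fs \<Longrightarrow> q \<in> QQ \<Longrightarrow> X \<in> XX \<Longrightarrow> nY (pscale f q) X = fscale f (nY q X)"
  and nY_scaleR [simp]: "f \<in> Fs \<Longrightarrow> q \<in> QQ \<Longrightarrow> X \<in> XX \<Longrightarrow> nY q (fscale f X) = fscale f (nY q X) + fscale (anchor L q f) X"
  by (simp_all add: nab_bas_TM_def fscale_algebra algebra_simps)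

lemma nY_simps [simp]:
  "q \<in> QQ \<Longrightarrow> nY q 0 = 0"
  "q \<in> QQ \<Longrightarrow> X \<in> XX \<Longrightarrow> nY q (- X) = - nY q X"
  "q \<in> QQ \<Longrightarrow> X \<in> XX \<Longrightarrow> Y \<in> XX \<Longrightarrow> nY q (X - Y) = nY q X - nY q Y"
  by (rule additive_on[OF XX_sub, of "nY q"]; simp)+

lemma nY_apply: "nY q X f = anchor L q (X f) - X (anchor L q f) + anchor L (nQ X q) f"
  by (simp add: nab_bas_TM_def op_apply)

lemma nY_rho: "q \<in> QQ \<Longrightarrow> r \<in> QQ \<Longrightarrow> nY q (anchor L r) = lie_bracket (anchor L q) (anchor L r) + anchor L (nQ (anchor L r) q)"
  by (simp add: nab_bas_TM_def)

text \<open>The bracket term disappears because the anchor vanishes on the image of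
  \<open>\<ell>\<close>.\<close>

lemma nY_ell [simp]: "b \<in> BD \<Longrightarrow> X \<in> XX \<Longrightarrow> nY (ell L b) X = anchor L (nQ X (ell L b))"
  by (simp add: nab_bas_TM_def) (simp add: lie_bracket_def fun_eq_iff op_apply)

definition "Rbas = R_bas L nQ"

lemma Rbas_closed [simp]: "q \<in> QQ \<Longrightarrow> r \<in> QQ \<Longrightarrow> X \<in> XX \<Longrightarrow> Rbas q r X \<in> QQ"
  by (simp add: Rbas_def R_bas_def)

text \<open>The derivative terms of the bracket, of \<open>nQ\<close> and of \<open>nY\<close>
  cancel, which makes the basic curvature a tensor.\<close>

lemma Rbas_add [simp]:
  "q \<in> QQ \<Longrightarrow> q' \<in> QQ \<Longrightarrow> r \<in> QQ \<Longrightarrow> X \<in> XX \<Longrightarrow> Rbas (q + q') r X = Rbas q r X + Rbas q' r X"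
  "q \<in> QQ \<Longrightarrow> r \<in> QQ \<Longrightarrow> X \<in> XX \<Longrightarrow> Y \<in> XX \<Longrightarrow> Rbas q r (X + Y) = Rbas q r X + Rbas q r Y"
  "q \<in> QQ \<Longrightarrow> r \<in> QQ \<Longrightarrow> X \<in> XX \<Longrightarrow> f \<in> Fs \<Longrightarrow> Rbas (pscale f q) r X = pscale f (Rbas q r X)"
  "q \<in> QQ \<Longrightarrow> r \<in> QQ \<Longrightarrow> X \<in> XX \<Longrightarrow> f \<in> Fs \<Longrightarrow> Rbas q r (fscale f X) = pscale f (Rbas q r X)"
  by (simp_all add: Rbas_def R_bas_def nY_apply pscale_algebra algebra_simps)

lemma Rbas_skew: "q \<in> QQ \<Longrightarrow> r \<in> QQ \<Longrightarrow> X \<in> XX \<Longrightarrow> Rbas r q X = - Rbas q r X"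
  using brk_skew[of r q] brk_skew[of "nQ X r" q] brk_skew[of r "nQ X q"]
  by (simp add: Rbas_def R_bas_def algebra_simps)

definition "nabOm X q r s = nab_omega L nQ nB X q r s"

lemma nabOm_closed [simp]: "q \<in> QQ \<Longrightarrow> r \<in> QQ \<Longrightarrow> s \<in> QQ \<Longrightarrow> X \<in> XX \<Longrightarrow> nabOm X q r s \<in> BD"
  by (simp add: nabOm_def nab_omega_def)

lemma nabOm_add [simp]:
  assumes [simp]: "q \<in> QQ" "r \<in> QQ" "s \<in> QQ" "X \<in> XX"
  shows "q' \<in> QQ \<Longrightarrow> nabOm X (q + q') r s = nabOm X q r s + nabOm X q' r s"
    "Y \<in> XX \<Longrightarrow> nabOm (X + Y) q r s = nabOm X q r s + nabOm Y q r s"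
    "f \<in> Fs \<Longrightarrow> nabOm X (pscale f q) r s = fscale f (nabOm X q r s)"
    "f \<in> Fs \<Longrightarrow> nabOm (fscale f X) q r s = fscale f (nabOm X q r s)"
  by (simp_all add: nabOm_def nab_omega_def fscale_algebra algebra_simps)

lemma nabOm_skew:
  assumes [simp]: "q \<in> QQ" "r \<in> QQ" "s \<in> QQ" "X \<in> XX"
  shows "nabOm X r q s = - nabOm X q r s" "nabOm X q s r = - nabOm X q r s"
  using om_swap12[of q r s] om_swap12[of "nQ X q" r s] om_swap12[of q "nQ X r" s] om_swap12[of q r "nQ X s"]
    om_swap23[of q r s] om_swap23[of "nQ X q" r s] om_swap23[of q "nQ X r" s] om_swap23[of q r "nQ X s"]
  by (simp_all add: nabOm_def nab_omega_def algebra_simps)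

text \<open>The mixed curvature of \<open>nB\<close> against the dual \<open>Q\<close>-connection,
  corrected by \<open>nQ\<close> and \<open>nY\<close> in place of a bracket of \<open>q\<close> and
  \<open>X\<close> so that it becomes linear over functions in every argument.\<close>

definition "phi1B b q X = nB X (nabBd L q b) - nabBd L q (nB X b) - nabBd L (nQ X q) b + nB (nY q X) b"

lemma phi1B_closed [simp]: "b \<in> BD \<Longrightarrow> q \<in> QQ \<Longrightarrow> X \<in> XX \<Longrightarrow> phi1B b q X \<in> BD"
  by (simp add: phi1B_def)

lemma phi1B_add [simp]:
  assumes [simp]: "q \<in> QQ" "X \<in> XX" "b \<in> BD"
  shows "q' \<in> QQ \<Longrightarrow> phi1B b (q + q') X = phi1B b q X + phi1B b q' X" "c \<in> BD \<Longrightarrow> phi1B (b + c) q X = phi1B b q X + phi1B c q X"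
    "Y \<in> XX \<Longrightarrow> phi1B b q (X + Y) = phi1B b q X + phi1B b q Y"
    "f \<in> Fs \<Longrightarrow> phi1B b (pscale f q) X = fscale f (phi1B b q X)" "f \<in> Fs \<Longrightarrow> phi1B (fscale f b) q X = fscale f (phi1B b q X)"
    "f \<in> Fs \<Longrightarrow> phi1B b q (fscale f X) = fscale f (phi1B b q X)"
  by (simp_all add: phi1B_def fscale_algebra nY_apply algebra_simps)

section \<open>Identities behind the flatness of the adjoint structure objects\<close>

abbreviation "nbas \<equiv> nab_bas L nQ"

lemma nbas_closed [simp]: "q \<in> QQ \<Longrightarrow> r \<in> QQ \<Longrightarrow> nbas q r \<in> QQ"
  by (simp add: nab_bas_def)

text \<open>This and the next two lemmas fix a direction of rewriting: an \<open>\<omega>\<close>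
  that meets \<open>\<ell>\<close> is eliminated in favour of brackets and connections, after which
  the terms cancel by additivity.\<close>

lemma ell_om:
  "q \<in> QQ \<Longrightarrow> r \<in> QQ \<Longrightarrow> s \<in> QQ \<Longrightarrow>
    ell L (omega L q r s) = brk L (brk L q r) s + brk L r (brk L q s) - brk L q (brk L r s)"
  using axiom_iii[of q r s] by (simp add: algebra_simps eq_neg_iff_add_eq_0 minus_equation_iff)

lemma om_ell:
  "q \<in> QQ \<Longrightarrow> r \<in> QQ \<Longrightarrow> b \<in> BD \<Longrightarrow>
    omega L q r (ell L b) = nabBd L (brk L q r) b - nabBd L q (nabBd L r b) + nabBd L r (nabBd L q b)"
  using axiom_iv[of q r b] by (simp add: algebra_simps eq_neg_iff_add_eq_0)

lemma ell_nab: "q \<in> QQ \<Longrightarrow> b \<in> BD \<Longrightarrow> ell L (nabBd L q b) = brk L q (ell L b)"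
  by (simp add: axiom_ii)

lemma rho_nbas: "q \<in> QQ \<Longrightarrow> r \<in> QQ \<Longrightarrow> anchor L (nbas q r) = nY q (anchor L r)"
  by (simp add: nab_bas_def nY_rho)

text \<open>Apart from unfolding, this is the Jacobi identity for the vector fields
  \<open>\<rho>(q)\<close>, \<open>\<rho>(r)\<close> and \<open>X\<close>.\<close>

lemma bas_curvature_TM:
  assumes [simp]: "q \<in> QQ" "r \<in> QQ" "X \<in> XX"
  shows "anchor L (Rbas q r X) = nY q (nY r X) - nY r (nY q X) - nY (brk L q r) X"
proof -
  have y: "nY q Z = lie_bracket (anchor L q) Z + anchor L (nQ Z q)" for q Z
    by (simp add: nab_bas_TM_def)
  have "lie_bracket (anchor L (nQ X q)) (anchor L r) = - lie_bracket (anchor L r) (anchor L (nQ X q))"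
    by (rule lie_bracket_skew)
  then show ?thesis
    using lie_bracket_jacobi[of "anchor L q" "anchor L r" X]
    unfolding y[of q "nY r X"] y[of r "nY q X"] y[of "brk L q r" X]
    by (simp add: Rbas_def R_bas_def y[of r X] y[of q X] algebra_simps)
qed

text \<open>The dull bracket satisfies Jacobi only up to \<open>\<ell> \<circ> \<omega>\<close>,
  which therefore accompanies the basic curvature.\<close>

lemma bas_curvature_Q:
  assumes [simp]: "q \<in> QQ" "r \<in> QQ" "s \<in> QQ"
  shows "nbas q (nbas r s) - nbas r (nbas q s) - nbas (brk L q r) s - Rbas q r (anchor L s) + ell L (omega L q r s) = 0"
  using brk_skew[of r "nQ (anchor L s) q"]
  by (simp add: nab_bas_def Rbas_def R_bas_def ell_om nY_rho algebra_simps)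

text \<open>Up to sign this is \<open>d_omega L q r s u\<close>: the derivatives along
  \<open>\<rho>(u)\<close> in \<open>nabOm\<close> and in \<open>nbas\<close> cancel.\<close>

lemma qqq_B:
  assumes [simp]: "q \<in> QQ" "r \<in> QQ" "s \<in> QQ" "u \<in> QQ"
  shows "- nabBd L q (omega L r s u) + nabBd L r (omega L q s u) - nabBd L s (omega L q r u)
    + omega L r s (nbas q u) - omega L q s (nbas r u) + omega L q r (nbas s u)
    + omega L (brk L q r) s u - omega L (brk L q s) r u + omega L (brk L r s) q u
    + nabOm (anchor L u) q r s - (nB (anchor L u) (omega L q r s) - nabBd L u (omega L q r s)) = 0"
proof -
  have c: "omega L a b (brk L c d) = omega L (brk L c d) a b" if "a \<in> QQ" "b \<in> QQ" "c \<in> QQ" "d \<in> QQ" for a b c d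
    using that om_swap12[of a "brk L c d" b] om_swap23[of a "brk L c d" b] by simp
  have c': "omega L a b (nQ X c) = omega L (nQ X c) a b" "omega L a (nQ X c) b = - omega L (nQ X c) a b"
    if "a \<in> QQ" "b \<in> QQ" "c \<in> QQ" "X \<in> XX" for a b c X
    using that om_swap12[of a "nQ X c" b] om_swap23[of a "nQ X c" b] by simp_all
  have "- nabBd L q (omega L r s u) + nabBd L r (omega L q s u) - nabBd L s (omega L q r u)
    + omega L r s (nbas q u) - omega L q s (nbas r u) + omega L q r (nbas s u)
    + omega L (brk L q r) s u - omega L (brk L q s) r u + omega L (brk L r s) q u
    + nabOm (anchor L u) q r s - (nB (anchor L u) (omega L q r s) - nabBd L u (omega L q r s)) = - d_omega L q r s u"
    by (simp add: d_omega_def nabOm_def nab_omega_def nab_bas_def c c' algebra_simps)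
  then show ?thesis by (simp add: axiom_v)
qed

text \<open>The Jacobi identity differentiated along \<open>X\<close>. In the last line
  \<open>nB\<close> cancels, leaving \<open>nQ X\<close> of \<open>\<ell>(\<omega>(q, r, s))\<close>
  minus the terms in which one argument is differentiated.\<close>

lemma qqq_Q:
  assumes [simp]: "q \<in> QQ" "r \<in> QQ" "s \<in> QQ" "X \<in> XX"
  shows "- nbas q (Rbas r s X) + nbas r (Rbas q s X) - nbas s (Rbas q r X) + Rbas r s (nY q X) - Rbas q s (nY r X) + Rbas q r (nY s X)
    + Rbas (brk L q r) s X - Rbas (brk L q s) r X + Rbas (brk L r s) q X
    + ell L (nabOm X q r s) - (ell L (nB X (omega L q r s)) - nQ X (ell L (omega L q r s))) = 0"
proof -
  \<comment> \<open>These rules put the arguments of a bracket into a fixed order; requiring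
    \<open>c\<close> to be one of the given sections keeps rewriting from looping.\<close>
  have m: "brk L (nQ Z a) c = - brk L c (nQ Z a)" if "c \<in> {q, r, s}" "a \<in> QQ" "Z \<in> XX" for a c Z
    using that brk_skew[of "nQ Z a" c] by auto
  have m'': "brk L (brk L a b) c = - brk L c (brk L a b)" if "c \<in> {q, r, s}" "a \<in> QQ" "b \<in> QQ" for a b c
    using that brk_skew[of "brk L a b" c] by auto
  have m': "brk L (nQ Z a) (brk L b c) = - brk L (brk L b c) (nQ Z a)"
    if "a \<in> QQ" "b \<in> QQ" "c \<in> QQ" "Z \<in> XX" for a b c Z
    using that brk_skew[of "nQ Z a" "brk L b c"] by simp
  show ?thesis
    \<comment> \<open>The anchor of a basic curvature has to be replaced before \<open>Rbas\<close>
      is unfolded, while it is still recognisable.\<close>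
    by (simp add: nab_bas_def bas_curvature_TM)
      (simp add: nabOm_def nab_omega_def ell_om Rbas_def R_bas_def m m' m'' algebra_simps)
qed

text \<open>The closedness of \<open>\<omega>\<close> differentiated along \<open>X\<close>: the
  whole sum is \<open>nB X\<close> of \<open>d_omega\<close> minus the four terms in which
  \<open>nQ X\<close> hits one argument.\<close>

lemma qqqq_B:
  assumes [simp]: "q \<in> QQ" "r \<in> QQ" "s \<in> QQ" "t \<in> QQ" "X \<in> XX"
  shows "nabBd L q (nabOm X r s t) - nabBd L r (nabOm X q s t) + nabBd L s (nabOm X q r t) - nabBd L t (nabOm X q r s)
      - nabOm (nY q X) r s t + nabOm (nY r X) q s t - nabOm (nY s X) q r t + nabOm (nY t X) q r s
      - nabOm X (brk L q r) s t + nabOm X (brk L q s) r t - nabOm X (brk L q t) r s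
      - nabOm X (brk L r s) q t + nabOm X (brk L r t) q s - nabOm X (brk L s t) q r
      + omega L q r (Rbas s t X) + omega L s t (Rbas q r X) - omega L q s (Rbas r t X) - omega L r t (Rbas q s X)
      + omega L q t (Rbas r s X) + omega L r s (Rbas q t X)
      + phi1B (omega L r s t) q X - phi1B (omega L q s t) r X + phi1B (omega L q r t) s X - phi1B (omega L q r s) t X = 0"
    (is "?lhs = 0")
proof -
  let ?C = "{q, r, s, t}"
  have m: "brk L (nQ Z a) c = - brk L c (nQ Z a)" if "c \<in> ?C" "a \<in> QQ" "Z \<in> XX" for a c Z
    using that brk_skew[of "nQ Z a" c] by auto
  have o1: "omega L c (brk L a b) d = - omega L (brk L a b) c d" "omega L d c (brk L a b) = - omega L d (brk L a b) c"
    if "c \<in> ?C" "a \<in> QQ" "b \<in> QQ" "d \<in> QQ" for a b c d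
    using that om_swap12[of c "brk L a b" d] om_swap23[of d c "brk L a b"] by auto
  have o2: "omega L c (nQ Z a) d = - omega L (nQ Z a) c d" "omega L d c (nQ Z a) = - omega L d (nQ Z a) c"
    if "c \<in> ?C" "a \<in> QQ" "Z \<in> XX" "d \<in> QQ" for a c d Z
    using that om_swap12[of c "nQ Z a" d] om_swap23[of d c "nQ Z a"] by auto
  have o3: "omega L (nQ Z e) (brk L a b) d = - omega L (brk L a b) (nQ Z e) d"
    if "e \<in> QQ" "a \<in> QQ" "b \<in> QQ" "d \<in> QQ" "Z \<in> XX" for a b d e Z
    using that om_swap12[of "nQ Z e" "brk L a b" d] by auto
  have "?lhs = nB X (d_omega L q r s t) - d_omega L (nQ X q) r s t - d_omega L q (nQ X r) s t
      - d_omega L q r (nQ X s) t - d_omega L q r s (nQ X t)"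
    by (simp add: d_omega_def nabOm_def nab_omega_def phi1B_def Rbas_def R_bas_def) (simp add: m o1 o2 o3)
  then show ?thesis by (simp add: axiom_v)
qed

text \<open>At \<open>X = \<rho>(u)\<close> the \<open>nB\<close> terms of \<open>phi1B\<close>
  cancel against those of \<open>\<phi>\<^sub>0\<close>, and what is left is the curvature axiom
  \<open>axiom_iv\<close>.\<close>

lemma qb_B:
  assumes [simp]: "q \<in> QQ" "b \<in> BD" "u \<in> QQ"
  shows "nabBd L q (nB (anchor L u) b - nabBd L u b) - (nB (anchor L (nbas q u)) b - nabBd L (nbas q u) b)
    - (nB (anchor L u) (nabBd L q b) - nabBd L u (nabBd L q b)) + omega L q (ell L b) u + phi1B b q (anchor L u) = 0"
  using om_swap23[of q u "ell L b"]
  by (simp add: om_ell phi1B_def rho_nbas) (simp add: nab_bas_def algebra_simps)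

text \<open>The derivative along \<open>X\<close> of \<open>axiom_ii\<close>.\<close>

lemma qb_Q:
  assumes [simp]: "q \<in> QQ" "b \<in> BD" "X \<in> XX"
  shows "nbas q (ell L (nB X b) - nQ X (ell L b)) - (ell L (nB (nY q X) b) - nQ (nY q X) (ell L b))
    - (ell L (nB X (nabBd L q b)) - nQ X (ell L (nabBd L q b))) + Rbas q (ell L b) X + ell L (phi1B b q X) = 0"
  using brk_skew[of "nQ X q" "ell L b"]
  by (simp add: nab_bas_def phi1B_def Rbas_def R_bas_def ell_nab algebra_simps)

text \<open>The derivative along \<open>X\<close> of \<open>axiom_iv\<close>; the anchor of the
  basic curvature turns into the curvature of \<open>nY\<close>, which the \<open>nB\<close> terms
  of \<open>phi1B\<close> compensate.\<close>

lemma qqb_B: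
  assumes [simp]: "q \<in> QQ" "r \<in> QQ" "b \<in> BD" "X \<in> XX"
  shows "nabBd L q (phi1B b r X) - nabBd L r (phi1B b q X) - phi1B b r (nY q X) + phi1B b q (nY r X) - phi1B b (brk L q r) X
    - phi1B (nabBd L q b) r X + phi1B (nabBd L r b) q X
    - omega L q r (ell L (nB X b) - nQ X (ell L b))
    + (nabBd L (Rbas q r X) b - nB (anchor L (Rbas q r X)) b) + nabOm X q r (ell L b) = 0"
  by (simp add: bas_curvature_TM phi1B_def) (simp add: nabOm_def nab_omega_def om_ell Rbas_def R_bas_def algebra_simps)

text \<open>The derivative along \<open>X\<close> of \<open>axiom_i\<close>, used for
  \<open>b\<close> and \<open>c\<close> and again with either of them differentiated.\<close>

lemma bb_B:
  assumes [simp]: "b \<in> BD" "c \<in> BD" "X \<in> XX"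
  shows "(nB (anchor L (ell L (nB X c) - nQ X (ell L c))) b - nabBd L (ell L (nB X c) - nQ X (ell L c)) b)
    + (nB (anchor L (ell L (nB X b) - nQ X (ell L b))) c - nabBd L (ell L (nB X b) - nQ X (ell L b)) c)
    + phi1B c (ell L b) X + phi1B b (ell L c) X = 0"
  using axiom_i[of "nB X c" b] axiom_i[of "nB X b" c] axiom_i[of b c]
  by (simp add: phi1B_def algebra_simps)

section \<open>The adjoint structure objects as an instance\<close>

lemma adj_elems: "elems (adj_module L) = BD \<times> QQ \<times> XX"
  by (simp add: adj_module_def secX_eq)

lemma adj_scl: "scl (adj_module L) f (\<beta>, q, X) = (fscale f \<beta>, pscale f q, fscale f X)"
  by (simp add: adj_module_def secX_eq)

lemma R_bas_R: "R_bas L nQ = Rbas" and nab_omega_nabOm: "nab_omega L nQ nB X q r s = nabOm X q r s"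
  by (simp_all add: Rbas_def nabOm_def)

lemma adj_ops:
  "adj_diff L (\<beta>, u, X) = (0, - ell L \<beta>, anchor L u)"
  "adj_nab L nQ q (\<beta>, u, X) = (nabBd L q \<beta>, nbas q u, nY q X)"
  "adj_omega2 L nQ q r (\<beta>, u, X) = (- omega L q r u, - Rbas q r X, 0)"
  "adj_omega3 L nQ nB q r s (\<beta>, u, X) = (nabOm X q r s, 0, 0)"
  "adj_phi0 L nQ nB b (\<beta>, u, X) = (nB (anchor L u) b - nabBd L u b, ell L (nB X b) - nQ X (ell L b), 0)"
  "adj_phi1 L nQ nB b q (\<beta>, u, X) = (phi1B b q X, 0, 0)"
  by (simp_all add: adj_diff_def adj_nab_def adj_omega2_def adj_omega3_def adj_phi0_def adj_phi1_def
      R_bas_R nab_omega_nabOm phi1B_def)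

lemma nbas_simps [simp]:
  "q \<in> QQ \<Longrightarrow> r \<in> QQ \<Longrightarrow> s \<in> QQ \<Longrightarrow> nbas q (r + s) = nbas q r + nbas q s"
  "q \<in> QQ \<Longrightarrow> r \<in> QQ \<Longrightarrow> s \<in> QQ \<Longrightarrow> nbas (q + r) s = nbas q s + nbas r s"
  "f \<in> Fs \<Longrightarrow> q \<in> QQ \<Longrightarrow> r \<in> QQ \<Longrightarrow> nbas q (pscale f r) = pscale f (nbas q r) + pscale (anchor L q f) r"
  "f \<in> Fs \<Longrightarrow> q \<in> QQ \<Longrightarrow> r \<in> QQ \<Longrightarrow> nbas (pscale f q) r = pscale f (nbas q r)"
  by (simp_all add: nab_bas_def pscale_algebra)

lemma zero_simps [simp]:
  "q \<in> QQ \<Longrightarrow> nbas q 0 = 0" "q \<in> QQ \<Longrightarrow> s \<in> QQ \<Longrightarrow> nbas q (- s) = - nbas q s"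
  "q \<in> QQ \<Longrightarrow> r \<in> QQ \<Longrightarrow> Rbas q r 0 = 0"
  "q \<in> QQ \<Longrightarrow> r \<in> QQ \<Longrightarrow> s \<in> QQ \<Longrightarrow> nabOm 0 q r s = 0"
  "b \<in> BD \<Longrightarrow> q \<in> QQ \<Longrightarrow> phi1B b q 0 = 0"
  by (simp_all add: nab_bas_def Rbas_def R_bas_def nabOm_def nab_omega_def phi1B_def)

lemma Rbas_alt: assumes "q \<in> QQ" "X \<in> XX" shows "Rbas q q X = 0"
  using Rbas_skew[OF assms(1,1,2)] two_cancel[of "Rbas q q X"] by (metis add.right_inverse)

lemma nabOm_alt: assumes "q \<in> QQ" "r \<in> QQ" "X \<in> XX" shows "nabOm X q q r = 0" "nabOm X r q q = 0"
proof -
  have c: "x = 0" if "x = - x" for x :: "('m, 'b) dsection"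
  proof (intro ext)
    fix c p show "x c p = 0 c p" using fun_cong[OF fun_cong[OF that, of c], of p] by (simp add: fun_apply)
  qed
  show "nabOm X q q r = 0" by (rule c[OF nabOm_skew(1)[OF assms(1,1,2,3)]])
  show "nabOm X r q q = 0" by (rule c[OF nabOm_skew(2)[OF assms(2,1,1,3)]])
qed

lemma adj_grading_iff:
  "(\<beta>, u, X) \<in> adj_grading L i \<longleftrightarrow> \<beta> \<in> BD \<and> u \<in> QQ \<and> X \<in> XX \<and>
    (i \<noteq> -2 \<longrightarrow> \<beta> = 0) \<and> (i \<noteq> -1 \<longrightarrow> u = 0) \<and> (i \<noteq> 0 \<longrightarrow> X = 0)"
  by (auto simp: adj_grading_def adj_elems)

lemma adj_grading_sub: "subgrp (adj_grading L i)"
proof (rule subgrpI)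
  show "0 \<in> adj_grading L i" by (simp add: adj_grading_def adj_elems zero_prod_def)
qed (auto simp: adj_grading_def adj_elems)

lemma triple_zero: "(0, 0, 0) = (0 :: ('m, 'q, 'b) triple)"
  by (simp add: zero_prod_def)

lemma adjoint_rep_data:
  "rep_data L (adj_module L) (adj_grading L) (adj_diff L) (adj_nab L nQ) (adj_omega2 L nQ)
     (adj_omega3 L nQ nB) (adj_phi0 L nQ nB) (adj_phi1 L nQ nB)"
proof (unfold_locales, goal_cases)
  case 1
  show ?case using subgrp_closed[OF sub(1)] by (auto intro!: subgrpI simp: adj_elems zero_prod_def)
next
  case (5 i)
  show ?case by (rule adj_grading_sub)
next
  case (6 i)
  show ?case by (auto simp: adj_grading_def)
next
  case (7 i)
  then have "adj_grading L i = {(0, 0, 0)}" by (auto simp: adj_grading_def adj_elems)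
  then show ?case by (simp add: zero_prod_def)
next
  case (8 x)
  obtain \<beta> u X where x: "x = (\<beta>, u, X)" by (metis prod.collapse)
  show ?case
    using 8 by (intro bexI[of _ "(\<beta>, 0, 0)"] bexI[of _ "(0, u, 0)"] bexI[of _ "(0, 0, X)"])
      (auto simp: x adj_grading_def adj_elems)
next
  \<comment> \<open>Cases 39 to 41 are the skew-symmetry of \<open>adj_omega2\<close> and
    \<open>adj_omega3\<close>, and case 49 is the degree of \<open>adj_phi0\<close>. The closing
    simplification covers additivity, linearity over functions and the other degrees.\<close>
  case (39 x q r)
  then show ?case using om_swap12[of q r] Rbas_skew[of q r] by (cases x) (simp add: adj_elems adj_ops)
next
  case (40 x q r s)
  then show ?case using nabOm_skew(1)[of q r s] by (cases x) (simp add: adj_elems adj_ops)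
next
  case (41 x q r s)
  then show ?case using nabOm_skew(2)[of q r s] by (cases x) (simp add: adj_elems adj_ops)
next
  case (49 x i b)
  then show ?case by (cases x) (auto simp: adj_grading_iff adj_ops)
qed (clarsimp simp: adj_elems adj_scl adj_ops adj_grading_def Rbas_alt nabOm_alt triple_zero fscale_algebra pscale_algebra algebra_simps)+

text \<open>Each equation splits along the summands of the coefficient: \<open>\<beta>\<close> meets
  the axioms themselves, \<open>u\<close> their rewritten forms such as
  \<open>bas_curvature_Q\<close>, \<open>qqq_B\<close> and \<open>qb_B\<close>, and
  \<open>X\<close>, in the higher arities, the axioms differentiated along \<open>X\<close>.\<close>

lemma adjoint_flat:
  "flat_rep_data L (adj_module L) (adj_grading L) (adj_diff L) (adj_nab L nQ) (adj_omega2 L nQ)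
     (adj_omega3 L nQ nB) (adj_phi0 L nQ nB) (adj_phi1 L nQ nB)"
proof (rule flat_rep_data.intro[OF adjoint_rep_data], unfold_locales, goal_cases)
  case (1 x)
  then show ?case by (cases x) (simp add: adj_elems adj_ops zero_prod_def)
next
  case (2 x q)
  then show ?case by (cases x) (simp add: adj_elems adj_ops zero_prod_def axiom_ii nY_rho nab_bas_def)
next
  case (3 x q r)
  then obtain \<beta> u X where x: "x = (\<beta>, u, X)" "\<beta> \<in> BD" "u \<in> QQ" "X \<in> XX" by (auto simp: adj_elems)
  then show ?case
    using 3 bas_curvature_Q[of q r u] bas_curvature_TM[of q r X] om_ell[of q r \<beta>]
    by (simp add: adj_ops zero_prod_def)
next
  case (4 x q r s)
  then obtain \<beta> u X where x: "x = (\<beta>, u, X)" "\<beta> \<in> BD" "u \<in> QQ" "X \<in> XX" by (auto simp: adj_elems)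
  then show ?case
    using 4 qqq_B[of q r s u] qqq_Q[of q r s X]
    by (simp add: adj_ops zero_prod_def; simp add: algebra_simps)
next
  case (5 x q r s t)
  then obtain \<beta> u X where x: "x = (\<beta>, u, X)" "\<beta> \<in> BD" "u \<in> QQ" "X \<in> XX" by (auto simp: adj_elems)
  then show ?case
    using 5 qqqq_B[of q r s t X] by (simp add: adj_ops zero_prod_def)
next
  case (6 x b)
  then obtain \<beta> u X where x: "x = (\<beta>, u, X)" "\<beta> \<in> BD" "u \<in> QQ" "X \<in> XX" by (auto simp: adj_elems)
  then show ?case
    using 6 axiom_i[of b \<beta>] brk_skew[of "ell L b" u] axiom_ii[of u b]
    by (simp add: adj_ops zero_prod_def nab_bas_def)
next
  case (7 x q b)
  then obtain \<beta> u X where x: "x = (\<beta>, u, X)" "\<beta> \<in> BD" "u \<in> QQ" "X \<in> XX" by (auto simp: adj_elems)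
  then show ?case
    using 7 qb_B[of q b u] qb_Q[of q b X]
    by (simp add: adj_ops zero_prod_def; simp add: algebra_simps)
next
  case (8 x q r b)
  then obtain \<beta> u X where x: "x = (\<beta>, u, X)" "\<beta> \<in> BD" "u \<in> QQ" "X \<in> XX" by (auto simp: adj_elems)
  then show ?case
    using 8 qqb_B[of q r b X]
    by (simp add: adj_ops zero_prod_def; simp add: algebra_simps)
next
  case (9 x b c)
  then obtain \<beta> u X where x: "x = (\<beta>, u, X)" "\<beta> \<in> BD" "u \<in> QQ" "X \<in> XX" by (auto simp: adj_elems)
  then show ?case
    using 9 bb_B[of b c X] by (simp add: adj_ops zero_prod_def)
qed

end

theorem proposition6p3p1:
  fixes L :: "('m::{t2_space,second_countable_topology}, 'q::real_vector, 'b::real_vector) split_data"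
    and nQ :: "'m vfield \<Rightarrow> ('m \<Rightarrow> 'q) \<Rightarrow> ('m \<Rightarrow> 'q)"
    and nB :: "'m vfield \<Rightarrow> ('m, 'b) dsection \<Rightarrow> ('m, 'b) dsection"
  assumes "split_lie_2_algebroid L"
    and "TM_connection (base L) (secQ L) nQ"
    and "TM_connection (base L) (secBd L) nB"
  shows "\<exists>\<Q> \<D>. homological_vector_field L \<Q> \<and>
           rep_up_to_homotopy L \<Q> (adj_module L) (adj_grading L) \<D> \<and>
           has_structure_objects L (adj_module L) \<D>
             (adj_diff L) (adj_nab L nQ) (adj_omega2 L nQ) (adj_omega3 L nQ nB)
             (adj_phi0 L nQ nB) (adj_phi1 L nQ nB)"
proof -
  interpret adjoint_data L nQ nB
    using assms by unfold_locales
  interpret A: flat_rep_data L "adj_module L" "adj_grading L" "adj_diff L" "adj_nab L nQ" "adj_omega2 L nQ"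
     "adj_omega3 L nQ nB" "adj_phi0 L nQ nB" "adj_phi1 L nQ nB"
    by (rule adjoint_flat)
  show ?thesis
    unfolding rep_up_to_homotopy_def
    using homological A.rep_op_derivation A.rep_op_square A.has_structure by blast
qed

end
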